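(* Let $K/\mathbf{Q}$ be a finite extension, with $K\subset\overline{\mathbf{Q}}$, and let $R_K=\mathrm{Int}_{\mathbf{Q}}(\mathcal{O}_K)$. Then $K/\mathbf{Q}$ is a Galois extension if and only if \[\{\alpha\in\overline{\mathbf{Z}} \mid R_K(\alpha)\subset\overline{\mathbf{Z}}\}=\mathcal{O}_K.\] In particular, if $K$ and $K'$ are two finite Galois extensions of $\mathbf{Q}$ (inside $\overline{\mathbf{Q}}$) such that $\mathrm{Int}_{\mathbf{Q}}(\mathcal{O}_K)=\mathrm{Int}_{\mathbf{Q}}(\mathcal{O}_{K'})$, then $K=K'$.
   Context: Fix an algebraic closure $\overline{\mathbf{Q}}$ of $\mathbf{Q}$; $\overline{\mathbf{Z}}$ denotes the ring of all algebraic integers in $\overline{\mathbf{Q}}$. For a number field $K$, $\mathcal{O}_K$ is its ring of algebraic integers and $\mathrm{Int}_{\mathbf{Q}}(\mathcal{O}_K):=\{f\in\mathbf{Q}[X] \mid f(\mathcal{O}_K)\subseteq\mathcal{O}_K\}$. For a subring $R$ of $\mathbf{Q}[X]$ and $\alpha\in\overline{\mathbf{Z}}$, $R(\alpha):=\{f(\alpha)\mid f\in R\}\subseteq\mathbf{Q}(\alpha)$. *)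

theory Defs
  imports "HOL-Computational_Algebra.Polynomial"
begin

text \<open>
  An algebraic closure of the rationals is rendered as a type \<open>'a\<close> of sort
  \<open>{alg_closed_field, field_char_0}\<close> all of whose elements are algebraic (the latter is
  an assumption of the theorem). Number fields are subsets of \<open>'a\<close>, and a rational number
  is identified with its image under \<^const>\<open>of_rat\<close>.
\<close>

definition eval_rat :: "rat poly \<Rightarrow> 'a::field_char_0 \<Rightarrow> 'a" where
  "eval_rat f x = poly (map_poly of_rat f) x"

definition alg_ints :: "'a::field_char_0 set" where
  "alg_ints = {x. algebraic_int x}"

text \<open>Closure under \<^const>\<open>inverse\<close> may include \<open>0\<close>, since \<open>inverse 0 = 0\<close>;
  \<open>0 = 1 - 1\<close> and closure under addition are consequences.\<close>

definition is_subfield :: "'a::field set \<Rightarrow> bool" where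
  "is_subfield K \<longleftrightarrow> 1 \<in> K \<and>
     (\<forall>x\<in>K. \<forall>y\<in>K. x - y \<in> K \<and> x * y \<in> K) \<and> (\<forall>x\<in>K. inverse x \<in> K)"

definition number_field :: "'a::field_char_0 set \<Rightarrow> bool" where
  "number_field K \<longleftrightarrow> is_subfield K \<and>
     (\<exists>B. finite B \<and> K = module.span (\<lambda>(q::rat) x. of_rat q * x) B)"

definition ring_of_ints :: "'a::field_char_0 set \<Rightarrow> 'a set" where
  "ring_of_ints K = K \<inter> alg_ints"

definition Int_Q :: "'a::field_char_0 set \<Rightarrow> rat poly set" where
  "Int_Q D = {f. eval_rat f ` D \<subseteq> D}"

definition values_at :: "rat poly set \<Rightarrow> 'a::field_char_0 \<Rightarrow> 'a set" where
  "values_at R \<alpha> = {eval_rat f \<alpha> | f. f \<in> R}"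

text \<open>Both notions below are for algebraic extensions of the rationals.\<close>

definition normal_over_Q :: "'a::field_char_0 set \<Rightarrow> bool" where
  "normal_over_Q K \<longleftrightarrow>
     (\<forall>p::rat poly. irreducible p \<and> (\<exists>x\<in>K. eval_rat p x = 0) \<longrightarrow>
        (\<exists>c xs. set xs \<subseteq> K \<and> map_poly of_rat p = smult c (\<Prod>x\<leftarrow>xs. [:- x, 1:])))"

text \<open>\<^const>\<open>rsquarefree\<close> says that all roots in \<open>'a\<close> are simple, which for an algebraically
  closed \<open>'a\<close> is separability of the polynomial.\<close>

definition separable_over_Q :: "'a::field_char_0 set \<Rightarrow> bool" where
  "separable_over_Q K \<longleftrightarrow>
     (\<forall>p::rat poly. irreducible p \<and> (\<exists>x\<in>K. eval_rat p x = 0) \<longrightarrow>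
        rsquarefree (map_poly of_rat p :: 'a poly))"

definition galois_over_Q :: "'a::field_char_0 set \<Rightarrow> bool" where
  "galois_over_Q K \<longleftrightarrow> normal_over_Q K \<and> separable_over_Q K"

end

theory Submission
  imports Defs "Jordan_Normal_Form.Char_Poly" "HOL-Analysis.Convex"
    "HOL-Computational_Algebra.Polynomial_Factorial" "HOL-Computational_Algebra.Field_as_Ring"
    "HOL-Computational_Algebra.Primes" "HOL-Computational_Algebra.Fundamental_Theorem_Algebra"
begin

text \<open>
  The set of algebraic integers at which all of \<open>Int\<^sub>\<rat>(O\<^sub>K)\<close> takes integral values contains \<open>O\<^sub>K\<close>
  and is closed under conjugation over \<open>\<rat>\<close>; if it equals \<open>O\<^sub>K\<close>, then \<open>K\<close> is normal.

  For the converse let \<open>K = \<rat>(\<theta>)\<close> be Galois of degree \<open>d\<close>. If \<open>\<theta>\<^sup>p \<equiv> \<theta>\<close> modulo a large prime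
  \<open>p\<close> (that is, if \<open>p\<close> splits completely), then \<open>(X\<^sup>p - X) / p\<close> lies in \<open>Int\<^sub>\<rat>(O\<^sub>K)\<close>, so that
  \<open>\<alpha>\<^sup>p \<equiv> \<alpha>\<close> modulo \<open>p\<close> for every \<open>\<alpha>\<close> in the set. If \<open>\<alpha>\<close> were not in \<open>K\<close>, all these primes would
  split completely in the normal closure of \<open>K(\<alpha>)\<close>, whose degree \<open>D\<close> is at least \<open>2d\<close>. This
  contradicts Bauer's theorem, of which two elementary weak forms suffice. The sum of
  \<open>ln p / p\<close> over the completely split primes \<open>p \<le> X\<close> is at most about \<open>(8/7) ln X / D\<close>:
  among the elements of a box of coordinate vectors, the pigeonhole principle forces many
  differences to be divisible by primes above \<open>p\<close>, while their norms are small. In \<open>K\<close> it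
  is at least about \<open>(2/3) ln X / d\<close>: the norms of most elements of a suitable shifted box are
  squarefree products of completely split primes, and an ideal of index \<open>p\<close> contains at most
  about a \<open>p\<close>-th part of the box.
\<close>

text \<open>Because \<open>D \<ge> 2d\<close>, any two bounds whose constants differ by a factor
  below 2 contradict each other, so no density theorem is needed. With X = \<open>n^d\<close> the
  upper bound grows like (4/7) ln n and the lower one like (2/3) ln n. Here 7/8 is what remains
  after removing the diagonal pairs, and 2/3 = (3/4) / (9/8) combines the discarded quarter of the
  box with the error of the point count.

  Ideal theory of \<open>O\<^sub>K\<close> is avoided. Computations take place in
  \<open>\<int>[\<theta>]\<close>, whose elements are integer polynomials of degree below d; the
  finitely many primes at which denominators or coinciding residues matter are excluded by lower
  bounds on p. Congruences are taken in the ring of all algebraic integers, and a single prime ideal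
  P of that ring above p suffices: evaluating a polynomial at the various conjugates and testing
  membership in P gives the primes of \<open>\<int>[\<theta>]\<close> above p.

  The abstract field carries no absolute value, so the size of a norm is estimated at a complex root
  of the minimal polynomial.\<close>

hide_const (open) Module.smult

section \<open>Evaluation of rational and integer polynomials\<close>

abbreviation eval_int :: "int poly \<Rightarrow> 'a::comm_ring_1 \<Rightarrow> 'a" where
  "eval_int g x \<equiv> poly (map_poly of_int g) x"

lemma map_poly_of_rat_hom:
  "map_poly_inj_idom_hom (of_rat :: rat \<Rightarrow> 'a::field_char_0)"
  by unfold_locales auto

context
begin

interpretation of_rat_poly_hom: map_poly_inj_idom_hom "of_rat :: rat \<Rightarrow> 'a::field_char_0"
  by (rule map_poly_of_rat_hom)

lemma eval_rat_simps [simp]: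
  fixes x :: "'a::field_char_0"
  shows "eval_rat 0 x = 0" "eval_rat 1 x = 1"
    "eval_rat [:c:] x = of_rat c" "eval_rat [:0, 1:] x = x"
    "eval_rat (f + g) x = eval_rat f x + eval_rat g x"
    "eval_rat (f - g) x = eval_rat f x - eval_rat g x"
    "eval_rat (- f) x = - eval_rat f x"
    "eval_rat (f * g) x = eval_rat f x * eval_rat g x"
    "eval_rat (f ^ n) x = eval_rat f x ^ n"
    "eval_rat (smult c f) x = of_rat c * eval_rat f x"
    "eval_rat (pCons c f) x = of_rat c + x * eval_rat f x"
    "eval_rat (monom c n) x = of_rat c * x ^ n"
    "eval_rat (pcompose f g) x = eval_rat f (eval_rat g x)"
  by (simp_all add: eval_rat_def hom_distribs map_poly_pCons map_poly_smult of_rat_mult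
      poly_monom map_poly_monom poly_pcompose)

lemma eval_rat_sum: "eval_rat (sum f A) x = (\<Sum>a\<in>A. eval_rat (f a) x)"
  by (induction A rule: infinite_finite_induct) auto

lemma eval_rat_prod: "eval_rat (prod f A) x = (\<Prod>a\<in>A. eval_rat (f a) x)"
  by (induction A rule: infinite_finite_induct) auto

lemma eval_rat_int: 
  fixes x :: "'a::field_char_0"
  shows "eval_rat (map_poly of_int g) x = eval_int g x"
proof -
  have "map_poly of_rat (map_poly of_int g :: rat poly) = (map_poly of_int g :: 'a poly)"
    by (rule poly_eqI) (simp add: coeff_map_poly)
  thus ?thesis by (simp add: eval_rat_def)
qed

lemma degree_map_poly_of_rat [simp]: "degree (map_poly of_rat f :: 'a::field_char_0 poly) = degree f"
  by (rule degree_map_poly) auto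

lemma map_poly_of_rat_eq_0 [simp]: "(map_poly of_rat f :: 'a::field_char_0 poly) = 0 \<longleftrightarrow> f = 0"
  by (auto simp: poly_eq_iff coeff_map_poly)

end

lemma eval_int_simps [simp]:
  fixes x :: "'a::comm_ring_1"
  shows "eval_int (f + g) x = eval_int f x + eval_int g x"
    "eval_int (f - g) x = eval_int f x - eval_int g x"
    "eval_int (f * g) x = eval_int f x * eval_int g x"
    "eval_int (f ^ n) x = eval_int f x ^ n"
    "eval_int (smult c f) x = of_int c * eval_int f x"
    "eval_int (pCons c f) x = of_int c + x * eval_int f x"
    "eval_int (monom c n) x = of_int c * x ^ n"
    "eval_int (of_int c) x = of_int c"
    "eval_int (of_nat m) x = of_nat m"
  by (simp_all add: hom_distribs poly_monom of_int_poly of_nat_poly map_poly_pCons)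

lemma eval_int_sum: "eval_int (sum f A) x = (\<Sum>a\<in>A. eval_int (f a) x)"
  by (induction A rule: infinite_finite_induct) auto

lemma eval_int_altdef: 
  assumes "degree g < n"
  shows "eval_int g x = (\<Sum>i<n. of_int (coeff g i) * x ^ i)"
proof -
  have "g = (\<Sum>i<n. monom (coeff g i) i)"
    using assms by (intro poly_eqI) (auto simp: coeff_sum coeff_eq_0)
  hence "eval_int g x = eval_int (\<Sum>i<n. monom (coeff g i) i) x" by simp
  thus ?thesis by (simp add: eval_int_sum map_poly_monom poly_monom)
qed

section \<open>The ring of algebraic integers\<close>

text \<open>The determinant trick: multiplication by \<open>z\<close> acts on the vector
  \<open>w\<close> as an integer matrix, so \<open>z\<close> is a root of its characteristic
  polynomial, which is monic. The nonzero entry makes \<open>w\<close> an eigenvector.\<close>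

lemma algebraic_int_criterion_nat:
  fixes z :: "'a::field_char_0" and w :: "nat \<Rightarrow> 'a"
  assumes nz: "k < n" "w k \<noteq> 0"
    and step: "\<And>i. i < n \<Longrightarrow> \<exists>c. z * w i = (\<Sum>j<n. of_int (c j) * w j)"
  shows "algebraic_int z"
proof -
  from step obtain c where c: "\<And>i. i < n \<Longrightarrow> z * w i = (\<Sum>j<n. of_int (c i j) * w j)"
    by metis
  define A where "A = mat n n (\<lambda>(i, j). c i j)"
  define v where "v = vec n w"
  have A: "A \<in> carrier_mat n n" by (simp add: A_def)
  have A': "(map_mat of_int A :: 'a mat) \<in> carrier_mat n n" by (simp add: A_def)
  have "map_mat of_int A *\<^sub>v v = z \<cdot>\<^sub>v v"
  proof (rule eq_vecI)
    fix i assume "i < dim_vec (z \<cdot>\<^sub>v v)"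
    hence i: "i < n" by (simp add: v_def)
    thus "(map_mat of_int A *\<^sub>v v) $ i = (z \<cdot>\<^sub>v v) $ i"
      using c[OF i] by (simp add: A_def v_def scalar_prod_def lessThan_atLeast0)
  qed (simp add: A_def v_def)
  moreover have "v \<noteq> 0\<^sub>v n"
    using nz by (metis index_vec index_zero_vec(1) v_def)
  ultimately have "eigenvector (map_mat of_int A) v z"
    by (simp add: eigenvector_def A_def v_def)
  hence "eigenvalue (map_mat of_int A :: 'a mat) z" by (auto simp: eigenvalue_def)
  hence "poly (char_poly (map_mat of_int A :: 'a mat)) z = 0"
    using eigenvalue_root_char_poly[OF A'] by simp
  hence "poly (map_poly of_int (char_poly A)) z = 0"
    by (simp add: of_int_hom.char_poly_hom[OF A])
  thus ?thesis
    using degree_monic_char_poly[OF A] by (auto simp: algebraic_int_altdef_ipoly)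
qed

lemma algebraic_int_criterion:
  fixes z :: "'a::field_char_0" and w :: "'b \<Rightarrow> 'a"
  assumes fin: "finite I" and nz: "k \<in> I" "w k \<noteq> 0"
    and step: "\<And>i. i \<in> I \<Longrightarrow> \<exists>c. z * w i = (\<Sum>j\<in>I. of_int (c j) * w j)"
  shows "algebraic_int z"
proof -
  obtain h where h: "bij_betw h {..<card I} I"
    using fin by (metis atLeast0LessThan ex_bij_betw_nat_finite)
  from nz(1) h obtain k' where k': "k' < card I" "h k' = k"
    by (metis bij_betw_def imageE lessThan_iff)
  show ?thesis
  proof (rule algebraic_int_criterion_nat)
    show "k' < card I" "w (h k') \<noteq> 0" using k' nz by auto
    fix i assume "i < card I"
    hence "h i \<in> I" using h by (auto simp: bij_betw_def)
    from step[OF this] obtain c where "z * w (h i) = (\<Sum>j\<in>I. of_int (c j) * w j)" by blast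
    also have "\<dots> = (\<Sum>j<card I. of_int (c (h j)) * w (h j))"
      by (rule sum.reindex_bij_betw[OF h, symmetric])
    finally show "\<exists>c. z * w (h i) = (\<Sum>j<card I. of_int (c j) * w (h j))"
      by (intro exI[of _ "\<lambda>j. c (h j)"])
  qed
qed

lemma algebraic_int_power_reduce:
  fixes x :: "'a::field_char_0"
  assumes "algebraic_int x"
  obtains n c where "n > 0" "x ^ n = (\<Sum>i<n. of_int (c i) * x ^ i)"
proof -
  from assms obtain p where p: "poly (map_poly of_int p) x = 0" "lead_coeff p = 1"
    by (auto simp: algebraic_int_altdef_ipoly)
  define n where "n = degree p"
  have "p \<noteq> 1" using p by auto
  hence n: "n > 0" using p unfolding n_def by (metis gr0I monic_degree_0)
  have "eval_int p x = (\<Sum>i<Suc n. of_int (coeff p i) * x ^ i)"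
    by (rule eval_int_altdef) (simp add: n_def)
  also have "\<dots> = (\<Sum>i<n. of_int (coeff p i) * x ^ i) + x ^ n"
    using p by (simp add: n_def)
  finally have "x ^ n = - (\<Sum>i<n. of_int (coeff p i) * x ^ i)"
    using p by (simp add: add_eq_0_iff2)
  also have "\<dots> = (\<Sum>i<n. of_int (- coeff p i) * x ^ i)"
    by (simp add: sum_negf)
  finally have "x ^ n = (\<Sum>i<n. of_int (- coeff p i) * x ^ i)" .
  with that[of n "\<lambda>i. - coeff p i"] n show ?thesis by simp
qed

text \<open>The monomials \<open>x^i * y^j\<close> below the degrees of two monic integral relations
  span a group \<open>M\<close> that is stable under multiplication by \<open>x\<close> and by
  \<open>y\<close>, so the determinant trick applies to both the sum and the product.\<close>

lemma
  fixes x y :: "'a::field_char_0"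
  assumes "algebraic_int x" "algebraic_int y"
  shows algebraic_int_plus: "algebraic_int (x + y)"
    and algebraic_int_times: "algebraic_int (x * y)"
proof -
  obtain n c where n: "n > 0" "x ^ n = (\<Sum>i<n. of_int (c i) * x ^ i)"
    using algebraic_int_power_reduce[OF assms(1)] by blast
  obtain m d where m: "m > 0" "y ^ m = (\<Sum>i<m. of_int (d i) * y ^ i)"
    using algebraic_int_power_reduce[OF assms(2)] by blast
  define I where "I = {..<n} \<times> {..<m}"
  define w where "w = (\<lambda>(i, j). x ^ i * y ^ j)"
  define M where "M = {u. \<exists>e. u = (\<Sum>k\<in>I. of_int (e k) * w k)}"
  have fin: "finite I" by (simp add: I_def)
  have M_add: "u + v \<in> M" if "u \<in> M" "v \<in> M" for u v
  proof -
    from that obtain e e' where "u = (\<Sum>k\<in>I. of_int (e k) * w k)" "v = (\<Sum>k\<in>I. of_int (e' k) * w k)"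
      by (auto simp: M_def)
    hence "u + v = (\<Sum>k\<in>I. of_int (e k + e' k) * w k)"
      by (simp add: sum.distrib algebra_simps)
    thus ?thesis unfolding M_def by (intro CollectI exI[of _ "\<lambda>k. e k + e' k"])
  qed
  have M_mult: "of_int a * u \<in> M" if "u \<in> M" for u a
  proof -
    from that obtain e where "u = (\<Sum>k\<in>I. of_int (e k) * w k)"
      by (auto simp: M_def)
    hence "of_int a * u = (\<Sum>k\<in>I. of_int (a * e k) * w k)"
      by (simp add: sum_distrib_left algebra_simps)
    thus ?thesis unfolding M_def by (intro CollectI exI[of _ "\<lambda>k. a * e k"])
  qed
  have M_w: "w k \<in> M" if "k \<in> I" for k
    unfolding M_def using fin that
    by (intro CollectI exI[of _ "\<lambda>j. if j = k then 1 else 0"]) (auto simp: if_distrib[of "\<lambda>x. x * _"] if_distrib[of of_int] sum.delta cong: if_cong)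
  have M_0: "0 \<in> M" unfolding M_def by (intro CollectI exI[of _ "\<lambda>_. 0"]) simp
  have M_sum: "(\<Sum>i\<in>J. of_int (g i) * u i) \<in> M" if "\<And>i. i \<in> J \<Longrightarrow> u i \<in> M"
    for J :: "nat set" and g u
    using that by (induction J rule: infinite_finite_induct) (auto simp: M_0 intro!: M_add M_mult)
  have x_w: "x * w k \<in> M" if "k \<in> I" for k
  proof -
    from that obtain i j where k: "k = (i, j)" "i < n" "j < m" by (auto simp: I_def)
    show ?thesis
    proof (cases "Suc i < n")
      case True
      with k have "w (Suc i, j) \<in> M" by (intro M_w) (auto simp: I_def)
      thus ?thesis by (simp add: w_def k algebra_simps)
    next
      case False
      with k have n': "n = Suc i" by simp
      have "x * w k = x ^ n * y ^ j"
        by (simp add: w_def k n')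
      also have "\<dots> = (\<Sum>l<n. of_int (c l) * w (l, j))"
        unfolding n(2) by (simp add: w_def sum_distrib_left mult_ac)
      also have "\<dots> \<in> M" using k by (intro M_sum M_w) (auto simp: I_def)
      finally show ?thesis .
    qed
  qed
  have y_w: "y * w k \<in> M" if "k \<in> I" for k
  proof -
    from that obtain i j where k: "k = (i, j)" "i < n" "j < m" by (auto simp: I_def)
    show ?thesis
    proof (cases "Suc j < m")
      case True
      with k have "w (i, Suc j) \<in> M" by (intro M_w) (auto simp: I_def)
      thus ?thesis by (simp add: w_def k algebra_simps)
    next
      case False
      with k have m': "m = Suc j" by simp
      have "y * w k = x ^ i * y ^ m"
        by (simp add: w_def k m')
      also have "\<dots> = (\<Sum>l<m. of_int (d l) * w (i, l))"
        unfolding m(2) by (simp add: w_def sum_distrib_left mult_ac)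
      also have "\<dots> \<in> M" using k by (intro M_sum M_w) (auto simp: I_def)
      finally show ?thesis .
    qed
  qed
  have y_M: "y * u \<in> M" if "u \<in> M" for u
  proof -
    from that obtain e where "u = (\<Sum>k\<in>I. of_int (e k) * w k)" by (auto simp: M_def)
    hence "y * u = (\<Sum>k\<in>I. of_int (e k) * (y * w k))"
      by (simp add: sum_distrib_left mult_ac)
    moreover have "(\<Sum>k\<in>J. of_int (e k) * (y * w k)) \<in> M" if "J \<subseteq> I" for J
      using finite_subset[OF that fin] that 
      by (induction J rule: finite_induct) (auto simp: M_0 intro!: M_add M_mult y_w)
    ultimately show ?thesis by simp
  qed
  have one: "(0, 0) \<in> I" "w (0, 0) \<noteq> 0" using n m by (auto simp: I_def w_def)
  show "algebraic_int (x + y)"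
  proof (rule algebraic_int_criterion[where w = w and k = "(0, 0)", OF fin one])
    fix k assume "k \<in> I"
    hence "x * w k + y * w k \<in> M" by (intro M_add x_w y_w)
    thus "\<exists>e. (x + y) * w k = (\<Sum>j\<in>I. of_int (e j) * w j)"
      by (simp add: M_def algebra_simps)
  qed
  show "algebraic_int (x * y)"
  proof (rule algebraic_int_criterion[where w = w and k = "(0, 0)", OF fin one])
    fix k assume "k \<in> I"
    hence "y * (x * w k) \<in> M" by (intro y_M x_w)
    thus "\<exists>e. (x * y) * w k = (\<Sum>j\<in>I. of_int (e j) * w j)"
      by (simp add: M_def mult_ac)
  qed
qed

lemma alg_ints_0 [simp]: "0 \<in> alg_ints"
  and alg_ints_1 [simp]: "1 \<in> alg_ints"
  and alg_ints_of_int [simp]: "of_int k \<in> alg_ints"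
  and alg_ints_of_nat [simp]: "of_nat m \<in> alg_ints"
  by (auto simp: alg_ints_def intro: int_imp_algebraic_int)

lemma alg_ints_add: "x \<in> alg_ints \<Longrightarrow> y \<in> alg_ints \<Longrightarrow> x + y \<in> alg_ints"
  by (simp add: alg_ints_def algebraic_int_plus)

lemma alg_ints_mult: "x \<in> alg_ints \<Longrightarrow> y \<in> alg_ints \<Longrightarrow> x * y \<in> alg_ints"
  by (simp add: alg_ints_def algebraic_int_times)

lemma alg_ints_uminus: "x \<in> alg_ints \<Longrightarrow> - x \<in> alg_ints"
  by (simp add: alg_ints_def)

lemma alg_ints_diff: "x \<in> alg_ints \<Longrightarrow> y \<in> alg_ints \<Longrightarrow> x - y \<in> alg_ints"
  using alg_ints_add[of x "- y"] alg_ints_uminus[of y] by simp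

lemma alg_ints_power: "x \<in> alg_ints \<Longrightarrow> x ^ n \<in> alg_ints"
  by (induction n) (auto intro: alg_ints_mult)

lemma alg_ints_sum: "(\<And>a. a \<in> A \<Longrightarrow> f a \<in> alg_ints) \<Longrightarrow> sum f A \<in> alg_ints"
  by (induction A rule: infinite_finite_induct) (auto intro: alg_ints_add)

lemma alg_ints_prod: "(\<And>a. a \<in> A \<Longrightarrow> f a \<in> alg_ints) \<Longrightarrow> prod f A \<in> alg_ints"
  by (induction A rule: infinite_finite_induct) (auto intro: alg_ints_mult)

lemma alg_ints_eval_int: "x \<in> alg_ints \<Longrightarrow> eval_int g x \<in> alg_ints"
  by (induction g) (auto intro: alg_ints_mult alg_ints_add)

lemma alg_ints_of_rat: 
  assumes "(of_rat q :: 'a::field_char_0) \<in> alg_ints"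
  shows "q \<in> \<int>"
proof -
  have "(of_rat q :: 'a) \<in> \<int>"
    using assms by (intro rational_algebraic_int_is_int) (auto simp: alg_ints_def)
  then obtain k where "(of_rat q :: 'a) = of_int k" by (auto elim: Ints_cases)
  hence "(of_rat q :: 'a) = of_rat (of_int k)" by simp
  hence "q = of_int k" by (simp only: of_rat_eq_iff)
  thus ?thesis by simp
qed

section \<open>Conjugates over the rationals\<close>

lemma rat_poly_dvd_eval:
  fixes x :: "'a::field_char_0"
  assumes "f dvd g" "eval_rat f x = 0"
  shows "eval_rat g x = 0"
  using assms by (auto elim!: dvdE)

text \<open>Otherwise a Bezout identity for \<open>f\<close> and \<open>g\<close>, evaluated at
  \<open>x\<close>, would read 0 = 1.\<close>

lemma irreducible_dvd_of_common_root:
  fixes x :: "'a::field_char_0"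
  assumes f: "irreducible (f :: rat poly)" and x: "eval_rat f x = 0" "eval_rat g x = 0"
  shows "f dvd g"
proof (rule ccontr)
  assume "\<not> f dvd g"
  hence "coprime f g"
    using f by (simp add: irreducible_imp_prime_elem prime_elem_imp_coprime)
  hence "fst (bezout_coefficients f g) * f + snd (bezout_coefficients f g) * g = 1"
    by (metis bezout_coefficients_fst_snd coprime_imp_gcd_eq_1)
  from arg_cong[OF this, of "\<lambda>h. eval_rat h x"] x show False by simp
qed

text \<open>Conjugacy means being roots of one irreducible rational polynomial. Transfer of
  polynomial relations takes the place of field automorphisms throughout.\<close>

lemma conjugate_eval_zero:
  fixes x y :: "'a::field_char_0"
  assumes "irreducible (f :: rat poly)" "eval_rat f x = 0" "eval_rat f y = 0" "eval_rat g x = 0"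
  shows "eval_rat g y = 0"
  using irreducible_dvd_of_common_root[OF assms(1,2,4)] assms(3) rat_poly_dvd_eval by blast

text \<open>In characteristic 0 the derivative of a nonconstant polynomial is not divisible by it,
  hence is coprime to the irreducible \<open>g\<close>; a Bezout identity excludes a common
  root.\<close>

lemma irreducible_rsquarefree:
  assumes "irreducible (g :: rat poly)"
  shows "rsquarefree (map_poly of_rat g :: 'a::field_char_0 poly)"
proof -
  have "g \<noteq> 0" using assms by auto
  have "\<not> g dvd pderiv g"
    using assms \<open>g \<noteq> 0\<close> by (metis dvd_pderiv_iff irreducible_def is_unit_iff_degree)
  hence "coprime g (pderiv g)"
    using assms by (simp add: irreducible_imp_prime_elem prime_elem_imp_coprime)
  hence bez: "fst (bezout_coefficients g (pderiv g)) * g + snd (bezout_coefficients g (pderiv g)) * pderiv g = 1"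
    by (metis bezout_coefficients_fst_snd coprime_imp_gcd_eq_1)
  have pd: "pderiv (map_poly of_rat g :: 'a poly) = map_poly of_rat (pderiv g)"
    by (rule poly_eqI) (simp add: coeff_pderiv coeff_map_poly of_rat_mult of_rat_add)
  show ?thesis
    unfolding rsquarefree_roots pd
  proof (intro allI notI, elim conjE)
    fix x assume "poly (map_poly of_rat g) x = (0 :: 'a)" "poly (map_poly of_rat (pderiv g)) x = 0"
    hence "eval_rat g x = 0" "eval_rat (pderiv g) x = 0" by (simp_all add: eval_rat_def)
    with arg_cong[OF bez, of "\<lambda>h. eval_rat h x"] show False by simp
  qed
qed

lemma alg_ints_iff_int_poly:
  "(x :: 'a::field_char_0) \<in> alg_ints \<longleftrightarrow> (\<exists>p. lead_coeff p = 1 \<and> eval_int p x = 0)"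
  by (auto simp: alg_ints_def algebraic_int_altdef_ipoly)

text \<open>A monic integral equation \<open>p\<close> for \<open>h(x)\<close> is a rational
  relation \<open>p(h(X))\<close> for \<open>x\<close>, which the conjugate \<open>y\<close>
  shares.\<close>

lemma conjugate_eval_alg_int:
  fixes x y :: "'a::field_char_0"
  assumes f: "irreducible (f :: rat poly)" "eval_rat f x = 0" "eval_rat f y = 0"
    and h: "eval_rat h x \<in> alg_ints"
  shows "eval_rat h y \<in> alg_ints"
proof -
  from h obtain p where p: "lead_coeff p = 1" "eval_int p (eval_rat h x) = 0"
    by (auto simp: alg_ints_iff_int_poly)
  have "eval_rat (pcompose (map_poly of_int p) h) y = 0"
    by (rule conjugate_eval_zero[OF f]) (simp add: eval_rat_int p)
  thus ?thesis using p by (auto simp: alg_ints_iff_int_poly eval_rat_int)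
qed

lemma algebraic_imp_rat_root:
  fixes x :: "'a::field_char_0"
  assumes "algebraic x"
  obtains f :: "rat poly" where "f \<noteq> 0" "eval_rat f x = 0"
proof -
  from assms obtain p where p: "poly (map_poly of_int p) x = 0" "p \<noteq> 0"
    by (rule algebraicE') auto
  show ?thesis
    by (rule that[of "map_poly of_int p"]) (use p in \<open>auto simp: eval_rat_int\<close>)
qed

lemma min_poly_exists:
  fixes x :: "'a::field_char_0"
  assumes "algebraic x"
  obtains f :: "rat poly" where "irreducible f" "lead_coeff f = 1" "eval_rat f x = 0"
proof -
  from algebraic_imp_rat_root[OF assms] obtain f0 :: "rat poly"
    where f0: "f0 \<noteq> 0" "eval_rat f0 x = 0" .
  define P where "P = (\<lambda>f::rat poly. f \<noteq> 0 \<and> eval_rat f x = 0)"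
  obtain f where f: "P f" "\<And>g. P g \<Longrightarrow> degree f \<le> degree g"
    using f0 ex_has_least_nat[of P f0 degree] by (auto simp: P_def)
  define g where "g = smult (inverse (lead_coeff f)) f"
  have g: "P g" "lead_coeff g = 1" "degree g = degree f"
    using f(1) by (auto simp: g_def P_def)
  have dpos: "degree g > 0"
  proof (rule ccontr)
    assume "\<not> degree g > 0"
    then obtain c where "g = [:c:]" using degree_eq_zeroE by blast
    with g show False by (auto simp: P_def)
  qed
  have "irreducible g"
  proof (rule irreducibleI)
    show "g \<noteq> 0" using g by (simp add: P_def)
    show "\<not> g dvd 1" using dpos g by (auto simp: poly_dvd_1)
    fix a b assume ab: "g = a * b"
    with g have nz: "a \<noteq> 0" "b \<noteq> 0" by (auto simp: P_def)
    from ab g have "eval_rat a x = 0 \<or> eval_rat b x = 0" by (auto simp: P_def)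
    hence "degree a \<ge> degree g \<or> degree b \<ge> degree g"
      using nz f(2) g(3) by (auto simp: P_def)
    moreover have "degree g = degree a + degree b" using ab nz by (simp add: degree_mult_eq)
    ultimately have "degree a = 0 \<or> degree b = 0" by linarith
    thus "a dvd 1 \<or> b dvd 1" using nz by (auto simp: is_unit_iff_degree)
  qed
  with g that show ?thesis by (auto simp: P_def)
qed

lemma integral_multiple:
  fixes x :: "'a::field_char_0"
  assumes "algebraic x"
  obtains n :: nat where "n > 0" "of_nat n * x \<in> alg_ints"
proof -
  from assms obtain p where p: "poly (map_poly of_int p) x = 0" "p \<noteq> 0"
    by (rule algebraicE') auto
  define a where "a = lead_coeff p"
  define d where "d = degree p"
  have a: "a \<noteq> 0" using p by (simp add: a_def)
  have "d \<noteq> 0"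
  proof
    assume "d = 0"
    then obtain c where "p = [:c:]" unfolding d_def using degree_eq_zeroE by blast
    with p show False by simp
  qed
  \<comment> \<open>This is \<open>a^(d - 1) * p(X / a)\<close>, which is monic with integer
    coefficients and vanishes at \<open>a * x\<close>.\<close>
  define q where "q = (\<Sum>i<d. monom (coeff p i * a ^ (d - 1 - i)) i) + monom 1 d"
  have cq: "coeff q i = (if i < d then coeff p i * a ^ (d - 1 - i) else if i = d then 1 else 0)" for i
    unfolding q_def by (simp add: coeff_sum)
  have dq: "degree q = d"
    by (rule antisym[OF degree_le le_degree]) (auto simp: cq)
  have "eval_int q (of_int a * x) = (\<Sum>i<Suc d. of_int (coeff q i) * (of_int a * x) ^ i)"
    by (rule eval_int_altdef) (simp add: dq)
  also have "\<dots> = (\<Sum>i<Suc d. of_int (a ^ (d - 1)) * (of_int (coeff p i) * x ^ i))"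
  proof (rule sum.cong)
    fix i assume i: "i \<in> {..<Suc d}"
    have "of_int (coeff q i) * (of_int a) ^ i = (of_int (a ^ (d - 1) * coeff p i) :: 'a)"
    proof (cases "i < d")
      case True
      hence "a ^ (d - 1) = a ^ (d - 1 - i) * a ^ i" by (simp flip: power_add)
      with True show ?thesis by (simp add: cq mult_ac)
    next
      case False
      with i have "i = d" by simp
      moreover have "a ^ (d - 1) * a = a ^ d" using \<open>d \<noteq> 0\<close> by (simp add: power_eq_if)
      ultimately show ?thesis by (simp add: cq a_def d_def flip: of_int_power of_int_mult)
    qed
    thus "of_int (coeff q i) * (of_int a * x) ^ i = of_int (a ^ (d - 1)) * (of_int (coeff p i) * x ^ i)"
      by (simp add: power_mult_distrib flip: mult.assoc)
  qed auto
  also have "\<dots> = of_int (a ^ (d - 1)) * eval_int p x"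
    by (subst eval_int_altdef[of p "Suc d"]) (auto simp: d_def sum_distrib_left distrib_left)
  finally have "eval_int q (of_int a * x) = 0" using p by simp
  moreover have "lead_coeff q = 1" by (simp add: dq cq)
  ultimately have "of_int a * x \<in> alg_ints" by (auto simp: alg_ints_iff_int_poly)
  hence "of_int (sgn a) * (of_int a * x) \<in> alg_ints" by (rule alg_ints_mult[OF alg_ints_of_int])
  also have "of_int (sgn a) * (of_int a * x) = of_int (\<bar>a\<bar>) * x"
    by (simp add: abs_sgn mult_ac)
  also have "\<dots> = of_nat (nat \<bar>a\<bar>) * x" by simp
  finally show ?thesis using that[of "nat \<bar>a\<bar>"] a by simp
qed

lemma rat_common_denominator:
  fixes A :: "rat set"
  assumes "finite A"
  obtains n :: nat where "n > 0" "\<forall>q\<in>A. of_nat n * q \<in> \<int>"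
proof -
  have "\<exists>n::nat. n > 0 \<and> (\<forall>q\<in>A. of_nat n * q \<in> \<int>)"
    using assms
  proof (induction A rule: finite_induct)
    case (insert q A)
    then obtain n :: nat where n: "n > 0" "\<forall>q\<in>A. of_nat n * q \<in> \<int>" by blast
    obtain a b :: int where ab: "b > 0" "q = of_int a / of_int b"
      using Rat_cases[of q] by (metis Fract_of_int_quotient)
    have "of_nat (nat b * n) * q = of_int (int n * a)" using ab by simp
    hence "of_nat (nat b * n) * q \<in> \<int>" by (metis Ints_of_int)
    moreover have "of_nat (nat b * n) * q' \<in> \<int>" if "q' \<in> A" for q'
    proof -
      have "of_nat (nat b * n) * q' = of_nat (nat b) * (of_nat n * q')" by simp
      also have "\<dots> \<in> \<int>" by (rule Ints_mult) (use n that in auto)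
      finally show ?thesis .
    qed
    ultimately show ?case using ab n by (intro exI[of _ "nat b * n"]) auto
  qed (auto intro: exI[of _ 1])
  with that show ?thesis by blast
qed

lemma rat_poly_common_denominator:
  fixes A :: "rat poly set"
  assumes "finite A"
  obtains n :: nat and H :: "rat poly \<Rightarrow> int poly" where "n > 0" "\<forall>h\<in>A. smult (of_nat n) h = map_poly of_int (H h)"
proof -
  have "finite (\<Union>h\<in>A. set (coeffs h))" using assms by auto
  from rat_common_denominator[OF this] obtain n :: nat
    where n: "n > 0" "\<forall>q\<in>(\<Union>h\<in>A. set (coeffs h)). of_nat n * q \<in> \<int>" .
  define H where "H = (\<lambda>h :: rat poly. map_poly (\<lambda>q. \<lfloor>of_nat n * q\<rfloor>) h)"
  have "smult (of_nat n) h = map_poly of_int (H h)" if "h \<in> A" for h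
  proof (rule poly_eqI)
    fix i
    have "of_nat n * coeff h i \<in> \<int>"
    proof (cases "coeff h i = 0")
      case False
      hence "coeff h i \<in> set (coeffs h)" by (metis coeff_in_coeffs coeff_0 le_degree)
      thus ?thesis using n that by blast
    qed auto
    thus "coeff (smult (of_nat n) h) i = coeff (map_poly of_int (H h)) i"
      by (simp add: H_def coeff_map_poly)
  qed
  with n(1) that show ?thesis by blast
qed

section \<open>Primitive elements\<close>

text \<open>\<open>rat_adjoin c\<close> is the ring \<open>\<rat>[c]\<close>, which for algebraic \<open>c\<close> is the field \<open>\<rat>(c)\<close>.\<close>

definition rat_adjoin :: "'a::field_char_0 \<Rightarrow> 'a set" where
  "rat_adjoin c = range (\<lambda>h. eval_rat h c)"

lemma rat_adjoinI [intro]: "eval_rat h c \<in> rat_adjoin c"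
  by (auto simp: rat_adjoin_def)

lemma rat_adjoin_self: "c \<in> rat_adjoin c"
  using rat_adjoinI[of "[:0, 1:]" c] by simp

lemma rat_adjoin_of_rat: "of_rat q \<in> rat_adjoin c"
  using rat_adjoinI[of "[:q:]" c] by simp

lemma rat_adjoinE:
  assumes "x \<in> rat_adjoin c"
  obtains h where "x = eval_rat h c"
  using assms by (auto simp: rat_adjoin_def)

lemma rat_adjoin_add: "x \<in> rat_adjoin c \<Longrightarrow> y \<in> rat_adjoin c \<Longrightarrow> x + y \<in> rat_adjoin c"
  by (elim rat_adjoinE) (simp flip: eval_rat_simps(5) add: rat_adjoinI del: eval_rat_simps)

lemma rat_adjoin_diff: "x \<in> rat_adjoin c \<Longrightarrow> y \<in> rat_adjoin c \<Longrightarrow> x - y \<in> rat_adjoin c"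
  by (elim rat_adjoinE) (simp flip: eval_rat_simps(6) add: rat_adjoinI del: eval_rat_simps)

lemma rat_adjoin_mult: "x \<in> rat_adjoin c \<Longrightarrow> y \<in> rat_adjoin c \<Longrightarrow> x * y \<in> rat_adjoin c"
  by (elim rat_adjoinE) (simp flip: eval_rat_simps(8) add: rat_adjoinI del: eval_rat_simps)

lemma rat_adjoin_eval: "x \<in> rat_adjoin c \<Longrightarrow> eval_rat h x \<in> rat_adjoin c"
  by (elim rat_adjoinE) (simp flip: eval_rat_simps(13) add: rat_adjoinI del: eval_rat_simps)

lemma rat_adjoin_inverse:
  assumes c: "algebraic c" and x: "x \<in> rat_adjoin c"
  shows "inverse x \<in> rat_adjoin c"
proof (cases "x = 0")
  case False
  from min_poly_exists[OF c] obtain f :: "rat poly"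
    where f: "irreducible f" "eval_rat f c = 0" by blast
  from x obtain h where h: "x = eval_rat h c" by (auto simp: rat_adjoin_def)
  have "\<not> f dvd h" using False f h rat_poly_dvd_eval by blast
  hence "coprime f h"
    using f by (simp add: irreducible_imp_prime_elem prime_elem_imp_coprime)
  hence "fst (bezout_coefficients f h) * f + snd (bezout_coefficients f h) * h = 1"
    by (metis bezout_coefficients_fst_snd coprime_imp_gcd_eq_1)
  from arg_cong[OF this, of "\<lambda>h. eval_rat h c"] f h
  have "eval_rat (snd (bezout_coefficients f h)) c * x = 1" by simp
  hence "inverse x = eval_rat (snd (bezout_coefficients f h)) c"
    by (metis inverse_unique mult.commute)
  thus ?thesis by auto
qed (use rat_adjoin_of_rat[of 0 c] in auto)

lemma is_subfield_eval_rat: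
  assumes K: "is_subfield K" and x: "x \<in> K"
  shows "eval_rat h x \<in> K"
proof -
  have sub: "a - b \<in> K" "a * b \<in> K" if "a \<in> K" "b \<in> K" for a b
    using K that by (auto simp: is_subfield_def)
  have zero: "0 \<in> K" using K sub[of 1 1] by (auto simp: is_subfield_def)
  have neg: "- a \<in> K" if "a \<in> K" for a using sub(1)[OF zero that] by simp
  have add: "a + b \<in> K" if "a \<in> K" "b \<in> K" for a b
    using sub(1)[OF that(1) neg[OF that(2)]] by simp
  have nat: "of_nat n \<in> K" for n
    by (induction n) (use zero K add in \<open>auto simp: is_subfield_def\<close>)
  have int: "of_int n \<in> K" for n
    by (cases n rule: int_cases2) (auto intro: nat neg)
  have rat: "of_rat q \<in> K" for q
  proof -
    obtain a b :: int where "q = of_int a / of_int b" using Rat_cases[of q] by (metis Fract_of_int_quotient)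
    hence "(of_rat q :: 'a) = of_int a * inverse (of_int b)" by (simp add: of_rat_mult of_rat_inverse divide_inverse)
    also have "\<dots> \<in> K" using int K by (intro sub) (auto simp: is_subfield_def)
    finally show ?thesis .
  qed
  show ?thesis by (induction h) (auto intro!: add sub rat simp: zero x)
qed

text \<open>Division by a monic polynomial never leaves the ring of coefficients. The coefficients
  are confined to a set \<open>k\<close> because the subfield generated by one element is a set
  here; the case \<open>k = UNIV\<close> over the integers gives reduction modulo
  \<open>F\<close>.\<close>

lemma poly_division_over_subring:
  fixes f m :: "'a::idom poly"
  assumes k: "\<And>x y. x \<in> k \<Longrightarrow> y \<in> k \<Longrightarrow> x - y \<in> k" "\<And>x y. x \<in> k \<Longrightarrow> y \<in> k \<Longrightarrow> x * y \<in> k"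
      "0 \<in> k"
    and m: "\<And>i. coeff m i \<in> k" "lead_coeff m = 1"
    and f: "\<And>i. coeff f i \<in> k"
  shows "\<exists>q r. f = q * m + r \<and> (\<forall>i. coeff r i \<in> k) \<and> (r = 0 \<or> degree r < degree m)"
  using f
proof (induction "degree f" arbitrary: f rule: less_induct)
  case less
  show ?case
  proof (cases "f = 0 \<or> degree f < degree m")
    case True
    thus ?thesis using less.prems by (intro exI[of _ 0] exI[of _ f]) auto
  next
    case False
    define n where "n = degree f - degree m"
    define g where "g = f - monom (lead_coeff f) n * m"
    have cg: "coeff g i \<in> k" for i
      unfolding g_def using less.prems m k(3)
      by (auto simp: coeff_monom_mult intro!: k(1,2))
    have deg: "degree f = n + degree m" using False by (simp add: n_def)
    have m0: "m \<noteq> 0" using m(2) by auto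
    have "degree g \<le> degree f"
      unfolding g_def
      by (intro degree_diff_le) (auto simp: degree_mult_eq deg m0 degree_monom_eq monom_eq_0_iff
          intro!: order.trans[OF degree_mult_le] add_mono degree_monom_le)
    moreover have "coeff g (degree f) = 0"
      by (simp add: g_def coeff_monom_mult deg m(2))
    ultimately consider "g = 0" | "degree g < degree f"
      using eq_zero_or_degree_less by blast
    then obtain q r where qr: "g = q * m + r" "\<forall>i. coeff r i \<in> k" "r = 0 \<or> degree r < degree m"
    proof cases
      case 1
      thus ?thesis using that[of 0 0] k(3) by simp
    next
      case 2
      thus ?thesis using less.hyps[of g] cg that by blast
    qed
    have "f = (q + monom (lead_coeff f) n) * m + r"
      using qr(1) by (simp add: g_def algebra_simps)
    thus ?thesis using qr by blast
  qed
qed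

text \<open>The least-degree polynomial over \<open>\<rat>(a + t b)\<close> vanishing at \<open>b\<close> divides both
  \<open>g(X)\<close> and \<open>f(a + t b - t X)\<close>; for all but finitely many \<open>t\<close> these have only the
  simple root \<open>b\<close> in common.\<close>

lemma primitive_element_two:
  fixes a b :: "'a::{alg_closed_field, field_char_0}"
  assumes alg: "algebraic a" "algebraic b" "\<And>t::int. algebraic (a + of_int t * b)"
  obtains t :: int where "a \<in> rat_adjoin (a + of_int t * b)" "b \<in> rat_adjoin (a + of_int t * b)"
proof -
  from min_poly_exists[OF alg(1)] obtain f :: "rat poly"
    where f: "irreducible f" "eval_rat f a = 0" by blast
  from min_poly_exists[OF alg(2)] obtain g :: "rat poly"
    where g: "irreducible g" "eval_rat g b = 0" by blast
  have f0: "f \<noteq> 0" and g0: "g \<noteq> 0" using f g by auto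
  define A where "A = {x::'a. eval_rat f x = 0}"
  define B where "B = {x::'a. eval_rat g x = 0}"
  have fin: "finite A" "finite B"
    unfolding A_def B_def eval_rat_def by (intro poly_roots_finite, simp add: f0 g0)+
  have "finite ((\<lambda>(x, y). (x - a) / (b - y)) ` (A \<times> B))" using fin by auto
  moreover have "infinite (range (of_int :: int \<Rightarrow> 'a))"
    by (simp add: finite_image_iff infinite_UNIV_int inj_def)
  \<comment> \<open>Excluded are the \<open>t\<close> for which some root
    \<open>y \<noteq> b\<close> of \<open>g\<close> makes \<open>a + t b - t y\<close> a root of
    \<open>f\<close>. Pairs with \<open>y = b\<close> give the default quotient 0 and exclude only
    \<open>t = 0\<close>.\<close>
  ultimately obtain t :: int where t: "of_int t \<notin> (\<lambda>(x, y). (x - a) / (b - y)) ` (A \<times> B)"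
    by (metis (no_types, lifting) finite_subset image_subsetI)
  define c where "c = a + of_int t * b"
  have c: "algebraic c" using alg(3) by (simp add: c_def)
  define k where "k = rat_adjoin c"
  have k: "x - y \<in> k" "x * y \<in> k" if "x \<in> k" "y \<in> k" for x y
    using that by (simp_all add: k_def rat_adjoin_diff rat_adjoin_mult)
  have krat: "of_rat q \<in> k" for q by (simp add: k_def rat_adjoin_of_rat)
  have k0: "0 \<in> k" using krat[of 0] by simp
  have kneg: "- x \<in> k" if "x \<in> k" for x using k(1)[OF k0 that] by simp
  have kadd: "x + y \<in> k" if "x \<in> k" "y \<in> k" for x y using k(1)[OF that(1) kneg[OF that(2)]] by simp
  define g' where "g' = (map_poly of_rat g :: 'a poly)"
  define f' where "f' = pcompose (map_poly of_rat f :: 'a poly) [:c, - of_int t:]"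
  have cg': "coeff g' i \<in> k" for i by (simp add: g'_def coeff_map_poly krat)
  have cmul: "coeff (p * q) i \<in> k" if "\<And>i. coeff p i \<in> k" "\<And>i. coeff q i \<in> k" for p q i
  proof -
    have "(\<Sum>j\<in>J. coeff p j * coeff q (i - j)) \<in> k" for J
      by (induction J rule: infinite_finite_induct) (auto simp: k0 intro!: kadd k(2) that)
    thus ?thesis by (simp add: coeff_mult)
  qed
  have cf': "coeff f' i \<in> k" for i
  proof -
    have "of_int t \<in> k" using krat[of "of_int t"] by simp
    hence lin: "coeff [:c, - of_int t:] j \<in> k" for j
      by (auto simp: coeff_pCons k_def rat_adjoin_self k0[unfolded k_def] intro!: kneg[unfolded k_def] split: nat.splits)
    have "coeff (pcompose (map_poly of_rat h :: 'a poly) [:c, - of_int t:]) j \<in> k" for h j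
    proof (induction h arbitrary: j)
      case (pCons u h)
      have "coeff [:of_rat u:] j \<in> k" by (auto simp: coeff_pCons krat k0 split: nat.splits)
      hence "coeff ([:of_rat u:] + [:c, - of_int t:] * pcompose (map_poly of_rat h) [:c, - of_int t:]) j \<in> k"
        unfolding coeff_add by (rule kadd[OF _ cmul[OF lin pCons.IH]])
      thus ?case by (simp only: map_poly_pCons[OF pCons.hyps(1)] pcompose_pCons)
    qed (simp add: k0)
    thus ?thesis by (simp add: f'_def)
  qed
  have vf: "poly f' b = 0" using f by (simp add: f'_def poly_pcompose c_def eval_rat_def)
  have vg: "poly g' b = 0" using g by (simp add: g'_def eval_rat_def)
  have g'0: "g' \<noteq> 0" using g0 by (simp add: g'_def)
  define P where "P = (\<lambda>m. m \<noteq> 0 \<and> (\<forall>i. coeff m i \<in> k) \<and> poly m b = 0)"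
  have "P g'" using cg' vg g'0 by (simp add: P_def)
  then obtain m0 where m0: "P m0" "\<And>h. P h \<Longrightarrow> degree m0 \<le> degree h"
    using ex_has_least_nat[of P g' degree] by blast
  define m where "m = smult (inverse (lead_coeff m0)) m0"
  have "inverse (lead_coeff m0) \<in> k"
    using m0(1) rat_adjoin_inverse[OF c] by (simp add: P_def k_def)
  hence m: "P m" "lead_coeff m = 1" "\<And>h. P h \<Longrightarrow> degree m \<le> degree h"
    using m0 k(2) by (auto simp: m_def P_def)
  have dvd: "m dvd h" if h: "\<And>i. coeff h i \<in> k" "poly h b = 0" for h
  proof -
    have "\<exists>q r. h = q * m + r \<and> (\<forall>i. coeff r i \<in> k) \<and> (r = 0 \<or> degree r < degree m)"
      by (rule poly_division_over_subring[OF k k0 _ m(2) h(1)]) (use m in \<open>auto simp: P_def\<close>)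
    then obtain q r where qr: "h = q * m + r" "\<forall>i. coeff r i \<in> k" "r = 0 \<or> degree r < degree m"
      by blast
    have "poly r b = 0" using qr(1) h(2) m(1) by (simp add: P_def)
    hence "P r" if "r \<noteq> 0" using qr that by (simp add: P_def)
    hence "r = 0" using qr(3) m(3)[of r] by linarith
    thus ?thesis using qr by simp
  qed
  have root: "y = b" if "poly m y = 0" for y
  proof (rule ccontr)
    assume ne: "y \<noteq> b"
    have "poly f' y = 0" "poly g' y = 0"
      using dvd[OF cf' vf] dvd[OF cg' vg] that by (auto elim!: dvdE)
    hence "y \<in> B" "c - of_int t * y \<in> A"
      by (auto simp: A_def B_def f'_def g'_def eval_rat_def poly_pcompose mult.commute)
    moreover have "of_int t = (c - of_int t * y - a) / (b - y)"
      using ne by (simp add: c_def field_simps)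
    ultimately show False using t by force
  qed
  have "rsquarefree g'" unfolding g'_def by (rule irreducible_rsquarefree[OF g(1)])
  moreover have "m dvd g'" by (rule dvd[OF cg' vg])
  moreover have mb: "poly m b = 0" using m by (simp add: P_def)
  \<comment> \<open>A further linear factor of \<open>m\<close> would again have the root
    \<open>b\<close>, which would then be a double root of the squarefree \<open>g'\<close>.\<close>
  ultimately have "degree m = 1"
  proof -
    assume sq: "rsquarefree g'" and "m dvd g'" 
    from mb obtain m1 where m1: "m = [:- b, 1:] * m1" by (auto simp: poly_eq_0_iff_dvd)
    have "m1 \<noteq> 0" using m1 m by (auto simp: P_def)
    have "degree m1 = 0"
    proof (rule ccontr)
      assume "degree m1 \<noteq> 0"
      then obtain y where y: "poly m1 y = 0" using alg_closed_imp_poly_has_root by blast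
      hence "y = b" using root[of y] m1 by simp
      with y have "[:- b, 1:] dvd m1" by (simp add: poly_eq_0_iff_dvd)
      hence "[:- b, 1:] ^ 2 dvd m" unfolding m1 power2_eq_square by (rule mult_dvd_mono[OF dvd_refl])
      hence "[:- b, 1:] ^ 2 dvd g'" using \<open>m dvd g'\<close> dvd_trans by blast
      hence "2 \<le> order b g'" using g'0 by (simp add: order_divides)
      thus False using rsquarefree_root_order[OF sq vg g'0] by simp
    qed
    thus ?thesis unfolding m1 using \<open>m1 \<noteq> 0\<close> by (subst degree_mult_eq) auto
  qed
  with m(2) have "m = [:coeff m 0, 1:]"
    by (intro poly_eqI) (auto simp: coeff_pCons coeff_eq_0 split: nat.splits)
  with mb have "coeff m 0 + b = 0" by (metis mult.right_neutral poly_pCons poly_0 add.right_neutral mult_zero_right)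
  hence "b = - coeff m 0" by (simp add: eq_neg_iff_add_eq_0 add.commute)
  hence b: "b \<in> k" using m kneg by (simp add: P_def)
  have "a = c - of_int t * b" by (simp add: c_def)
  also have "\<dots> \<in> k" using b krat[of "of_int t"] by (intro k) (auto simp: k_def rat_adjoin_self)
  finally have "a \<in> k" .
  with b that[of t] show ?thesis by (simp add: k_def c_def)
qed

definition is_subring :: "'a::comm_ring_1 set \<Rightarrow> bool" where
  "is_subring R \<longleftrightarrow> 1 \<in> R \<and> (\<forall>x\<in>R. \<forall>y\<in>R. x - y \<in> R \<and> x * y \<in> R)"

lemma is_subring_closed:
  assumes "is_subring R"
  shows "0 \<in> R" "1 \<in> R" "x \<in> R \<Longrightarrow> y \<in> R \<Longrightarrow> x + y \<in> R" "x \<in> R \<Longrightarrow> y \<in> R \<Longrightarrow> x - y \<in> R"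
    "x \<in> R \<Longrightarrow> y \<in> R \<Longrightarrow> x * y \<in> R" "of_int n \<in> R"
proof -
  have one: "1 \<in> R" using assms by (simp add: is_subring_def)
  have diff: "x - y \<in> R" "x * y \<in> R" if "x \<in> R" "y \<in> R" for x y
    using assms that by (auto simp: is_subring_def)
  have zero: "0 \<in> R" using diff(1)[OF one one] by simp
  have neg: "- x \<in> R" if "x \<in> R" for x using diff(1)[OF zero that] by simp
  have add: "x + y \<in> R" if "x \<in> R" "y \<in> R" for x y using diff(1)[OF that(1) neg[OF that(2)]] by simp
  have nat: "of_nat n \<in> R" for n by (induction n) (auto simp: zero one add)
  show "0 \<in> R" "1 \<in> R" "x \<in> R \<Longrightarrow> y \<in> R \<Longrightarrow> x + y \<in> R" "x \<in> R \<Longrightarrow> y \<in> R \<Longrightarrow> x - y \<in> R"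
    "x \<in> R \<Longrightarrow> y \<in> R \<Longrightarrow> x * y \<in> R"
    using zero one add diff by auto
  show "of_int n \<in> R" by (cases n rule: int_cases2) (auto intro: neg nat)
qed

lemma is_subring_eval_int:
  assumes "is_subring R" "x \<in> R"
  shows "eval_int g x \<in> R"
  using assms by (induction g) (auto intro: is_subring_closed)

lemma is_subring_alg_ints: "is_subring alg_ints"
  by (auto simp: is_subring_def alg_ints_diff alg_ints_mult)

text \<open>The last conclusion says that \<open>c\<close> is an integer polynomial expression in
  the elements of \<open>B\<close>, which holds because each step only adds an integer multiple of a
  generator. In this form, any property that defines a subring passes from the generators to
  \<open>c\<close>; it is later used for integrality, for trivial Frobenius, for membership in the
  number field and for normality.\<close>

lemma primitive_element:
  fixes B :: "'a::{alg_closed_field, field_char_0} set"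
  assumes "finite B" "B \<subseteq> alg_ints"
  obtains c where "c \<in> alg_ints" "B \<subseteq> rat_adjoin c" "\<And>R. is_subring R \<Longrightarrow> B \<subseteq> R \<Longrightarrow> c \<in> R"
proof -
  have "\<exists>c. B \<subseteq> rat_adjoin c \<and> (\<forall>R. is_subring R \<longrightarrow> B \<subseteq> R \<longrightarrow> c \<in> R)"
    using assms
  proof (induction B rule: finite_induct)
    case empty
    show ?case by (intro exI[of _ 0]) (auto intro: is_subring_closed)
  next
    case (insert b B)
    then obtain c where c: "B \<subseteq> rat_adjoin c" "\<And>R. is_subring R \<Longrightarrow> B \<subseteq> R \<Longrightarrow> c \<in> R" by auto
    have "c \<in> alg_ints" using c(2) is_subring_alg_ints insert.prems by blast
    hence int: "c + of_int t * b \<in> alg_ints" for t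
      using insert.prems by (intro alg_ints_add alg_ints_mult) auto
    have alg: "algebraic x" if "x \<in> alg_ints" for x :: 'a using that by (auto simp: alg_ints_def)
    obtain t where t: "c \<in> rat_adjoin (c + of_int t * b)" "b \<in> rat_adjoin (c + of_int t * b)"
      using primitive_element_two[of c b] alg int \<open>c \<in> alg_ints\<close> insert.prems by auto
    have "x \<in> rat_adjoin (c + of_int t * b)" if "x \<in> B" for x
    proof -
      from c(1) that obtain h where "x = eval_rat h c" by (auto simp: rat_adjoin_def)
      thus ?thesis using rat_adjoin_eval[OF t(1)] by simp
    qed
    moreover have "c + of_int t * b \<in> R" if "is_subring R" "insert b B \<subseteq> R" for R
      using that c(2)[of R] by (auto intro: is_subring_closed)
    ultimately show ?case using t by blast
  qed
  with that is_subring_alg_ints assms(2) show ?thesis by metis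
qed

section \<open>Congruences and prime ideals in the ring of algebraic integers\<close>

lemma rsquarefree_factorization:
  fixes p :: "'a::alg_closed_field poly"
  assumes "rsquarefree p"
  shows "p = smult (lead_coeff p) (\<Prod>x | poly p x = 0. [:- x, 1:])"
    and "card {x. poly p x = 0} = degree p"
proof -
  have p0: "p \<noteq> 0" using assms by (simp add: rsquarefree_def)
  obtain A where A: "size A = degree p" "p = smult (lead_coeff p) (\<Prod>x\<in>#A. [:- x, 1:])"
    using alg_closed_imp_factorization[OF p0] by blast
  have "count A x \<le> 1" for x
  proof (rule ccontr)
    assume "\<not> count A x \<le> 1"
    hence "{#x, x#} \<subseteq># A" by (simp add: subseteq_mset_def)
    then obtain B where "A = {#x, x#} + B" by (metis subset_mset.less_eqE)
    with A(2) have "p = smult (lead_coeff p) ([:- x, 1:] ^ 2 * (\<Prod>x\<in>#B. [:- x, 1:]))"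
      by (simp add: power2_eq_square mult_ac del: mult_pCons_left mult_pCons_right)
    hence "[:- x, 1:] ^ 2 dvd p" by (metis dvd_smult dvd_triv_left)
    hence "2 \<le> order x p" using p0 by (simp add: order_divides)
    moreover have "order x p \<le> 1" using assms by (metis rsquarefree_def le_numeral_extra(4) zero_le_one)
    ultimately show False by simp
  qed
  hence "A = mset_set (set_mset A)"
    by (intro multiset_eqI) (metis One_nat_def count_mset_set(1) count_mset_set(3) finite_set_mset le_SucE le_zero_eq not_in_iff)
  moreover have set: "set_mset A = {x. poly p x = 0}"
  proof -
    have "poly p x = 0 \<longleftrightarrow> x \<in># A" for x
      by (subst A(2)) (use p0 in \<open>auto simp: poly_prod_mset prod_mset_zero_iff\<close>)
    thus ?thesis by auto
  qed
  ultimately have "A = mset_set {x. poly p x = 0}" by simp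
  with A show "p = smult (lead_coeff p) (\<Prod>x | poly p x = 0. [:- x, 1:])"
    "card {x. poly p x = 0} = degree p"
    by (simp_all add: prod_unfold_prod_mset) 
qed

section \<open>Congruences modulo an integer\<close>

definition ai_multiples :: "nat \<Rightarrow> 'a::field_char_0 set" where
  "ai_multiples n = {of_nat n * z |z. z \<in> alg_ints}"

lemma ai_multiplesI: "z \<in> alg_ints \<Longrightarrow> x = of_nat n * z \<Longrightarrow> x \<in> ai_multiples n"
  by (auto simp: ai_multiples_def)

lemma ai_multiples_alg_ints: "x \<in> ai_multiples n \<Longrightarrow> x \<in> alg_ints"
  by (auto simp: ai_multiples_def alg_ints_mult)

lemma ai_multiples_0 [simp]: "0 \<in> ai_multiples n"
  by (rule ai_multiplesI[of 0]) auto

lemma ai_multiples_add: "x \<in> ai_multiples n \<Longrightarrow> y \<in> ai_multiples n \<Longrightarrow> x + y \<in> ai_multiples n"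
  unfolding ai_multiples_def by (auto simp flip: distrib_left intro: alg_ints_add)

lemma ai_multiples_mult: "x \<in> ai_multiples n \<Longrightarrow> y \<in> alg_ints \<Longrightarrow> x * y \<in> ai_multiples n"
  by (auto simp: ai_multiples_def mult.assoc intro: alg_ints_mult)

lemma ai_multiples_uminus: "x \<in> ai_multiples n \<Longrightarrow> - x \<in> ai_multiples n"
  using ai_multiples_mult[of x n "of_int (-1)"] alg_ints_of_int[of "-1"] by simp

lemma ai_multiples_diff: "x \<in> ai_multiples n \<Longrightarrow> y \<in> ai_multiples n \<Longrightarrow> x - y \<in> ai_multiples n"
  using ai_multiples_add[OF _ ai_multiples_uminus, of x n y] by simp

lemma ai_multiples_sum: "(\<And>a. a \<in> A \<Longrightarrow> f a \<in> ai_multiples n) \<Longrightarrow> sum f A \<in> ai_multiples n"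
  by (induction A rule: infinite_finite_induct) (auto intro: ai_multiples_add)

text \<open>The quotient is a rational algebraic integer, hence an integer, so divisibility among
  all algebraic integers is no weaker than in the integers.\<close>

lemma ai_multiples_of_int_iff:
  "(of_int k :: 'a::field_char_0) \<in> ai_multiples n \<longleftrightarrow> int n dvd k"
proof
  assume "(of_int k :: 'a) \<in> ai_multiples n"
  then obtain z :: 'a where z: "z \<in> alg_ints" "of_int k = of_nat n * z" by (auto simp: ai_multiples_def)
  show "int n dvd k"
  proof (cases "n = 0")
    case False
    hence "z = of_rat (of_int k / of_nat n)" using z(2) by (simp add: of_rat_divide field_simps)
    with z(1) have "of_int k / (of_nat n :: rat) \<in> \<int>" using alg_ints_of_rat by metis
    then obtain j where "of_int k / (of_nat n :: rat) = of_int j" by (elim Ints_cases)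
    hence "(of_int k :: rat) = of_int (j * int n)" using False by (simp add: field_simps)
    hence "k = j * int n" by (simp only: of_int_eq_iff)
    thus ?thesis by simp
  qed (use z in simp)
next
  assume "int n dvd k"
  then obtain j where "k = int n * j" by blast
  thus "(of_int k :: 'a) \<in> ai_multiples n" by (intro ai_multiplesI[of "of_int j"]) auto
qed

lemma ai_multiples_cancel_coprime:
  assumes x: "x \<in> alg_ints" and c: "coprime a (int n)" and m: "of_int a * x \<in> ai_multiples n"
  shows "x \<in> ai_multiples n"
proof -
  obtain u v where uv: "u * a + v * int n = 1" using c by (metis bezout_int coprime_imp_gcd_eq_1)
  have "x = of_int (u * a + v * int n) * x" by (simp add: uv)
  also have "\<dots> = (of_int a * x) * of_int u + of_nat n * (of_int v * x)" by (simp add: algebra_simps)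
  also have "\<dots> \<in> ai_multiples n"
    by (intro ai_multiples_add ai_multiples_mult m ai_multiplesI[OF _ refl] alg_ints_mult x) auto
  finally show ?thesis .
qed

text \<open>For a generator \<theta> of a Galois extension and large \<open>p\<close>, membership of
  \<theta> says that \<open>p\<close> splits completely. In this form it is integrality of the value
  of the rational polynomial \<open>(X^p - X) / p\<close>, which links it to integer-valued
  polynomials.\<close>

definition frobenius_fixed :: "nat \<Rightarrow> 'a::field_char_0 set" where
  "frobenius_fixed p = {x \<in> alg_ints. x ^ p - x \<in> ai_multiples p}"

lemma frobenius_additive:
  fixes x y :: "'a::field_char_0"
  assumes p: "prime p" and xy: "x \<in> alg_ints" "y \<in> alg_ints"
  shows "(x + y) ^ p - x ^ p - y ^ p \<in> ai_multiples p"
proof -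
  have p0: "p > 0" using p by (simp add: prime_gt_0_nat)
  have "(x + y) ^ p = (\<Sum>k\<le>p. of_nat (p choose k) * x ^ k * y ^ (p - k))"
    by (rule binomial_ring)
  also have "{..p} = insert 0 (insert p {0<..<p})" using p0 by auto
  finally have "(x + y) ^ p - x ^ p - y ^ p = (\<Sum>k\<in>{0<..<p}. of_nat (p choose k) * x ^ k * y ^ (p - k))"
    using p0 by simp
  also have "\<dots> \<in> ai_multiples p"
  proof (rule ai_multiples_sum)
    fix k assume k: "k \<in> {0<..<p}"
    hence "p dvd (p choose k)" using p by (intro dvd_choose_prime) auto
    then obtain j where "p choose k = p * j" by blast
    thus "of_nat (p choose k) * x ^ k * y ^ (p - k) \<in> ai_multiples p"
      by (intro ai_multiplesI[of "of_nat j * x ^ k * y ^ (p - k)"] alg_ints_mult alg_ints_power xy) auto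
  qed
  finally show ?thesis .
qed

text \<open>This extends the condition from \<theta> to all of \<open>\<int>[\<theta>]\<close>, and
  from a set of generators to a primitive element built from them.\<close>

lemma is_subring_frobenius_fixed:
  assumes p: "prime p"
  shows "is_subring (frobenius_fixed p :: 'a::field_char_0 set)"
proof -
  have mult: "x * y \<in> frobenius_fixed p" if "x \<in> frobenius_fixed p" "y \<in> frobenius_fixed p" for x y :: 'a
  proof -
    have "(x * y) ^ p - x * y = (x ^ p - x) * y ^ p + (y ^ p - y) * x"
      by (simp add: power_mult_distrib algebra_simps)
    also have "\<dots> \<in> ai_multiples p"
      using that by (intro ai_multiples_add ai_multiples_mult alg_ints_power) (auto simp: frobenius_fixed_def)
    finally show ?thesis using that by (auto simp: frobenius_fixed_def alg_ints_mult)
  qed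
  have add: "x + y \<in> frobenius_fixed p" if "x \<in> frobenius_fixed p" "y \<in> frobenius_fixed p" for x y :: 'a
  proof -
    have "(x + y) ^ p - (x + y) = ((x + y) ^ p - x ^ p - y ^ p) + (x ^ p - x) + (y ^ p - y)" by simp
    also have "\<dots> \<in> ai_multiples p"
      using that by (intro ai_multiples_add frobenius_additive[OF p]) (auto simp: frobenius_fixed_def)
    finally show ?thesis using that by (auto simp: frobenius_fixed_def alg_ints_add)
  qed
  have minus: "(-1 :: 'a) \<in> frobenius_fixed p"
  \<comment> \<open>For odd \<open>p\<close> the difference is 0; for \<open>p = 2\<close> it is 2
    and thus still a multiple of \<open>p\<close>.\<close>
  proof (cases "p = 2")
    case True
    thus ?thesis using alg_ints_of_int[of "-1"] by (auto simp: frobenius_fixed_def intro: ai_multiplesI[of 1])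
  next
    case False
    hence "odd p" using p primes_dvd_imp_eq two_is_prime_nat by blast
    thus ?thesis using alg_ints_of_int[of "-1"] by (auto simp: frobenius_fixed_def)
  qed
  have "x - y \<in> frobenius_fixed p" if "x \<in> frobenius_fixed p" "y \<in> frobenius_fixed p" for x y :: 'a
    using add[OF that(1) mult[OF minus that(2)]] by simp
  moreover have "1 \<in> frobenius_fixed p" by (simp add: frobenius_fixed_def)
  ultimately show ?thesis using mult by (simp add: is_subring_def)
qed

text \<open>Integrality of the value of \<open>(X^p - X) / p\<close> passes to conjugates because
  this polynomial has rational coefficients.\<close>

lemma conjugate_in_frobenius_fixed:
  fixes x y :: "'a::field_char_0"
  assumes f: "irreducible (f :: rat poly)" "eval_rat f x = 0" "eval_rat f y = 0"
    and p: "prime p" and x: "x \<in> frobenius_fixed p"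
  shows "y \<in> frobenius_fixed p"
proof -
  have p0: "p \<noteq> 0" using p by auto
  define h :: "rat poly" where "h = smult (1 / of_nat p) (monom 1 p - [:0, 1:])"
  have h: "eval_rat h z = (z ^ p - z) / of_nat p" for z :: 'a by (simp add: h_def of_rat_divide)
  obtain z where z: "z \<in> alg_ints" "x ^ p - x = of_nat p * z" and xi: "x \<in> alg_ints"
    using x by (auto simp: frobenius_fixed_def ai_multiples_def)
  have "eval_rat h x \<in> alg_ints" using z p0 by (simp add: h)
  hence "eval_rat h y \<in> alg_ints" by (rule conjugate_eval_alg_int[OF f])
  moreover have "y ^ p - y = of_nat p * eval_rat h y" using p0 by (simp add: h)
  moreover have "y \<in> alg_ints" using conjugate_eval_alg_int[OF f, of "[:0, 1:]"] xi by simp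
  ultimately show ?thesis by (auto simp: frobenius_fixed_def intro: ai_multiplesI)
qed

text \<open>A polynomial over a field with more roots than its degree vanishes. This is the case of
  the field with \<open>p\<close> elements, phrased by integer polynomials; the induction splits off
  one linear factor at a time.\<close>

lemma prime_dvd_poly_coeffs:
  assumes p: "prime (p :: int)" and R: "finite R" "\<And>r s. r \<in> R \<Longrightarrow> s \<in> R \<Longrightarrow> p dvd r - s \<Longrightarrow> r = s"
    "degree f < card R" "\<And>r. r \<in> R \<Longrightarrow> p dvd poly f r"
  shows "[:p:] dvd f"
  using R
proof (induction "degree f" arbitrary: f R rule: less_induct)
  case less
  from less.prems(3) obtain r where r: "r \<in> R" by fastforce
  show ?case
  proof (cases "degree f = 0")
    case True
    then obtain c where "f = [:c:]" by (rule degree_eq_zeroE)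
    with less.prems(4)[OF r] show ?thesis by (simp add: const_poly_dvd)
  next
    case False
    define g where "g = synthetic_div f r"
    have f: "f = [:- r, 1:] * g + [:poly f r:]" unfolding g_def by (rule synthetic_div_correct'[symmetric])
    have dg: "degree g = degree f - 1" by (simp add: g_def degree_synthetic_div)
    have "[:p:] dvd g"
    proof (rule less.hyps)
      show "degree g < degree f" using False dg by simp
      show "finite (R - {r})" using less.prems by simp
      show "degree g < card (R - {r})" using False dg less.prems(1,3) r by (simp add: card_Diff_singleton)
      show "s = t" if "s \<in> R - {r}" "t \<in> R - {r}" "p dvd s - t" for s t
        using that less.prems(2) by blast
      fix s assume s: "s \<in> R - {r}"
      have "poly f s = (s - r) * poly g s + poly f r"
        by (subst f) (simp add: algebra_simps)
      hence "p dvd (s - r) * poly g s"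
        using less.prems(4) r s by (metis Diff_iff dvd_add_left_iff)
      moreover have "\<not> p dvd s - r" using less.prems(2)[of s r] s r by auto
      ultimately show "p dvd poly g s" using p by (simp add: prime_dvd_mult_iff)
    qed
    moreover have "[:p:] dvd [:poly f r:]" using less.prems(4)[OF r] by (simp add: const_poly_dvd)
    ultimately show ?thesis by (subst f) (intro dvd_add dvd_mult)
  qed
qed

text \<open>\<open>X^p - X\<close> and the product of all \<open>X - r\<close> are both monic of
  degree \<open>p\<close>, so their difference has degree below \<open>p\<close> but vanishes modulo
  \<open>p\<close> at all \<open>p\<close> residues.\<close>

lemma frobenius_factorization:
  fixes x :: "'a::field_char_0"
  assumes p: "prime p" and x: "x \<in> alg_ints"
  shows "x ^ p - x - (\<Prod>r<p. x - of_nat r) \<in> ai_multiples p"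
proof -
  define G :: "int poly" where "G = (\<Prod>r<p. [:- of_nat r, 1:])"
  define f where "f = monom 1 p - [:0, 1:] - G"
  have p2: "p \<ge> 2" using p by (rule prime_ge_2_nat)
  have "lead_coeff G = 1" unfolding G_def lead_coeff_prod by simp
  moreover have "degree G = p" by (simp add: G_def degree_prod_eq_sum_degree)
  ultimately have G: "degree G = p" "lead_coeff G = 1" by auto
  have "degree (monom 1 p - G) \<le> p" using G by (intro degree_diff_le) (auto simp: degree_monom_le)
  moreover have "coeff (monom 1 p - G) p = 0" using G by simp
  ultimately have "monom 1 p - G = 0 \<or> degree (monom 1 p - G) < p" using eq_zero_or_degree_less by blast
  hence "degree (monom 1 p - G) < p" using p2 by auto
  hence "degree ((monom 1 p - G) - [:0, 1:]) < p" using p2 by (rule_tac degree_diff_less) auto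
  hence df: "degree f < p" by (simp add: f_def algebra_simps)
  have "[:int p:] dvd f"
  proof (rule prime_dvd_poly_coeffs[where R = "int ` {..<p}"])
    show "prime (int p)" using p by simp
    show "degree f < card (int ` {..<p})" using df by (simp add: card_image)
    show "r = s" if "r \<in> int ` {..<p}" "s \<in> int ` {..<p}" "int p dvd r - s" for r s
    proof -
      from that have "\<bar>r - s\<bar> < int p" by auto
      with that(3) have "r - s = 0" using dvd_imp_le_int[of "r - s" "int p"] by linarith
      thus ?thesis by simp
    qed
    fix r assume "r \<in> int ` {..<p}"
    then obtain k where k: "k < p" "r = int k" by auto
    have "poly G r = 0" using k by (auto simp: G_def poly_prod)
    hence "poly f r = r ^ p - r" by (simp add: f_def poly_monom)
    \<comment> \<open>Fermat's little theorem, from the fact that a subring contains all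
      integers.\<close>
    moreover have "(of_int r :: 'a) \<in> frobenius_fixed p"
      by (rule is_subring_closed(6)[OF is_subring_frobenius_fixed[OF p]])
    hence "(of_int (r ^ p - r) :: 'a) \<in> ai_multiples p" by (simp add: frobenius_fixed_def)
    hence "int p dvd r ^ p - r" by (simp only: ai_multiples_of_int_iff)
    ultimately show "int p dvd poly f r" by simp
  qed simp
  then obtain g where g: "f = [:int p:] * g" by blast
  have "eval_int G x = (\<Prod>r<p. x - of_nat r)"
    by (simp add: G_def of_int_poly_hom.hom_prod poly_prod)
  hence "x ^ p - x - (\<Prod>r<p. x - of_nat r) = eval_int f x" by (simp add: f_def poly_monom)
  also have "\<dots> = of_nat p * eval_int g x" by (simp add: g)
  finally show ?thesis by (rule ai_multiplesI[OF alg_ints_eval_int[OF x]])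
qed

section \<open>Prime ideals of the ring of all algebraic integers\<close>

definition prime_over :: "nat \<Rightarrow> 'a::field_char_0 set \<Rightarrow> bool" where
  "prime_over p P \<longleftrightarrow> P \<subseteq> alg_ints \<and> of_nat p \<in> P \<and> 1 \<notin> P \<and> (\<forall>x\<in>P. \<forall>y\<in>P. x + y \<in> P) \<and>
     (\<forall>x\<in>P. \<forall>y\<in>alg_ints. x * y \<in> P) \<and>
     (\<forall>x\<in>alg_ints. \<forall>y\<in>alg_ints. x * y \<in> P \<longrightarrow> x \<in> P \<or> y \<in> P)"

text \<open>Zorn's lemma gives a maximal element among the proper ideals containing
  \<open>p\<close>. There is one, the multiples of \<open>p\<close>, since \<open>p\<close> does not
  divide 1. A maximal ideal is prime.\<close>

lemma prime_over_exists:
  assumes p: "prime p"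
  obtains P :: "'a::field_char_0 set" where "prime_over p P"
proof -
  define \<A> :: "'a set set" where "\<A> = {I. I \<subseteq> alg_ints \<and> of_nat p \<in> I \<and> 1 \<notin> I \<and>
    (\<forall>x\<in>I. \<forall>y\<in>I. x + y \<in> I) \<and> (\<forall>x\<in>I. \<forall>y\<in>alg_ints. x * y \<in> I)}"
  have "(of_int 1 :: 'a) \<notin> ai_multiples p"
    unfolding ai_multiples_of_int_iff using prime_gt_1_nat[OF p] by auto
  hence "ai_multiples p \<in> \<A>"
    by (auto simp: \<A>_def intro: ai_multiples_alg_ints ai_multiples_add ai_multiples_mult ai_multiplesI[of 1])
  hence ne: "\<A> \<noteq> {}" by blast
  have "\<exists>M\<in>\<A>. \<forall>X\<in>\<A>. M \<subseteq> X \<longrightarrow> X = M"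
  proof (rule subset_Zorn_nonempty[OF ne])
    fix \<C> assume C: "\<C> \<noteq> {}" "subset.chain \<A> \<C>"
    hence sub: "\<C> \<subseteq> \<A>" by (simp add: subset.chain_def)
    have "x + y \<in> \<Union>\<C>" if xy: "x \<in> \<Union>\<C>" "y \<in> \<Union>\<C>" for x y
    proof -
      from xy obtain X Y where XY: "X \<in> \<C>" "x \<in> X" "Y \<in> \<C>" "y \<in> Y" by blast
      with C(2) have "X \<subseteq> Y \<or> Y \<subseteq> X" unfolding subset.chain_def by blast
      hence "\<exists>Z\<in>\<C>. x \<in> Z \<and> y \<in> Z" using XY by blast
      thus ?thesis using sub by (auto simp: \<A>_def)
    qed
    thus "\<Union>\<C> \<in> \<A>" using C(1) sub unfolding \<A>_def by blast
  qed
  then obtain M where M: "M \<in> \<A>" "\<And>X. X \<in> \<A> \<Longrightarrow> M \<subseteq> X \<Longrightarrow> X = M" by blast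
  have M': "M \<subseteq> alg_ints" "of_nat p \<in> M" "1 \<notin> M" "\<And>x y. x \<in> M \<Longrightarrow> y \<in> M \<Longrightarrow> x + y \<in> M"
    "\<And>x y. x \<in> M \<Longrightarrow> y \<in> alg_ints \<Longrightarrow> x * y \<in> M" using M(1) by (auto simp: \<A>_def)
  have M0: "0 \<in> M" using M'(5)[OF M'(2), of 0] by simp
  \<comment> \<open>By maximality, \<open>M\<close> together with an outside element generates the
    unit ideal.\<close>
  have gen: "\<exists>m\<in>M. \<exists>a\<in>alg_ints. 1 = m + x * a" if x: "x \<in> alg_ints" "x \<notin> M" for x
  proof (rule ccontr)
    assume no: "\<not> ?thesis"
    define J where "J = {m + x * a |m a. m \<in> M \<and> a \<in> alg_ints}"
    have MJ: "M \<subseteq> J" unfolding J_def by (force intro: exI[of _ 0])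
    have "x \<in> J" unfolding J_def using M0 by (intro CollectI exI[of _ 0] exI[of _ 1]) simp
    moreover have "J \<in> \<A>"
      unfolding \<A>_def
    proof (intro CollectI conjI ballI)
      show "J \<subseteq> alg_ints" using M'(1) x by (auto simp: J_def intro!: alg_ints_add alg_ints_mult)
      show "of_nat p \<in> J" using M'(2) MJ by blast
      show "1 \<notin> J" using no by (auto simp: J_def)
    next
      fix u v assume "u \<in> J" "v \<in> J"
      then obtain m a m' a' where "u = m + x * a" "v = m' + x * a'" "m \<in> M" "m' \<in> M"
        "a \<in> alg_ints" "a' \<in> alg_ints" by (auto simp: J_def)
      thus "u + v \<in> J" unfolding J_def
        by (intro CollectI exI[of _ "m + m'"] exI[of _ "a + a'"]) (auto simp: algebra_simps M'(4) alg_ints_add)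
    next
      fix u v :: 'a assume "u \<in> J" "v \<in> alg_ints"
      moreover from this obtain m a where "u = m + x * a" "m \<in> M" "a \<in> alg_ints" by (auto simp: J_def)
      ultimately show "u * v \<in> J" unfolding J_def
        by (intro CollectI exI[of _ "m * v"] exI[of _ "a * v"]) (auto simp: algebra_simps M'(5) alg_ints_mult)
    qed
    ultimately show False using M(2)[of J] MJ x by blast
  qed
  have "x \<in> M \<or> y \<in> M" if xy: "x \<in> alg_ints" "y \<in> alg_ints" "x * y \<in> M" for x y
  proof (rule ccontr)
    assume "\<not> ?thesis"
    then obtain m a m' b where ab: "m \<in> M" "a \<in> alg_ints" "1 = m + x * a" "m' \<in> M" "b \<in> alg_ints" "1 = m' + y * b"
      using gen xy by meson
    have "1 = (m + x * a) * (m' + y * b)" using ab by simp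
    also have "\<dots> = m * (m' + y * b) + m' * (x * a) + x * y * (a * b)" by (simp add: algebra_simps)
    also have "\<dots> \<in> M"
    proof (intro M'(4))
      show "m * (m' + y * b) \<in> M" "m' * (x * a) \<in> M" "x * y * (a * b) \<in> M"
        by (rule M'(5); use ab xy M'(1) in \<open>auto intro: alg_ints_add alg_ints_mult\<close>)+
    qed
    finally show False using M'(3) by simp
  qed
  with M' have "prime_over p M" by (auto simp: prime_over_def)
  thus ?thesis by (rule that)
qed

locale prime_over_locale =
  fixes p :: nat and P :: "'a::field_char_0 set"
  assumes p: "prime p" and P: "prime_over p P"
begin

lemma P_add: "x \<in> P \<Longrightarrow> y \<in> P \<Longrightarrow> x + y \<in> P" using P by (auto simp: prime_over_def)
lemma P_mult: "x \<in> P \<Longrightarrow> y \<in> alg_ints \<Longrightarrow> x * y \<in> P" using P by (auto simp: prime_over_def)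
lemma P_mult': "y \<in> P \<Longrightarrow> x \<in> alg_ints \<Longrightarrow> x * y \<in> P" using P_mult[of y x] by (simp add: mult.commute)
lemma P_prime: "x * y \<in> P \<Longrightarrow> x \<in> alg_ints \<Longrightarrow> y \<in> alg_ints \<Longrightarrow> x \<in> P \<or> y \<in> P"
  using P by (auto simp: prime_over_def)
lemma P_1: "1 \<notin> P" using P by (auto simp: prime_over_def)
lemma P_0: "0 \<in> P" using P P_mult[of "of_nat p" 0] by (auto simp: prime_over_def)
lemma P_uminus: "x \<in> P \<Longrightarrow> - x \<in> P" using P_mult[of x "of_int (-1)"] by (simp del: of_int_minus) simp
lemma P_diff: "x \<in> P \<Longrightarrow> y \<in> P \<Longrightarrow> x - y \<in> P" using P_add[OF _ P_uminus, of x y] by simp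

lemma P_ai_multiples: "x \<in> ai_multiples p \<Longrightarrow> x \<in> P"
  using P by (auto simp: ai_multiples_def prime_over_def)

lemma P_of_int_iff: "of_int k \<in> P \<longleftrightarrow> int p dvd k"
proof
  assume k: "of_int k \<in> P"
  show "int p dvd k"
  proof (rule ccontr)
    assume "\<not> int p dvd k"
    hence "coprime (int p) k" using p by (simp add: prime_imp_coprime)
    then obtain u v where uv: "u * int p + v * k = 1" by (metis bezout_int coprime_imp_gcd_eq_1)
    have "of_nat p * of_int u + of_int k * of_int v \<in> P"
      using k P by (intro P_add P_mult) (auto simp: prime_over_def)
    also have "of_nat p * of_int u + of_int k * of_int v = (of_int (u * int p + v * k) :: 'a)" by (simp add: mult.commute)
    finally show False using uv P_1 by simp
  qed
next
  assume "int p dvd k"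
  thus "of_int k \<in> P" by (intro P_ai_multiples) (simp add: ai_multiples_of_int_iff)
qed

lemma P_prod:
  assumes "finite A" "\<And>a. a \<in> A \<Longrightarrow> f a \<in> alg_ints" "prod f A \<in> P"
  shows "\<exists>a\<in>A. f a \<in> P"
  using assms
proof (induction A rule: finite_induct)
  case (insert a A)
  hence "f a \<in> P \<or> prod f A \<in> P" by (intro P_prime) (auto intro: alg_ints_prod)
  with insert show ?case by auto
qed (use P_1 in auto)

text \<open>Modulo \<open>P\<close> the product of all \<open>x - r\<close> equals
  \<open>x^p - x\<close> and so vanishes; hence the residue of \<open>x\<close> lies in the prime
  field.\<close>

lemma frobenius_fixed_residue:
  assumes "x \<in> frobenius_fixed p"
  obtains r where "r < p" "x - of_nat r \<in> P"
proof -
  have x: "x \<in> alg_ints" "x ^ p - x \<in> ai_multiples p" using assms by (auto simp: frobenius_fixed_def)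
  have "(x ^ p - x) - (x ^ p - x - (\<Prod>r<p. x - of_nat r)) \<in> P"
    by (intro P_diff P_ai_multiples x frobenius_factorization p)
  hence "(\<Prod>r<p. x - of_nat r) \<in> P" by simp
  hence "\<exists>r\<in>{..<p}. x - of_nat r \<in> P" by (rule P_prod[rotated 2]) (auto intro: alg_ints_diff x)
  with that show ?thesis by auto
qed

lemma P_cong_eval_int:
  assumes "x - y \<in> P" "x \<in> alg_ints" "y \<in> alg_ints"
  shows "eval_int g x - eval_int g y \<in> P"
proof (induction g)
  case (pCons a g)
  have "eval_int (pCons a g) x - eval_int (pCons a g) y = x * (eval_int g x - eval_int g y) + (x - y) * eval_int g y"
    by (simp add: algebra_simps)
  also have "\<dots> \<in> P" using assms pCons.IH by (intro P_add P_mult P_mult' alg_ints_eval_int) auto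
  finally show ?case .
qed (use P_0 in auto)

end

section \<open>Primitive elements of Galois extensions\<close>

text \<open>Coordinate vectors are stored as polynomials, so that the same vector can be evaluated
  at each conjugate and at complex roots.\<close>

definition polys_in :: "nat \<Rightarrow> int set \<Rightarrow> int poly set" where
  "polys_in n A = {g. (\<forall>i\<ge>n. coeff g i = 0) \<and> (\<forall>i<n. coeff g i \<in> A)}"

lemma polys_in_bij:
  "bij_betw (\<lambda>f. \<Sum>i<n. monom (f i) i) ({..<n} \<rightarrow>\<^sub>E A) (polys_in n A)"
proof (rule bij_betw_byWitness[where f' = "\<lambda>g. restrict (coeff g) {..<n}"])
  have c: "coeff (\<Sum>i<n. monom (f i) i) j = (if j < n then f j else 0)" for f :: "nat \<Rightarrow> int" and j
    by (simp add: coeff_sum)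
  show "\<forall>f\<in>{..<n} \<rightarrow>\<^sub>E A. restrict (coeff (\<Sum>i<n. monom (f i) i)) {..<n} = f"
  proof (intro ballI ext)
    fix f i assume f: "f \<in> {..<n} \<rightarrow>\<^sub>E A"
    show "restrict (coeff (\<Sum>i<n. monom (f i) i)) {..<n} i = f i"
      unfolding restrict_def c using PiE_arb[OF f, of i] by simp
  qed
  show "\<forall>g\<in>polys_in n A. (\<Sum>i<n. monom (restrict (coeff g) {..<n} i) i) = g"
    by (auto simp: poly_eq_iff c polys_in_def)
  show "(\<lambda>f. \<Sum>i<n. monom (f i) i) ` ({..<n} \<rightarrow>\<^sub>E A) \<subseteq> polys_in n A"
  proof (rule image_subsetI)
    fix f assume f: "f \<in> {..<n} \<rightarrow>\<^sub>E A"
    show "(\<Sum>i<n. monom (f i) i) \<in> polys_in n A"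
      unfolding polys_in_def mem_Collect_eq c using PiE_mem[OF f] by simp
  qed
  show "(\<lambda>g. restrict (coeff g) {..<n}) ` polys_in n A \<subseteq> {..<n} \<rightarrow>\<^sub>E A"
    by (rule image_subsetI, rule PiE_I) (auto simp: polys_in_def)
qed

lemma card_polys_in: "card (polys_in n A) = card A ^ n"
  using bij_betw_same_card[OF polys_in_bij[of n A]] by (simp add: card_PiE)

lemma finite_polys_in: "finite A \<Longrightarrow> finite (polys_in n A)"
  using bij_betw_finite[OF polys_in_bij[of n A]] by (simp add: finite_PiE)

lemma polys_in_coeff_le:
  assumes "g \<in> polys_in n {-int N..int N}"
  shows "\<bar>coeff g i\<bar> \<le> int N"
  using assms by (cases "i < n") (auto simp: polys_in_def abs_le_iff)

lemma polys_inI_le: "(\<And>i. i \<ge> n \<Longrightarrow> coeff g i = 0) \<Longrightarrow> (\<And>i. \<bar>coeff g i\<bar> \<le> int N) \<Longrightarrow> g \<in> polys_in n {-int N..int N}"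
  by (auto simp: polys_in_def abs_le_iff) (metis minus_le_iff)

lemma polys_in_degree: "g \<in> polys_in n A \<Longrightarrow> n > 0 \<Longrightarrow> degree g < n"
  by (auto simp: polys_in_def intro!: degree_lessI)

lemma polys_in_add:
  assumes "f \<in> polys_in n {-int M..int M}" "g \<in> polys_in n {-int N..int N}"
  shows "f + g \<in> polys_in n {-int (M + N)..int (M + N)}"
proof (rule polys_inI_le)
  fix i
  show "\<bar>coeff (f + g) i\<bar> \<le> int (M + N)"
    using polys_in_coeff_le[OF assms(1), of i] polys_in_coeff_le[OF assms(2), of i] by simp
qed (use assms in \<open>auto simp: polys_in_def\<close>)

text \<open>\<theta> is an integral generator of a normal extension and \<open>F\<close> its minimal
  polynomial. All Galois theory used later rests on \<open>normal_F\<close>: every conjugate is a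
  rational polynomial in \<theta>.\<close>

locale galois_element =
  fixes \<theta> :: "'a::{alg_closed_field, field_char_0}" and F :: "int poly"
  assumes irreducible_F: "irreducible (map_poly of_int F :: rat poly)"
    and monic_F: "lead_coeff F = 1"
    and root_F: "eval_int F \<theta> = 0"
    and normal_F: "\<And>y. eval_int F y = 0 \<Longrightarrow> y \<in> rat_adjoin \<theta>"
begin

definition conjugates :: "'a set" where "conjugates = {x. eval_int F x = 0}"

definition deg :: nat where "deg = degree F"

lemma theta_conjugate [simp]: "\<theta> \<in> conjugates"
  by (simp add: conjugates_def root_F)

lemma conjugate_alg_int: "x \<in> conjugates \<Longrightarrow> x \<in> alg_ints"
  using monic_F by (auto simp: conjugates_def alg_ints_iff_int_poly)

lemma F_nz [simp]: "F \<noteq> 0" using monic_F by auto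

lemma conjugates_transfer:
  assumes "eval_rat h x = 0" "x \<in> conjugates" "y \<in> conjugates"
  shows "eval_rat h y = 0"
  using conjugate_eval_zero[OF irreducible_F, of x y h] assms by (simp add: conjugates_def eval_rat_int)

lemma conjugates_transfer_alg_int:
  assumes "eval_rat h x \<in> alg_ints" "x \<in> conjugates" "y \<in> conjugates"
  shows "eval_rat h y \<in> alg_ints"
  using conjugate_eval_alg_int[OF irreducible_F, of x y h] assms by (simp add: conjugates_def eval_rat_int)

lemma F_factorization: "(map_poly of_int F :: 'a poly) = (\<Prod>x\<in>conjugates. [:- x, 1:])"
  and card_conjugates: "card conjugates = deg"
proof -
  have eq: "map_poly of_rat (map_poly of_int F :: rat poly) = (map_poly of_int F :: 'a poly)"
    by (rule poly_eqI) (simp add: coeff_map_poly)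
  have sq: "rsquarefree (map_poly of_int F :: 'a poly)"
    using irreducible_rsquarefree[OF irreducible_F, where ?'a = 'a] unfolding eq .
  show "(map_poly of_int F :: 'a poly) = (\<Prod>x\<in>conjugates. [:- x, 1:])"
    using rsquarefree_factorization(1)[OF sq] monic_F by (simp add: conjugates_def)
  show "card conjugates = deg"
    using rsquarefree_factorization(2)[OF sq] by (simp add: conjugates_def deg_def)
qed

lemma finite_conjugates [simp]: "finite conjugates"
  unfolding conjugates_def by (rule poly_roots_finite) simp

lemma deg_pos: "deg > 0"
  by (metis card_conjugates theta_conjugate finite_conjugates card_gt_0_iff empty_iff)

lemma rat_poly_zero_of_root:
  assumes "eval_rat h x = 0" "x \<in> conjugates" "h = 0 \<or> degree h < deg"
  shows "h = 0"
proof -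
  have "map_poly of_int F dvd h"
    using irreducible_dvd_of_common_root[OF irreducible_F] assms by (simp add: conjugates_def eval_rat_int)
  thus ?thesis using assms(3) by (auto simp: deg_def dest: dvd_imp_degree_le)
qed

lemma rat_adjoin_reduced:
  assumes "x \<in> rat_adjoin \<theta>"
  obtains h where "x = eval_rat h \<theta>" "degree h < deg"
proof -
  obtain h0 where h0: "x = eval_rat h0 \<theta>" using assms by (rule rat_adjoinE)
  define Fq where "Fq = (map_poly of_int F :: rat poly)"
  define h where "h = h0 mod Fq"
  have dF: "degree Fq = deg" "Fq \<noteq> 0" by (simp_all add: Fq_def deg_def)
  have "h0 = h0 div Fq * Fq + h" by (simp add: h_def)
  hence "x = eval_rat (h0 div Fq) \<theta> * eval_rat Fq \<theta> + eval_rat h \<theta>"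
    unfolding h0 by (metis eval_rat_simps(5) eval_rat_simps(8))
  hence "x = eval_rat h \<theta>" by (simp add: Fq_def eval_rat_int root_F)
  moreover have "h = 0 \<or> degree h < deg" unfolding h_def using degree_mod_less[of Fq h0] dF by simp
  ultimately show ?thesis using deg_pos by (intro that) auto
qed

lemma int_poly_zero_of_root:
  assumes "eval_int g x = 0" "x \<in> conjugates" "g \<in> polys_in deg A"
  shows "g = 0"
proof -
  have "(map_poly of_int g :: rat poly) = 0"
  proof (rule rat_poly_zero_of_root[of _ x])
    show "map_poly rat_of_int g = 0 \<or> degree (map_poly rat_of_int g) < deg"
      using polys_in_degree[OF assms(3) deg_pos] by simp
  qed (use assms in \<open>simp_all add: eval_rat_int\<close>)
  thus ?thesis by simp
qed

definition conj_poly :: "'a \<Rightarrow> rat poly" where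
  "conj_poly x = (SOME h. x = eval_rat h \<theta>)"

lemma conj_poly: "x \<in> conjugates \<Longrightarrow> eval_rat (conj_poly x) \<theta> = x"
  unfolding conj_poly_def by (rule someI_ex[THEN sym])
    (use normal_F in \<open>auto simp: conjugates_def elim: rat_adjoinE\<close>)

text \<open>The map is the restriction to the conjugates of the automorphism \<open>\<theta> \<mapsto> y\<close>.\<close>

lemma conj_poly_bij:
  assumes y: "y \<in> conjugates"
  shows "bij_betw (\<lambda>x. eval_rat (conj_poly x) y) conjugates conjugates"
proof -
  have "inj_on (\<lambda>x. eval_rat (conj_poly x) y) conjugates"
  proof (rule inj_onI)
    fix x x' assume xx: "x \<in> conjugates" "x' \<in> conjugates" "eval_rat (conj_poly x) y = eval_rat (conj_poly x') y"
    hence "eval_rat (conj_poly x - conj_poly x') y = 0" by simp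
    from conjugates_transfer[OF this y theta_conjugate] xx show "x = x'" by (simp add: conj_poly)
  qed
  moreover have "(\<lambda>x. eval_rat (conj_poly x) y) ` conjugates \<subseteq> conjugates"
  proof safe
    fix x assume x: "x \<in> conjugates"
    have "eval_rat (pcompose (map_poly of_int F) (conj_poly x)) \<theta> = 0"
      using x by (simp add: eval_rat_int conj_poly) (simp add: conjugates_def)
    from conjugates_transfer[OF this theta_conjugate y]
    show "eval_rat (conj_poly x) y \<in> conjugates" by (simp add: conjugates_def eval_rat_int)
  qed
  ultimately show ?thesis
    by (simp add: bij_betw_def endo_inj_surj)
qed

text \<open>The second conjunct transports the factorization of the norm to any field in which
  \<^term>\<open>F\<close> has a root, in particular to the complex numbers.\<close>

lemma norm_exists:
  "\<exists>k::int. (\<Prod>x\<in>conjugates. eval_int g x) = of_int k \<and>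
     map_poly of_int F dvd (\<Prod>x\<in>conjugates. pcompose (map_poly of_int g) (conj_poly x)) - [:of_int k :: rat:]"
proof -
  \<comment> \<open>A rational polynomial whose value at \<theta> is the norm. Its value at any
    other conjugate is the same, since there the factors are only permuted.\<close>
  define H where "H = (\<Prod>x\<in>conjugates. pcompose (map_poly of_int g :: rat poly) (conj_poly x))"
  define m where "m = (\<Prod>x\<in>conjugates. eval_int g x)"
  have H: "eval_rat H y = m" if y: "y \<in> conjugates" for y
  proof -
    have "eval_rat H y = (\<Prod>x\<in>conjugates. eval_int g (eval_rat (conj_poly x) y))"
      by (simp add: H_def eval_rat_prod eval_rat_int)
    also have "\<dots> = m" unfolding m_def by (rule prod.reindex_bij_betw[OF conj_poly_bij[OF y]])
    finally show ?thesis .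
  qed
  define Fq where "Fq = (map_poly of_int F :: rat poly)"
  define r where "r = H mod Fq"
  have dFq: "degree Fq = deg" "Fq \<noteq> 0" by (simp_all add: Fq_def deg_def)
  have dr: "r = 0 \<or> degree r < deg" unfolding r_def using degree_mod_less[of Fq H] dFq by simp
  have r: "eval_rat r y = m" if y: "y \<in> conjugates" for y
  proof -
    have "H = H div Fq * Fq + r" by (simp add: r_def)
    hence "eval_rat H y = eval_rat (H div Fq) y * eval_rat Fq y + eval_rat r y"
      by (metis eval_rat_simps(5) eval_rat_simps(8))
    thus ?thesis using H[OF y] y by (simp add: Fq_def eval_rat_int conjugates_def)
  qed
  \<comment> \<open>Its degree is below \<open>deg\<close>, but it vanishes at all
    \<open>deg\<close> conjugates. So \<open>H\<close> reduces modulo \<open>F\<close> to a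
    constant, which is rational and integral.\<close>
  define s where "s = (map_poly of_rat r :: 'a poly) - [:m:]"
  have "s = 0"
  proof (rule ccontr)
    assume "s \<noteq> 0"
    have "degree s < deg" unfolding s_def using dr deg_pos
      by (intro degree_diff_less) auto
    moreover have "conjugates \<subseteq> {x. poly s x = 0}" using r by (auto simp: s_def eval_rat_def)
    hence "card conjugates \<le> card {x. poly s x = 0}"
      by (intro card_mono poly_roots_finite \<open>s \<noteq> 0\<close>)
    hence "deg \<le> degree s" using card_poly_roots_bound[OF \<open>s \<noteq> 0\<close>] card_conjugates by linarith
    ultimately show False by simp
  qed
  hence s: "map_poly of_rat r = [:m:]" by (simp add: s_def)
  hence m: "m = of_rat (coeff r 0)"
    by (metis coeff_map_poly coeff_pCons_0 of_rat_0)
  moreover have "m \<in> alg_ints"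
    unfolding m_def by (intro alg_ints_prod alg_ints_eval_int conjugate_alg_int)
  ultimately have "coeff r 0 \<in> \<int>" using alg_ints_of_rat by metis
  then obtain k where k: "coeff r 0 = of_int k" by (elim Ints_cases)
  have "degree r = degree (map_poly of_rat r :: 'a poly)" by simp
  also have "\<dots> = 0" unfolding s by simp
  finally have "degree r = 0" .
  hence "r = [:of_int k:]" using k by (metis degree_eq_zeroE coeff_pCons_0)
  hence "Fq dvd H - [:of_int k:]" unfolding r_def by (metis minus_mod_eq_mult_div dvd_triv_left)
  moreover have "m = of_int k" using m k by simp
  ultimately show ?thesis unfolding H_def m_def Fq_def by blast
qed

definition nrm :: "int poly \<Rightarrow> int" where
  "nrm g = (THE k. (\<Prod>x\<in>conjugates. eval_int g x) = of_int k)"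

lemma nrm: "of_int (nrm g) = (\<Prod>x\<in>conjugates. eval_int g x)"
proof -
  obtain k where k: "(\<Prod>x\<in>conjugates. eval_int g x) = of_int k" using norm_exists[of g] by blast
  hence "nrm g = k" unfolding nrm_def by (intro the_equality) auto
  with k show ?thesis by simp
qed

lemma nrm_nonzero: "g \<in> polys_in deg A \<Longrightarrow> g \<noteq> 0 \<Longrightarrow> nrm g \<noteq> 0"
  using int_poly_zero_of_root nrm[of g] by (metis (no_types, lifting) finite_conjugates of_int_0 prod_zero_iff)

text \<open>The points \<open>w x\<close> are the images of the conjugates under the embedding that
  sends \<theta> to a complex root of \<open>F\<close>. They supply the absolute values for
  estimating norms.\<close>

lemma nrm_complex:
  obtains w :: "'a \<Rightarrow> complex" where "\<And>g. of_int (nrm g) = (\<Prod>x\<in>conjugates. eval_int g (w x))"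
proof -
  have "degree (map_poly of_int F :: complex poly) > 0" using deg_pos by (simp add: deg_def)
  then obtain z :: complex where z: "eval_int F z = 0" using alg_closed_imp_poly_has_root by blast
  have "of_int (nrm g) = (\<Prod>x\<in>conjugates. eval_int g (eval_rat (conj_poly x) z))" for g
  proof -
    obtain k where k: "(\<Prod>x\<in>conjugates. eval_int g x) = of_int k"
      "map_poly of_int F dvd (\<Prod>x\<in>conjugates. pcompose (map_poly of_int g) (conj_poly x)) - [:of_int k :: rat:]"
      using norm_exists[of g] by blast
    have "eval_rat (map_poly of_int F) z = 0" using z by (simp add: eval_rat_int)
    from rat_poly_dvd_eval[OF k(2) this]
    have "(\<Prod>x\<in>conjugates. eval_int g (eval_rat (conj_poly x) z)) = of_int k"
      by (simp add: eval_rat_prod eval_rat_int)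
    moreover have "nrm g = k" using k(1) nrm[of g] by simp
    ultimately show ?thesis by simp
  qed
  thus ?thesis by (rule that[of "\<lambda>x. eval_rat (conj_poly x) z"])
qed

text \<open>Both are factorwise estimates at the complex conjugates: each value of a box element is
  at most \<open>W * N\<close>, and for large \<open>H\<close> the shift \<open>H * N\<close>
  outweighs it. \<open>H\<close> is independent of \<open>Q\<close>.\<close>

lemma
  shows nrm_upper: "\<exists>W::real. W \<ge> 1 \<and> (\<forall>N. \<forall>g\<in>polys_in deg {-int N..int N}. \<bar>real_of_int (nrm g)\<bar> \<le> (W * real N) ^ deg)"
    and nrm_lower: "\<exists>H::nat. \<forall>Q\<ge>1. \<forall>N\<ge>1. \<forall>b\<in>polys_in deg {-int N..int N}.
      \<bar>real_of_int (nrm (1 + of_nat Q * (of_nat (H * N) + b)))\<bar> \<ge> real N ^ deg"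
proof -
  obtain w :: "'a \<Rightarrow> complex" where w: "\<And>g. of_int (nrm g) = (\<Prod>x\<in>conjugates. eval_int g (w x))"
    using nrm_complex by blast
  have nw: "\<bar>real_of_int (nrm g)\<bar> = (\<Prod>x\<in>conjugates. cmod (eval_int g (w x)))" for g
  proof -
    have "\<bar>real_of_int (nrm g)\<bar> = cmod (of_int (nrm g))" by simp
    thus ?thesis unfolding w prod_norm .
  qed
  define W where "W = 1 + (\<Sum>x\<in>conjugates. \<Sum>i<deg. cmod (w x) ^ i)"
  have W1: "W \<ge> 1" unfolding W_def by (auto intro!: sum_nonneg)
  have ub: "cmod (eval_int g (w x)) \<le> W * real N" if "g \<in> polys_in deg {-int N..int N}" "x \<in> conjugates" for g x N
  proof -
    have "eval_int g (w x) = (\<Sum>i<deg. of_int (coeff g i) * w x ^ i)"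
      by (rule eval_int_altdef) (rule polys_in_degree[OF that(1) deg_pos])
    also have "cmod \<dots> \<le> (\<Sum>i<deg. cmod (of_int (coeff g i) * w x ^ i))" by (rule norm_sum)
    also have "\<dots> \<le> (\<Sum>i<deg. real N * cmod (w x) ^ i)"
    proof (rule sum_mono)
      fix i
      have "\<bar>coeff g i\<bar> \<le> int N" by (rule polys_in_coeff_le[OF that(1)])
      hence "\<bar>real_of_int (coeff g i)\<bar> \<le> real N" by linarith
      thus "cmod (of_int (coeff g i) * w x ^ i) \<le> real N * cmod (w x) ^ i"
        by (simp add: norm_mult norm_power mult_right_mono)
    qed
    also have "\<dots> = real N * (\<Sum>i<deg. cmod (w x) ^ i)" by (simp add: sum_distrib_left)
    also have "\<dots> \<le> real N * W"
    proof (intro mult_left_mono)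
      have "(\<Sum>i<deg. cmod (w x) ^ i) \<le> (\<Sum>x\<in>conjugates. \<Sum>i<deg. cmod (w x) ^ i)"
        by (rule member_le_sum[OF that(2)]) (auto intro: sum_nonneg)
      thus "(\<Sum>i<deg. cmod (w x) ^ i) \<le> W" by (simp add: W_def)
    qed simp
    finally show ?thesis by (simp add: mult.commute)
  qed
  have "\<bar>real_of_int (nrm g)\<bar> \<le> (W * real N) ^ deg" if "g \<in> polys_in deg {-int N..int N}" for g N
  proof -
    have "(\<Prod>x\<in>conjugates. cmod (eval_int g (w x))) \<le> (\<Prod>x\<in>conjugates. W * real N)"
      by (intro prod_mono conjI ub that) auto
    thus ?thesis by (simp add: nw card_conjugates)
  qed
  with W1 show "\<exists>W::real. W \<ge> 1 \<and> (\<forall>N. \<forall>g\<in>polys_in deg {-int N..int N}. \<bar>real_of_int (nrm g)\<bar> \<le> (W * real N) ^ deg)"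
    by blast
  \<comment> \<open>With \<open>H \<ge> W + 2\<close> each factor is at least
    \<open>2 * Q * N - 1\<close>, and thus at least \<open>N\<close>; the 2 instead of 1 absorbs the
    summand 1 of the shifted element.\<close>
  define H where "H = nat \<lceil>W\<rceil> + 2"
  have H: "real H \<ge> W + 2" unfolding H_def using W1 by linarith
  have "\<bar>real_of_int (nrm (1 + of_nat Q * (of_nat (H * N) + b)))\<bar> \<ge> real N ^ deg"
    if Q: "Q \<ge> 1" and N: "N \<ge> 1" and b: "b \<in> polys_in deg {-int N..int N}" for Q N b
  proof -
    have "real N \<le> cmod (eval_int (1 + of_nat Q * (of_nat (H * N) + b)) (w x))" if x: "x \<in> conjugates" for x
    proof -
      have "real Q * (real H * real N) = cmod (of_nat Q * (of_nat (H * N)))" by (simp add: norm_mult)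
      also have "of_nat Q * (of_nat (H * N)) = eval_int (1 + of_nat Q * (of_nat (H * N) + b)) (w x)
        - (1 + of_nat Q * eval_int b (w x))" by (simp add: algebra_simps)
      also have "cmod \<dots> \<le> cmod (eval_int (1 + of_nat Q * (of_nat (H * N) + b)) (w x)) +
        cmod (1 + of_nat Q * eval_int b (w x))" by (rule norm_triangle_ineq4)
      also have "cmod (1 + of_nat Q * eval_int b (w x)) \<le> 1 + real Q * (W * real N)"
        by (rule order.trans[OF norm_triangle_ineq]) (use ub[OF b x] in \<open>auto simp: norm_mult mult_left_mono\<close>)
      finally have "real Q * real N * (real H - W) - 1 \<le> cmod (eval_int (1 + of_nat Q * (of_nat (H * N) + b)) (w x))"
        by (simp add: algebra_simps)
      moreover have "real Q * real N * (real H - W) \<ge> real Q * real N * 2"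
        using H by (intro mult_left_mono) auto
      moreover have "1 * real N \<le> real Q * real N" using Q by (intro mult_right_mono) auto
      ultimately show ?thesis using N by linarith
    qed
    hence "(\<Prod>x\<in>conjugates. real N) \<le> (\<Prod>x\<in>conjugates. cmod (eval_int (1 + of_nat Q * (of_nat (H * N) + b)) (w x)))"
      by (intro prod_mono) auto
    thus ?thesis by (simp add: nw card_conjugates)
  qed
  thus "\<exists>H::nat. \<forall>Q\<ge>1. \<forall>N\<ge>1. \<forall>b\<in>polys_in deg {-int N..int N}.
      \<bar>real_of_int (nrm (1 + of_nat Q * (of_nat (H * N) + b)))\<bar> \<ge> real N ^ deg" by blast
qed

lemma int_division: "\<exists>q r. g = q * F + r \<and> (\<forall>i\<ge>deg. coeff r i = 0)"
proof -
  have "\<exists>q r. g = q * F + r \<and> (\<forall>i. coeff r i \<in> UNIV) \<and> (r = 0 \<or> degree r < degree F)"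
    by (rule poly_division_over_subring) (auto simp: monic_F)
  thus ?thesis by (metis coeff_0 coeff_eq_0 deg_def order_less_le_trans)
qed

text \<open>The translates of a fundamental parallelotope of the sublattice \<open>b \<int>[\<theta>]\<close>, whose diameter
  is linear in the size of \<open>b\<close>, cover \<open>\<int>[\<theta>]\<close>.\<close>

lemma small_representatives:
  "\<exists>C::nat. \<forall>N. \<forall>b\<in>polys_in deg {-int N..int N}. b \<noteq> 0 \<longrightarrow>
     (\<forall>y. \<exists>y'\<in>polys_in deg {-int (C * N)..int (C * N)}. \<exists>u v. y = y' + b * u + F * v)"
proof -
  \<comment> \<open>The reductions \<open>R m\<close> of the powers of \<open>X\<close> are
    structure constants: products of two reduced elements involve only \<open>m < 2 * deg\<close>,
    so \<open>C0\<close> bounds all coefficients that occur.\<close>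
  have "\<forall>m. \<exists>q r. monom 1 m = q * F + r \<and> (\<forall>i\<ge>deg. coeff r i = 0)" using int_division by blast
  then obtain q R where R: "\<And>m. monom 1 m = q m * F + R m" "\<And>m i. i \<ge> deg \<Longrightarrow> coeff (R m) i = 0"
    by metis
  define C0 where "C0 = (\<Sum>m<2 * deg. \<Sum>i<deg. nat \<bar>coeff (R m) i\<bar>)"
  have C0: "\<bar>coeff (R m) i\<bar> \<le> int C0" if "m < 2 * deg" for m i
  proof (cases "i < deg")
    case True
    have "nat \<bar>coeff (R m) i\<bar> \<le> (\<Sum>i<deg. nat \<bar>coeff (R m) i\<bar>)"
      using True by (intro member_le_sum) auto
    also have "\<dots> \<le> C0" unfolding C0_def using that by (intro member_le_sum) auto
    finally show ?thesis by linarith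
  qed (simp add: R)
  define Fq where "Fq = (map_poly of_int F :: rat poly)"
  have dFq: "degree Fq = deg" "Fq \<noteq> 0" by (simp_all add: Fq_def deg_def)
  define C where "C = deg * deg * C0"
  have "\<exists>y'\<in>polys_in deg {-int (C * N)..int (C * N)}. \<exists>u v. y = y' + b * u + F * v"
    if b: "b \<in> polys_in deg {-int N..int N}" "b \<noteq> 0" for N b y
  proof -
    define bq where "bq = (map_poly of_int b :: rat poly)"
    define yq where "yq = (map_poly of_int y :: rat poly)"
    have "\<not> Fq dvd bq"
      using b polys_in_degree[OF b(1) deg_pos] dFq by (auto simp: bq_def dest: dvd_imp_degree_le)
    hence "coprime Fq bq"
      using irreducible_F by (simp add: Fq_def irreducible_imp_prime_elem prime_elem_imp_coprime)
    then obtain s0 t0 where bez: "t0 * Fq + s0 * bq = 1"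
      by (metis bezout_coefficients_fst_snd coprime_imp_gcd_eq_1)
    \<comment> \<open>\<open>s0\<close> inverts \<open>b\<close> modulo \<open>F\<close>, so
      \<open>s\<close> holds the coordinates of \<open>y / b\<close>. Rounding down gives
      \<open>u\<close>; the fractional part \<open>z\<close> has coordinates in [0, 1), and
      \<open>y - b u\<close> is congruent to \<open>b z\<close>.\<close>
    define s where "s = (yq * s0) mod Fq"
    define u where "u = map_poly floor s"
    define z where "z = s - map_poly of_int u"
    have ds: "coeff s i = 0" if "i \<ge> deg" for i
      using degree_mod_less[of Fq "yq * s0"] dFq that
      by (metis coeff_0 coeff_eq_0 le_trans linorder_not_le s_def)
    have z: "0 \<le> coeff z i" "coeff z i < 1" for i
      by (simp_all add: z_def u_def coeff_map_poly) linarith+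
    have z0: "coeff z i = 0" if "i \<ge> deg" for i using ds[OF that] by (simp add: z_def u_def coeff_map_poly)
    obtain v y' where y': "y - b * u = v * F + y'" "\<And>i. i \<ge> deg \<Longrightarrow> coeff y' i = 0"
      using int_division[of "y - b * u"] by blast
    \<comment> \<open>The product \<open>b z\<close>, expanded and reduced modulo \<open>F\<close>.
      Each of its \<open>deg^2\<close> summands has coefficients of size at most
      \<open>N * C0\<close>.\<close>
    define y2 where "y2 = (\<Sum>i<deg. \<Sum>j<deg. smult (of_int (coeff b i) * coeff z j) (map_poly of_int (R (i + j))))"
    have "Fq dvd bq * z - y2"
    proof -
      have bq: "bq = (\<Sum>i<deg. monom (of_int (coeff b i)) i)"
        using b by (intro poly_eqI) (auto simp: bq_def coeff_sum polys_in_def)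
      have zq: "z = (\<Sum>j<deg. monom (coeff z j) j)"
        by (intro poly_eqI) (auto simp: coeff_sum z0)
      have "bq * z = (\<Sum>i<deg. \<Sum>j<deg. smult (of_int (coeff b i) * coeff z j) (monom 1 (i + j)))"
        by (subst bq, subst zq) (simp add: sum_product mult_monom smult_monom)
      hence "bq * z - y2 = (\<Sum>i<deg. \<Sum>j<deg. smult (of_int (coeff b i) * coeff z j)
          (monom 1 (i + j) - map_poly of_int (R (i + j))))"
        by (simp add: y2_def smult_diff_right sum_subtractf)
      moreover have "Fq dvd monom 1 m - map_poly of_int (R m)" for m
      proof -
        have "(monom 1 m :: rat poly) = map_poly of_int (monom 1 m)" by (simp add: map_poly_monom)
        also have "\<dots> = map_poly of_int (q m) * Fq + map_poly of_int (R m)"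
          by (subst R(1)) (simp add: Fq_def hom_distribs)
        finally show ?thesis by simp
      qed
      ultimately show ?thesis by (auto intro!: dvd_sum dvd_smult)
    qed
    moreover have "Fq dvd (yq - bq * map_poly of_int u) - bq * z"
    proof -
      define D where "D = (yq * s0) div Fq"
      have "yq * s0 = D * Fq + s" by (simp add: s_def D_def)
      hence "s = yq * s0 - D * Fq" by simp
      hence "bq * s = bq * (yq * s0 - D * Fq)" by (rule arg_cong)
      hence "bq * s = yq * (s0 * bq) - bq * D * Fq" by (simp add: algebra_simps)
      also have "s0 * bq = 1 - t0 * Fq" using bez by (simp add: algebra_simps)
      finally have "bq * s = yq - Fq * (yq * t0 + bq * D)" by (simp add: algebra_simps)
      hence "(yq - bq * map_poly of_int u) - bq * z = Fq * (yq * t0 + bq * D)"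
        by (simp add: z_def algebra_simps)
      thus ?thesis by simp
    qed
    moreover have "Fq dvd map_poly of_int y' - (yq - bq * map_poly of_int u)"
    proof -
      have "y' = y - b * u - v * F" using y'(1) by (simp add: algebra_simps)
      hence "map_poly of_int y' = yq - bq * map_poly of_int u - map_poly of_int v * Fq"
        by (simp add: yq_def bq_def Fq_def hom_distribs)
      thus ?thesis by simp
    qed
    ultimately have "Fq dvd (map_poly of_int y' - (yq - bq * map_poly of_int u)) +
        ((yq - bq * map_poly of_int u) - bq * z) + (bq * z - y2)"
      by (intro dvd_add)
    hence dvd: "Fq dvd map_poly of_int y' - y2" by simp
    have c2: "coeff y2 i = (\<Sum>j<deg. \<Sum>k<deg. of_int (coeff b j) * coeff z k * of_int (coeff (R (j + k)) i))" for i
      by (simp add: y2_def coeff_sum coeff_map_poly)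
    have "degree (map_poly of_int y' - y2) < deg"
      using deg_pos by (intro degree_lessI) (auto simp: coeff_map_poly y'(2) c2 R(2))
    \<comment> \<open>Both have degree below \<open>deg\<close> and agree modulo \<open>F\<close>;
      the fractional parts thus combine to integers.\<close>
    hence eq: "map_poly of_int y' = y2"
      using dvd dFq by (metis dvd_imp_degree_le eq_iff_diff_eq_0 linorder_not_le)
    have "\<bar>coeff y' i\<bar> \<le> int (C * N)" for i
    proof -
      have "(of_int \<bar>coeff y' i\<bar> :: rat) = \<bar>coeff y2 i\<bar>" by (simp flip: eq add: coeff_map_poly)
      also have "\<dots> \<le> (\<Sum>j<deg. \<Sum>k<deg. \<bar>of_int (coeff b j) * coeff z k * of_int (coeff (R (j + k)) i)\<bar>)"
        unfolding c2 by (intro order.trans[OF sum_abs] sum_mono order_refl)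
      also have "\<dots> \<le> (\<Sum>j<deg. \<Sum>k<deg. of_nat N * 1 * of_nat C0)"
      proof (intro sum_mono)
        fix j k assume jk: "j \<in> {..<deg}" "k \<in> {..<deg}"
        have "\<bar>coeff b j\<bar> \<le> int N" "\<bar>coeff (R (j + k)) i\<bar> \<le> int C0"
          using polys_in_coeff_le[OF b(1)] C0[of "j + k" i] jk by auto
        hence "\<bar>of_int (coeff b j)\<bar> \<le> (of_nat N :: rat)" "\<bar>of_int (coeff (R (j + k)) i)\<bar> \<le> (of_nat C0 :: rat)"
          by (metis of_int_abs of_int_le_iff of_int_of_nat_eq)+
        moreover have "\<bar>coeff z k\<bar> \<le> 1" using z[of k] by simp
        ultimately show "\<bar>of_int (coeff b j) * coeff z k * of_int (coeff (R (j + k)) i)\<bar> \<le> of_nat N * 1 * of_nat C0"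
          unfolding abs_mult by (intro mult_mono) auto
      qed
      also have "\<dots> = of_int (int (C * N))" by (simp add: C_def)
      finally show ?thesis by (simp only: of_int_le_iff)
    qed
    hence "y' \<in> polys_in deg {-int (C * N)..int (C * N)}" using y'(2) by (intro polys_inI_le)
    moreover have "y = y' + b * u + F * v" using y'(1) by (simp add: algebra_simps)
    ultimately show ?thesis by blast
  qed
  thus ?thesis by blast
qed

end

section \<open>An upper bound for primes with trivial Frobenius\<close>

text \<open>Valuation at \<open>P\<close> without localizing: a factor \<open>s\<close> outside
  \<open>P\<close> is harmless. After cancelling \<open>p^k\<close>, the remaining cofactor of
  \<open>m\<close> lies in \<open>P\<close> and is an integer, hence divisible by
  \<open>p\<close>.\<close>

lemma (in prime_over_locale) prime_power_dvd:
  assumes "s \<in> alg_ints" "s \<notin> P" "of_int m * s \<in> ai_multiples (p ^ k)"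
  shows "int p ^ k dvd m"
  using assms(3)
proof (induction k)
  case (Suc k)
  then obtain z where z: "z \<in> alg_ints" "of_int m * s = of_nat (p ^ Suc k) * z"
    by (auto simp: ai_multiples_def)
  have "of_int m * s = of_nat (p ^ k) * (of_nat p * z)" using z(2) by (simp add: mult_ac)
  hence "of_int m * s \<in> ai_multiples (p ^ k)"
    by (rule ai_multiplesI[rotated]) (use z in \<open>auto intro: alg_ints_mult\<close>)
  with Suc.IH obtain m' where m': "m = int p ^ k * m'" by blast
  have p0: "p \<noteq> 0" using p by auto
  have "(of_nat p ^ k) * (of_int m' * s) = (of_nat p ^ k :: 'a) * (of_nat p * z)"
    using z(2) m' by (simp add: mult_ac)
  hence "of_int m' * s = of_nat p * z" using p0 by simp
  hence "of_int m' * s \<in> P" by (intro P_ai_multiples ai_multiplesI[OF z(1)])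
  hence "of_int m' \<in> P" using P_prime[of "of_int m'" s] assms(1,2) by auto
  hence "int p dvd m'" by (simp add: P_of_int_iff)
  thus ?case using m' by (simp add: mult.commute mult_dvd_mono)
qed auto

lemma sum_ln_primes_le:
  fixes T :: "nat set" and m :: int
  assumes T: "finite T" "\<And>p. p \<in> T \<Longrightarrow> prime p" and m: "m \<noteq> 0"
    and dvd: "\<And>p. p \<in> T \<Longrightarrow> int p ^ w p dvd m"
  shows "(\<Sum>p\<in>T. real (w p) * ln (real p)) \<le> ln \<bar>real_of_int m\<bar>"
proof -
  have "(\<Prod>p\<in>T. int p ^ w p) dvd m" using T dvd
  proof (induction T rule: finite_induct)
    case (insert p T)
    have "coprime (int p ^ w p) (\<Prod>q\<in>T. int q ^ w q)"
    proof (rule prod_coprime_right)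
      fix q assume "q \<in> T"
      hence "coprime p q" using insert by (metis insertCI primes_coprime)
      thus "coprime (int p ^ w p) (int q ^ w q)" by simp
    qed
    thus ?case using insert by (simp add: divides_mult)
  qed auto
  hence "\<bar>\<Prod>p\<in>T. int p ^ w p\<bar> \<le> \<bar>m\<bar>" using m by (rule dvd_imp_le_int[rotated])
  hence le: "(\<Prod>p\<in>T. int p ^ w p) \<le> \<bar>m\<bar>" by simp
  have p0: "real p > 0" if "p \<in> T" for p using T(2)[OF that] by (simp add: prime_gt_0_nat)
  have "(\<Sum>p\<in>T. real (w p) * ln (real p)) = (\<Sum>p\<in>T. ln (real p ^ w p))"
    using p0 by (intro sum.cong) (auto simp: ln_realpow)
  also have "\<dots> = ln (\<Prod>p\<in>T. real p ^ w p)" using p0 T(1) by (intro ln_prod[symmetric]) auto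
  also have "\<dots> = ln (real_of_int (\<Prod>p\<in>T. int p ^ w p))" by simp
  also have "\<dots> \<le> ln (real_of_int \<bar>m\<bar>)"
  proof (rule ln_mono)
    show "real_of_int (\<Prod>p\<in>T. int p ^ w p) \<le> real_of_int \<bar>m\<bar>" using le by (simp only: of_int_le_iff)
    show "0 < real_of_int (\<Prod>p\<in>T. int p ^ w p)" using p0 by (auto intro!: prod_pos)
  qed
  finally show ?thesis by simp
qed

text \<open>Cauchy-Schwarz for the sizes of the at most \<open>p\<close> fibres of \<open>c\<close>;
  ordered pairs are counted, including the diagonal.\<close>

lemma card_collisions:
  fixes c :: "'b \<Rightarrow> nat"
  assumes U: "finite U" and c: "\<And>u. u \<in> U \<Longrightarrow> c u < p"
  shows "card U ^ 2 \<le> p * card {(u, v) \<in> U \<times> U. c u = c v}"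
proof -
  define n where "n = (\<lambda>r. card {u \<in> U. c u = r})"
  have "U = (\<Union>r<p. {u \<in> U. c u = r})" using c by auto
  hence "card U = card (\<Union>r<p. {u \<in> U. c u = r})" by simp
  also have "\<dots> = (\<Sum>r<p. n r)" unfolding n_def using U by (intro card_UN_disjoint) auto
  finally have cu: "card U = (\<Sum>r<p. n r)" .
  have "{(u, v) \<in> U \<times> U. c u = c v} = (\<Union>r<p. {u \<in> U. c u = r} \<times> {u \<in> U. c u = r})"
    using c by auto
  hence "card {(u, v) \<in> U \<times> U. c u = c v} = card (\<Union>r<p. {u \<in> U. c u = r} \<times> {u \<in> U. c u = r})" by simp
  also have "\<dots> = (\<Sum>r<p. n r ^ 2)"
    using U by (subst card_UN_disjoint) (auto simp: n_def card_cartesian_product power2_eq_square)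
  finally have cc: "card {(u, v) \<in> U \<times> U. c u = c v} = (\<Sum>r<p. n r ^ 2)" .
  have "(\<Sum>r<p. real (n r)) ^ 2 \<le> (\<Sum>r<p. real (n r) ^ 2) * real (card {..<p})"
    by (rule sum_squared_le_sum_of_squares)
  hence "real ((\<Sum>r<p. n r) ^ 2) \<le> real (p * (\<Sum>r<p. n r ^ 2))" by (simp add: mult.commute)
  thus ?thesis unfolding cu cc by (simp only: of_nat_le_iff)
qed

context galois_element
begin

lemma conjugate_frobenius_fixed:
  assumes "\<theta> \<in> frobenius_fixed p" "x \<in> conjugates" "prime p"
  shows "x \<in> frobenius_fixed p"
  using conjugate_in_frobenius_fixed[OF irreducible_F _ _ assms(3,1), of x] assms(2) root_F
  by (simp add: conjugates_def eval_rat_int)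

text \<open>If \<open>y = g(x)\<close> lies in \<open>P\<close>, then \<open>y^(p - 1) - 1\<close>
  does not, while its product with \<open>y\<close> is a multiple of \<open>p\<close>. So each such
  conjugate contributes a factor \<open>p\<close> up to a multiplier outside \<open>P\<close>, and
  the product of the multipliers stays outside \<open>P\<close>.\<close>

lemma prime_power_dvd_nrm:
  assumes p: "prime p" and \<theta>: "\<theta> \<in> frobenius_fixed p" and P: "prime_over p P"
  shows "int p ^ card {x \<in> conjugates. eval_int g x \<in> P} dvd nrm g"
proof -
  interpret prime_over_locale p P using p P by unfold_locales
  define A where "A = {x \<in> conjugates. eval_int g x \<in> P}"
  have fin: "finite A" by (simp add: A_def)
  have ai: "eval_int g x \<in> alg_ints" if "x \<in> conjugates" for x
    using that by (intro alg_ints_eval_int conjugate_alg_int)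
  have "\<exists>s z. s \<in> alg_ints \<and> s \<notin> P \<and> z \<in> alg_ints \<and> s * eval_int g x = of_nat p * z" if x: "x \<in> A" for x
  proof -
    define y where "y = eval_int g x"
    have "y \<in> frobenius_fixed p" unfolding y_def using x
      by (intro is_subring_eval_int[OF is_subring_frobenius_fixed[OF p]] conjugate_frobenius_fixed[OF \<theta> _ p]) (simp add: A_def)
    then obtain z where z: "z \<in> alg_ints" "y ^ p - y = of_nat p * z" and y: "y \<in> alg_ints"
      by (auto simp: frobenius_fixed_def ai_multiples_def)
    have yP: "y \<in> P" using x by (simp add: A_def y_def)
    obtain k where k: "p = Suc (Suc k)" using prime_ge_2_nat[OF p] nat_le_iff_add[of 2 p] by auto
    have "y ^ Suc k \<in> P" using P_mult[OF yP alg_ints_power[OF y, of k]] by simp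
    hence "y ^ Suc k - 1 \<notin> P" using P_diff[of "y ^ Suc k" "y ^ Suc k - 1"] P_1 by auto
    moreover have "(y ^ Suc k - 1) * y = of_nat p * z" using z(2) k by (simp add: algebra_simps)
    moreover have "y ^ Suc k - 1 \<in> alg_ints" by (intro alg_ints_diff alg_ints_power y alg_ints_1)
    ultimately show ?thesis using z(1) unfolding y_def by blast
  qed
  then obtain s z where sz: "\<And>x. x \<in> A \<Longrightarrow> s x \<in> alg_ints \<and> s x \<notin> P \<and> z x \<in> alg_ints \<and> s x * eval_int g x = of_nat p * z x"
    by metis
  have "prod s A \<notin> P" using P_prod[OF fin, of s] sz by auto
  moreover have "prod s A \<in> alg_ints" using sz by (intro alg_ints_prod) auto
  moreover have "of_int (nrm g) * prod s A \<in> ai_multiples (p ^ card A)"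
  proof (rule ai_multiplesI)
    show "prod z A * (\<Prod>x\<in>conjugates - A. eval_int g x) \<in> alg_ints"
      using sz ai by (intro alg_ints_mult alg_ints_prod) auto
    have "of_int (nrm g) = (\<Prod>x\<in>conjugates - A. eval_int g x) * (\<Prod>x\<in>A. eval_int g x)"
      unfolding nrm by (rule prod.subset_diff) (auto simp: A_def)
    moreover have "prod s A * (\<Prod>x\<in>A. eval_int g x) = of_nat p ^ card A * prod z A"
      using sz by (simp flip: prod.distrib) (simp add: prod.distrib)
    ultimately show "of_int (nrm g) * prod s A =
        of_nat (p ^ card A) * (prod z A * (\<Prod>x\<in>conjugates - A. eval_int g x))"
      by (simp add: mult_ac)
  qed
  ultimately show ?thesis unfolding A_def[symmetric] by (intro prime_power_dvd) auto
qed

text \<open>The values at \<open>x\<close> have only \<open>p\<close> possible residues modulo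
  \<open>P\<close>, which forces collisions. The subtracted \<open>card U\<close> accounts for the
  diagonal pairs.\<close>

lemma frobenius_fixed_collisions:
  assumes p: "prime p" and \<theta>: "\<theta> \<in> frobenius_fixed p" and P: "prime_over p P"
    and U: "finite U" and x: "x \<in> conjugates"
  shows "real (card U) ^ 2 / p - card U \<le> card {(u, v) \<in> U \<times> U. u \<noteq> v \<and> eval_int (u - v) x \<in> P}"
proof -
  interpret prime_over_locale p P using p P by unfold_locales
  have "\<forall>u. \<exists>r<p. eval_int u x - of_nat r \<in> P"
  proof
    fix u
    have "eval_int u x \<in> frobenius_fixed p"
      by (rule is_subring_eval_int[OF is_subring_frobenius_fixed[OF p] conjugate_frobenius_fixed[OF \<theta> x p]])
    thus "\<exists>r<p. eval_int u x - of_nat r \<in> P" by (rule frobenius_fixed_residue) auto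
  qed
  then obtain c where c: "\<And>u. c u < p" "\<And>u. eval_int u x - of_nat (c u) \<in> P" by metis
  have sub: "{(u, v) \<in> U \<times> U. c u = c v} \<subseteq> (\<lambda>u. (u, u)) ` U \<union> {(u, v) \<in> U \<times> U. u \<noteq> v \<and> eval_int (u - v) x \<in> P}"
  proof
    fix e assume "e \<in> {(u, v) \<in> U \<times> U. c u = c v}"
    then obtain u v where e: "e = (u, v)" "u \<in> U" "v \<in> U" "c u = c v" by auto
    have "(eval_int u x - of_nat (c u)) - (eval_int v x - of_nat (c v)) \<in> P" by (intro P_diff c)
    hence "eval_int (u - v) x \<in> P" using e(4) by simp
    with e show "e \<in> (\<lambda>u. (u, u)) ` U \<union> {(u, v) \<in> U \<times> U. u \<noteq> v \<and> eval_int (u - v) x \<in> P}" by auto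
  qed
  have fin: "finite {(u, v) \<in> U \<times> U. u \<noteq> v \<and> eval_int (u - v) x \<in> P}"
    by (rule finite_subset[of _ "U \<times> U"]) (use U in auto)
  have "card {(u, v) \<in> U \<times> U. c u = c v} \<le>
      card ((\<lambda>u. (u, u)) ` U \<union> {(u, v) \<in> U \<times> U. u \<noteq> v \<and> eval_int (u - v) x \<in> P})"
    by (rule card_mono[OF _ sub]) (use U fin in auto)
  also have "\<dots> \<le> card ((\<lambda>u. (u, u)) ` U) + card {(u, v) \<in> U \<times> U. u \<noteq> v \<and> eval_int (u - v) x \<in> P}"
    by (rule card_Un_le)
  also have "card ((\<lambda>u. (u, u)) ` U) \<le> card U" using U by (rule card_image_le)
  finally have 1: "card {(u, v) \<in> U \<times> U. c u = c v} \<le>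
      card U + card {(u, v) \<in> U \<times> U. u \<noteq> v \<and> eval_int (u - v) x \<in> P}" by simp
  have "card U ^ 2 \<le> p * card {(u, v) \<in> U \<times> U. c u = c v}"
    by (rule card_collisions[OF U]) (use c in auto)
  hence "real (card U ^ 2) \<le> real (p * card {(u, v) \<in> U \<times> U. c u = c v})" by (simp only: of_nat_le_iff)
  hence "real (card U) ^ 2 / p \<le> card {(u, v) \<in> U \<times> U. c u = c v}"
    using prime_gt_0_nat[OF p] by (simp add: field_simps)
  also have "\<dots> \<le> real (card U + card {(u, v) \<in> U \<times> U. u \<noteq> v \<and> eval_int (u - v) x \<in> P})"
    using 1 by (simp only: of_nat_le_iff)
  finally show ?thesis by simp
qed

text \<open>The pairs of distinct elements of a box with about \<open>8X\<close> elements have norms at most a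
  constant times \<open>X\<close>, but at least a \<open>(7/8) / p\<close>-th part of them is divisible by any given one of
  the \<^term>\<open>deg\<close> primes above \<open>p\<close>.\<close>

lemma frobenius_fixed_upper:
  assumes S: "\<And>p. p \<in> S \<Longrightarrow> prime p" "\<And>p. p \<in> S \<Longrightarrow> \<theta> \<in> frobenius_fixed p"
  shows "\<exists>K. \<forall>X::nat. X \<ge> 1 \<longrightarrow> 7 / 8 * real deg * (\<Sum>p | p \<in> S \<and> p \<le> X. ln p / p) \<le> ln X + K"
proof -
  obtain W :: real where W: "W \<ge> 1"
    "\<And>N g. g \<in> polys_in deg {-int N..int N} \<Longrightarrow> \<bar>real_of_int (nrm g)\<bar> \<le> (W * real N) ^ deg"
    using nrm_upper by blast
  have "7 / 8 * real deg * (\<Sum>p | p \<in> S \<and> p \<le> X. ln p / p) \<le> ln X + (real deg * ln W + ln 8)"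
    if X: "X \<ge> 1" for X :: nat
  proof -
    define T where "T = {p. p \<in> S \<and> p \<le> X}"
    have T: "finite T" "\<And>p. p \<in> T \<Longrightarrow> prime p" "\<And>p. p \<in> T \<Longrightarrow> \<theta> \<in> frobenius_fixed p" "\<And>p. p \<in> T \<Longrightarrow> p \<le> X"
      using S by (auto simp: T_def)
    have ex: "\<exists>N. 8 * X \<le> (N + 1) ^ deg"
    proof
      show "8 * X \<le> (8 * X + 1) ^ deg" using self_le_power[of "8 * X + 1" deg] deg_pos by simp
    qed
    \<comment> \<open>The box then has \<open>M \<ge> 8 * X\<close> elements, whereas minimality
      gives \<open>N^deg < 8 * X\<close> and keeps the norms linear in \<open>X\<close>.\<close>
    define N where "N = (LEAST N. 8 * X \<le> (N + 1) ^ deg)"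
    have N: "8 * X \<le> (N + 1) ^ deg" unfolding N_def using ex by (rule LeastI_ex)
    have "N \<noteq> 0" using N X by (intro notI) simp
    hence N': "N ^ deg < 8 * X"
      using not_less_Least[of "N - 1" "\<lambda>N. 8 * X \<le> (N + 1) ^ deg"] by (simp add: N_def)
    define U where "U = polys_in deg {0..int N}"
    define M where "M = (N + 1) ^ deg"
    have U: "finite U" "card U = M" by (simp_all add: U_def M_def finite_polys_in card_polys_in nat_add_distrib)
    have M0: "M > 0" by (simp add: M_def)
    define E where "E = {(u, v) \<in> U \<times> U. u \<noteq> v}"
    have E: "finite E" "card E \<le> M ^ 2"
    proof -
      show "finite E" by (rule finite_subset[of _ "U \<times> U"]) (use U in \<open>auto simp: E_def\<close>)
      have "card E \<le> card (U \<times> U)" by (rule card_mono) (use U in \<open>auto simp: E_def\<close>)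
      thus "card E \<le> M ^ 2" by (simp add: U card_cartesian_product power2_eq_square)
    qed
    have diff: "u - v \<in> polys_in deg {-int N..int N}" "u - v \<noteq> 0" if "(u, v) \<in> E" for u v
      using that by (fastforce simp: E_def U_def polys_in_def)+
    have "\<forall>p\<in>T. \<exists>P :: 'a set. prime_over p P" using T(2) prime_over_exists by metis
    then obtain P :: "nat \<Rightarrow> 'a set" where P: "\<And>p. p \<in> T \<Longrightarrow> prime_over p (P p)" by metis
    \<comment> \<open>A lower bound for the exponent of \<open>p\<close> in the norm of
      \<open>g\<close>.\<close>
    define w where "w = (\<lambda>p g. card {x \<in> conjugates. eval_int g x \<in> P p})"
    have up: "(\<Sum>p\<in>T. real (w p (u - v)) * ln p) \<le> ln X + (real deg * ln W + ln 8)" if uv: "(u, v) \<in> E" for u v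
    proof -
      have nz: "nrm (u - v) \<noteq> 0" using diff[OF uv] nrm_nonzero by blast
      have "(\<Sum>p\<in>T. real (w p (u - v)) * ln p) \<le> ln \<bar>real_of_int (nrm (u - v))\<bar>"
      proof (rule sum_ln_primes_le[OF T(1,2) nz])
        fix p assume "p \<in> T"
        thus "int p ^ w p (u - v) dvd nrm (u - v)"
          unfolding w_def by (intro prime_power_dvd_nrm T P)
      qed
      also have "\<dots> \<le> ln ((W * real N) ^ deg)"
        using W(2)[OF diff(1)[OF uv]] nz by (intro ln_mono) auto
      also have "\<dots> = real deg * ln W + ln (real N ^ deg)"
        using W(1) \<open>N \<noteq> 0\<close> by (simp add: ln_realpow ln_mult algebra_simps)
      also have "ln (real N ^ deg) \<le> ln (8 * real X)"
      proof (rule ln_mono)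
        have "real (N ^ deg) \<le> real (8 * X)" using N' by (simp only: of_nat_le_iff)
        thus "real N ^ deg \<le> 8 * real X" by simp
      qed (use \<open>N \<noteq> 0\<close> in auto)
      also have "ln (8 * real X) = ln 8 + ln X" using X by (simp add: ln_mult)
      finally show ?thesis by simp
    qed
    have low: "7 / 8 * real deg * (real M ^ 2 * (ln p / p)) \<le> (\<Sum>(u, v)\<in>E. real (w p (u - v)) * ln p)" if p: "p \<in> T" for p
    proof -
      have pp: "prime p" using T p by simp
      hence p1: "real p > 1" using prime_gt_1_nat by simp
      have "real deg * (7 / 8 * (real M ^ 2 / p)) \<le> (\<Sum>x\<in>conjugates. real (card {(u, v) \<in> U \<times> U. u \<noteq> v \<and> eval_int (u - v) x \<in> P p}))"
      proof -
        \<comment> \<open>Since \<open>M \<ge> 8 * p\<close>, the diagonal costs at most an eighth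
          of \<open>M^2 / p\<close>.\<close>
        have "7 / 8 * (real M ^ 2 / p) \<le> real M ^ 2 / p - M"
        proof -
          have "8 * p \<le> M" using T(4)[OF p] N by (simp add: M_def)
          hence "8 * real p \<le> real M" by linarith
          hence "real M * (8 * real p) \<le> real M * real M" by (intro mult_left_mono) auto
          thus ?thesis using p1 by (simp add: field_simps power2_eq_square)
        qed
        also have "\<dots> \<le> real (card {(u, v) \<in> U \<times> U. u \<noteq> v \<and> eval_int (u - v) x \<in> P p})" if "x \<in> conjugates" for x
          using frobenius_fixed_collisions[OF pp T(3)[OF p] P[OF p] U(1) that] U(2) by simp
        finally have "(\<Sum>x\<in>conjugates. 7 / 8 * (real M ^ 2 / p)) \<le>
            (\<Sum>x\<in>conjugates. real (card {(u, v) \<in> U \<times> U. u \<noteq> v \<and> eval_int (u - v) x \<in> P p}))"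
          by (intro sum_mono) simp
        thus ?thesis by (simp add: card_conjugates)
      qed
      also have "(\<Sum>x\<in>conjugates. real (card {(u, v) \<in> U \<times> U. u \<noteq> v \<and> eval_int (u - v) x \<in> P p})) =
          (\<Sum>x\<in>conjugates. \<Sum>(u, v)\<in>E. if eval_int (u - v) x \<in> P p then 1 else 0)"
      proof (rule sum.cong)
        fix x
        have "(\<Sum>(u, v)\<in>E. if eval_int (u - v) x \<in> P p then 1 else 0 :: real) =
            (\<Sum>e\<in>{e \<in> E. eval_int (fst e - snd e) x \<in> P p}. 1)"
          using E(1) by (simp add: sum.If_cases case_prod_unfold Int_def)
        also have "{e \<in> E. eval_int (fst e - snd e) x \<in> P p} = {(u, v) \<in> U \<times> U. u \<noteq> v \<and> eval_int (u - v) x \<in> P p}"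
          by (auto simp: E_def)
        finally show "real (card {(u, v) \<in> U \<times> U. u \<noteq> v \<and> eval_int (u - v) x \<in> P p}) =
          (\<Sum>(u, v)\<in>E. if eval_int (u - v) x \<in> P p then 1 else 0)" by simp
      qed simp
      also have "\<dots> = (\<Sum>(u, v)\<in>E. \<Sum>x\<in>conjugates. if eval_int (u - v) x \<in> P p then 1 else 0)"
        unfolding case_prod_unfold by (rule sum.swap)
      also have "\<dots> = (\<Sum>(u, v)\<in>E. real (w p (u - v)))"
        by (intro sum.cong) (auto simp: w_def sum.If_cases Int_def)
      finally have "real deg * (7 / 8 * (real M ^ 2 / p)) * ln p \<le> (\<Sum>(u, v)\<in>E. real (w p (u - v))) * ln p"
        using p1 by (intro mult_right_mono) auto
      thus ?thesis by (simp add: sum_distrib_left sum_distrib_right case_prod_unfold mult_ac)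
    qed
    \<comment> \<open>Double counting over primes and pairs: \<open>low\<close> bounds the total
      from below prime by prime, \<open>up\<close> from above pair by pair.\<close>
    have "real M ^ 2 * (7 / 8 * real deg * (\<Sum>p\<in>T. ln p / p)) = (\<Sum>p\<in>T. 7 / 8 * real deg * (real M ^ 2 * (ln p / p)))"
      by (simp add: sum_distrib_left mult_ac)
    also have "\<dots> \<le> (\<Sum>p\<in>T. \<Sum>(u, v)\<in>E. real (w p (u - v)) * ln p)" by (intro sum_mono low)
    also have "\<dots> = (\<Sum>(u, v)\<in>E. \<Sum>p\<in>T. real (w p (u - v)) * ln p)"
      unfolding case_prod_unfold by (rule sum.swap)
    also have "\<dots> \<le> (\<Sum>(u, v)\<in>E. ln X + (real deg * ln W + ln 8))" using up by (intro sum_mono) auto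
    also have "\<dots> = real (card E) * (ln X + (real deg * ln W + ln 8))" by (simp add: case_prod_unfold)
    also have "\<dots> \<le> real (M ^ 2) * (ln X + (real deg * ln W + ln 8))"
    proof (intro mult_right_mono)
      show "real (card E) \<le> real (M ^ 2)" using E(2) by (simp only: of_nat_le_iff)
      show "0 \<le> ln X + (real deg * ln W + ln 8)" using X W(1) by (intro add_nonneg_nonneg mult_nonneg_nonneg) auto
    qed
    finally have "real M ^ 2 * (7 / 8 * real deg * (\<Sum>p\<in>T. ln p / p)) \<le> real M ^ 2 * (ln X + (real deg * ln W + ln 8))"
      by simp
    thus ?thesis using M0 unfolding T_def by (simp add: mult_le_cancel_left_pos)
  qed
  thus ?thesis by blast
qed

section \<open>Counting points of ideals in boxes\<close>

text \<open>Ideals of \<open>\<int>[\<theta>]\<close> are represented by their preimages in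
  \<open>\<int>[X]\<close>, which are the ideals containing \<open>F\<close>.\<close>

definition poly_ideal :: "int poly set \<Rightarrow> bool" where
  "poly_ideal I \<longleftrightarrow> F \<in> I \<and> (\<forall>f\<in>I. \<forall>g\<in>I. f + g \<in> I) \<and> (\<forall>f\<in>I. \<forall>g. f * g \<in> I)"

lemma poly_ideal_closed:
  assumes "poly_ideal I"
  shows "0 \<in> I" "f \<in> I \<Longrightarrow> g \<in> I \<Longrightarrow> f + g \<in> I" "f \<in> I \<Longrightarrow> g \<in> I \<Longrightarrow> f - g \<in> I" "f \<in> I \<Longrightarrow> f * h \<in> I" "F \<in> I"
proof -
  show 1: "f \<in> I \<Longrightarrow> f * h \<in> I" "F \<in> I" "f \<in> I \<Longrightarrow> g \<in> I \<Longrightarrow> f + g \<in> I" for f g h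
    using assms by (auto simp: poly_ideal_def)
  show "0 \<in> I" using 1(1)[OF 1(2), of 0] by simp
  show "f - g \<in> I" if "f \<in> I" "g \<in> I" using 1(3)[OF that(1) 1(1)[OF that(2), of "-1"]] by simp
qed

text \<open>One fixed choice, so that the later constants can refer to it before any ideal or box is
  chosen.\<close>

definition representative_constant :: nat where
  "representative_constant = (SOME C. \<forall>N. \<forall>b\<in>polys_in deg {-int N..int N}. b \<noteq> 0 \<longrightarrow>
     (\<forall>y. \<exists>y'\<in>polys_in deg {-int (C * N)..int (C * N)}. \<exists>u v. y = y' + b * u + F * v))"

lemma representative_constant:
  assumes "b \<in> polys_in deg {-int N..int N}" "b \<noteq> 0"
  obtains y' u v where "y' \<in> polys_in deg {-int (representative_constant * N)..int (representative_constant * N)}"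
    "y = y' + b * u + F * v"
  using someI_ex[OF small_representatives, folded representative_constant_def] assms by meson

text \<open>Replace each \<open>y\<close> by a small representative modulo \<open>b\<close>, hence
  modulo \<open>I\<close>. The sums of a point of \<open>X\<close>, which lies in one class of
  \<open>I\<close>, and such a representative are pairwise distinct, and all lie in one slightly
  larger box. \<open>Y\<close> witnesses a lower bound for the index of \<open>I\<close>.\<close>

lemma ideal_count:
  assumes I: "poly_ideal I" and b: "b \<in> I" "b \<noteq> 0" "b \<in> polys_in deg {-int N'..int N'}"
    and X: "X \<subseteq> polys_in deg {-int N..int N}" "\<And>x x'. x \<in> X \<Longrightarrow> x' \<in> X \<Longrightarrow> x - x' \<in> I"
    and Y: "\<And>y y'. y \<in> Y \<Longrightarrow> y' \<in> Y \<Longrightarrow> y - y' \<in> I \<Longrightarrow> y = y'"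
  shows "card X * card Y \<le> (2 * (N + representative_constant * N') + 1) ^ deg"
proof -
  define L where "L = N + representative_constant * N'"
  have "\<forall>y. \<exists>y'\<in>polys_in deg {-int (representative_constant * N')..int (representative_constant * N')}. y - y' \<in> I"
  proof
    fix y
    obtain y' u v where y': "y' \<in> polys_in deg {-int (representative_constant * N')..int (representative_constant * N')}"
      "y = y' + b * u + F * v" using representative_constant[OF b(3,2)] .
    have "y - y' = b * u + F * v" using y'(2) by simp
    also have "\<dots> \<in> I" using I b(1) by (intro poly_ideal_closed)
    finally show "\<exists>y'\<in>polys_in deg {-int (representative_constant * N')..int (representative_constant * N')}. y - y' \<in> I"
      using y'(1) by blast
  qed
  then obtain \<rho> where \<rho>: "\<And>y. \<rho> y \<in> polys_in deg {-int (representative_constant * N')..int (representative_constant * N')}"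
    "\<And>y. y - \<rho> y \<in> I" by metis
  have inj: "inj_on (\<lambda>(x, y). x + \<rho> y) (X \<times> Y)"
  proof (rule inj_onI, clarify)
    fix x y x2 y2 assume xy: "x \<in> X" "y \<in> Y" "x2 \<in> X" "y2 \<in> Y" "x + \<rho> y = x2 + \<rho> y2"
    have "y - y2 = (y - \<rho> y) - (y2 - \<rho> y2) + (x2 - x)" using xy(5) by (simp add: algebra_simps)
    also have "\<dots> \<in> I" using xy by (intro poly_ideal_closed(2,3)[OF I] \<rho> X)
    finally have "y = y2" using Y xy by blast
    thus "x = x2 \<and> y = y2" using xy by simp
  qed
  have "card X * card Y = card (X \<times> Y)" by (rule card_cartesian_product[symmetric])
  also have "\<dots> = card ((\<lambda>(x, y). x + \<rho> y) ` (X \<times> Y))" by (rule card_image[OF inj, symmetric])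
  also have "\<dots> \<le> card (polys_in deg {-int L..int L})"
  proof (rule card_mono)
    show "finite (polys_in deg {-int L..int L})" by (simp add: finite_polys_in)
    show "(\<lambda>(x, y). x + \<rho> y) ` (X \<times> Y) \<subseteq> polys_in deg {-int L..int L}"
    proof (rule image_subsetI, unfold split_paired_all case_prod_conv, elim SigmaE2)
      fix x y assume "x \<in> X"
      thus "x + \<rho> y \<in> polys_in deg {-int L..int L}"
        unfolding L_def using X(1) by (intro polys_in_add \<rho>(1)) auto
    qed
  qed
  also have "\<dots> = (2 * L + 1) ^ deg" by (simp add: card_polys_in nat_add_distrib nat_mult_distrib)
  finally show ?thesis by (simp add: L_def)
qed

end

text \<open>The lowest nonzero coefficient of an integer polynomial vanishing at \<open>x\<close> is
  a multiple of \<open>x\<close>.\<close>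

lemma alg_int_dvd_int:
  fixes x :: "'a::field_char_0"
  assumes x: "x \<in> alg_ints" "x \<noteq> 0"
  obtains m :: int and z where "m \<noteq> 0" "z \<in> alg_ints" "of_int m = x * z"
proof -
  from x(1) obtain p where p: "lead_coeff p = 1" "eval_int p x = 0" by (auto simp: alg_ints_iff_int_poly)
  have "\<exists>m z. m \<noteq> 0 \<and> z \<in> alg_ints \<and> of_int m = x * z" if "p \<noteq> 0" "eval_int p x = 0" for p
    using that
  proof (induction p)
    case (pCons a p)
    show ?case
    proof (cases "a = 0")
      case True
      with pCons.prems x(2) have "p \<noteq> 0" "eval_int p x = 0" by auto
      thus ?thesis by (rule pCons.IH)
    next
      case False
      have "of_int a = x * (- eval_int p x)" using pCons.prems(2) by (simp add: eq_neg_iff_add_eq_0)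
      thus ?thesis using False alg_ints_uminus[OF alg_ints_eval_int[OF x(1)]] by blast
    qed
  qed simp
  moreover have "p \<noteq> 0" using p by auto
  ultimately show ?thesis using p that by blast
qed

section \<open>Residues of the conjugates and the ideals above p\<close>

context galois_element
begin

definition separates :: "'a set \<Rightarrow> bool" where
  "separates P \<longleftrightarrow> (\<forall>x\<in>conjugates. \<forall>y\<in>conjugates. x - y \<in> P \<longrightarrow> x = y)"

text \<open>The product of all differences of distinct conjugates, a discriminant up to sign,
  divides a nonzero integer. Primes exceeding that integer cannot identify two conjugates.\<close>

lemma separates_large_primes:
  "\<exists>b. \<forall>p P. prime p \<longrightarrow> b < p \<longrightarrow> prime_over p P \<longrightarrow> separates P"
proof -
  define E where "E = {e \<in> conjugates \<times> conjugates. fst e \<noteq> snd e}"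
  define \<delta> where "\<delta> = (\<Prod>e\<in>E. fst e - snd e)"
  have fin: "finite E" unfolding E_def by (rule finite_subset[of _ "conjugates \<times> conjugates"]) auto
  have E_ai: "fst e - snd e \<in> alg_ints" if "e \<in> E" for e
    using that conjugate_alg_int by (auto simp: E_def intro!: alg_ints_diff)
  have "\<delta> \<in> alg_ints" unfolding \<delta>_def by (rule alg_ints_prod[OF E_ai])
  moreover have "\<delta> \<noteq> 0" using fin by (auto simp: \<delta>_def E_def)
  ultimately obtain m z where m: "m \<noteq> 0" "z \<in> alg_ints" "of_int m = \<delta> * z" by (rule alg_int_dvd_int)
  have "separates P" if pP: "prime p" "nat \<bar>m\<bar> < p" "prime_over p P" for p P
    unfolding separates_def
  proof (intro ballI impI, rule ccontr)
    fix x y assume xy: "x \<in> conjugates" "y \<in> conjugates" "x - y \<in> P" "x \<noteq> y"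
    interpret prime_over_locale p P using pP by unfold_locales
    have e: "(x, y) \<in> E" using xy by (simp add: E_def)
    have "\<delta> = (x - y) * (\<Prod>e\<in>E - {(x, y)}. fst e - snd e)"
      unfolding \<delta>_def by (subst prod.remove[OF fin e]) simp
    also have "\<dots> \<in> P" using xy by (intro P_mult alg_ints_prod E_ai) auto
    finally have "of_int m \<in> P" unfolding m(3) by (rule P_mult[OF _ m(2)])
    hence "int p dvd m" by (simp add: P_of_int_iff)
    thus False using m(1) pP(2) dvd_imp_le_int[of m "int p"] by simp
  qed
  thus ?thesis by blast
qed

text \<open>One conjugate with residue in the prime field suffices for all: every other conjugate is
  \<open>G(y) / e\<close> for an integer polynomial \<open>G\<close> and a denominator
  \<open>e\<close> invertible modulo \<open>p\<close>.\<close>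

lemma integer_residues_large_primes:
  "\<exists>b. \<forall>p P y r. prime p \<longrightarrow> b < p \<longrightarrow> prime_over p P \<longrightarrow> y \<in> conjugates \<longrightarrow> y - of_int r \<in> P \<longrightarrow>
    (\<forall>x\<in>conjugates. \<exists>k::nat. k < p \<and> x - of_nat k \<in> P)"
proof -
  have "finite (conj_poly ` conjugates)" by simp
  then obtain e :: nat and H where e: "e > 0"
    "\<forall>h\<in>conj_poly ` conjugates. smult (of_nat e) h = map_poly of_int (H h)"
    by (rule rat_poly_common_denominator)
  have "\<exists>k::nat. k < p \<and> x - of_nat k \<in> P"
    if pP: "prime p" "e < p" "prime_over p P" and y: "y \<in> conjugates" "y - of_int r \<in> P" and x: "x \<in> conjugates"
    for p P y r x
  proof -
    interpret prime_over_locale p P using pP by unfold_locales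
    obtain x' where x': "x' \<in> conjugates" "eval_rat (conj_poly x') y = x"
      using bij_betw_imp_surj_on[OF conj_poly_bij[OF y(1)]] x by (metis (no_types, lifting) imageE)
    define G where "G = H (conj_poly x')"
    define c where "c = poly G r"
    have "of_nat e * x = eval_rat (smult (of_nat e) (conj_poly x')) y" by (simp add: x')
    also have "smult (of_nat e) (conj_poly x') = map_poly of_int G" using e(2) x'(1) by (simp add: G_def)
    finally have ex: "of_nat e * x = eval_int G y" by (simp add: eval_rat_int)
    have "eval_int G y - eval_int G (of_int r) \<in> P"
      by (rule P_cong_eval_int) (use y conjugate_alg_int in auto)
    hence 1: "of_nat e * x - of_int c \<in> P" by (simp add: ex c_def)
    have "\<not> p dvd e" using e(1) pP(2) by (auto dest: dvd_imp_le)
    hence "coprime (int e) (int p)" using pP(1) by (metis coprime_commute coprime_int_iff prime_imp_coprime)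
    then obtain u v where uv: "u * int e + v * int p = 1" by (metis bezout_int coprime_imp_gcd_eq_1)
    \<comment> \<open>\<open>u\<close> inverts \<open>e\<close> modulo \<open>p\<close>, and
      \<open>e * x\<close> has residue \<open>c\<close>.\<close>
    define k where "k = nat ((u * c) mod int p)"
    have p0: "p > 0" using pP(1) by (simp add: prime_gt_0_nat)
    have k: "k < p" "int k = (u * c) mod int p" using p0 by (simp_all add: k_def nat_less_iff)
    have "int p dvd u * c - int k" unfolding k(2) by (rule dvd_minus_mod)
    hence 2: "of_int (u * c - int k) \<in> P" by (simp only: P_of_int_iff)
    have "int p dvd 1 - u * int e" using uv by (metis add_diff_cancel_left' dvd_triv_right)
    hence "of_int (1 - u * int e) \<in> P" by (simp only: P_of_int_iff)
    hence 3: "of_int (1 - u * int e) * x \<in> P" by (rule P_mult[OF _ conjugate_alg_int[OF x]])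
    have "x - of_nat k = of_int (1 - u * int e) * x + of_int u * (of_nat e * x - of_int c) + of_int (u * c - int k)"
      by (simp add: algebra_simps)
    also have "\<dots> \<in> P" by (intro P_add P_mult' 1 2 3) simp
    finally show ?thesis using k(1) by blast
  qed
  thus ?thesis by blast
qed

text \<open>For large \<open>p\<close> the conjugates have distinct integer residues
  \<open>k x\<close>, so \<open>F\<close> is congruent modulo \<open>p\<close> to the product of the
  \<open>X - k x\<close>. At \<theta> this product is therefore a multiple of \<open>p\<close>, and
  it divides the product of all \<open>\<theta> - r\<close>, which is congruent to
  \<open>\<theta>^p - \<theta>\<close>.\<close>

lemma frobenius_fixed_of_integer_residue:
  "\<exists>b. \<forall>p P y r. prime p \<longrightarrow> b < p \<longrightarrow> prime_over p P \<longrightarrow> y \<in> conjugates \<longrightarrow> y - of_int r \<in> P \<longrightarrow>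
    \<theta> \<in> frobenius_fixed p"
proof -
  obtain b1 where b1: "\<And>p P. prime p \<Longrightarrow> b1 < p \<Longrightarrow> prime_over p P \<Longrightarrow> separates P"
    using separates_large_primes by blast
  from integer_residues_large_primes obtain b2 where
    b2: "\<forall>p P y r. prime p \<longrightarrow> b2 < p \<longrightarrow> prime_over p P \<longrightarrow> y \<in> conjugates \<longrightarrow> y - of_int r \<in> P \<longrightarrow>
      (\<forall>x\<in>conjugates. \<exists>k::nat. k < p \<and> x - of_nat k \<in> P)" ..
  have "\<theta> \<in> frobenius_fixed p" if pP: "prime p" "max b1 b2 < p" "prime_over p P"
    and y: "y \<in> conjugates" "y - of_int r \<in> P" for p P y r
  proof -
    interpret prime_over_locale p P using pP by unfold_locales
    have sep: "separates P" using b1 pP by simp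
    have "\<forall>x\<in>conjugates. \<exists>k::nat. k < p \<and> x - of_nat k \<in> P"
      using b2[rule_format (no_asm), OF pP(1) _ pP(3) y] pP(2) by simp
    then obtain k where k: "\<And>x. x \<in> conjugates \<Longrightarrow> k x < p" "\<And>x. x \<in> conjugates \<Longrightarrow> x - of_nat (k x) \<in> P"
      by metis
    have inj: "inj_on k conjugates"
    proof (rule inj_onI)
      fix x x' assume xx: "x \<in> conjugates" "x' \<in> conjugates" "k x = k x'"
      have "(x - of_nat (k x)) - (x' - of_nat (k x')) \<in> P" using xx by (intro P_diff k)
      thus "x = x'" using xx sep by (simp add: separates_def)
    qed
    define G where "G = (\<Prod>x\<in>conjugates. [:- int (k x), 1:])"
    define R where "R = int ` k ` conjugates"
    have cR: "card R = deg" using inj by (simp add: R_def card_image card_conjugates inj_on_def)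
    have "lead_coeff G = 1" unfolding G_def lead_coeff_prod by simp
    moreover have dG: "degree G = deg" by (simp add: G_def degree_prod_eq_sum_degree card_conjugates)
    ultimately have "coeff (F - G) deg = 0" using monic_F by (simp add: deg_def)
    moreover have "degree (F - G) \<le> deg" using dG by (intro degree_diff_le) (auto simp: deg_def)
    ultimately have "F - G = 0 \<or> degree (F - G) < deg" using eq_zero_or_degree_less by blast
    hence dFG: "degree (F - G) < deg" using deg_pos by auto
    have "[:int p:] dvd F - G"
    proof (rule prime_dvd_poly_coeffs[where R = R])
      show "prime (int p)" using pP(1) by simp
      show "finite R" by (simp add: R_def)
      show "degree (F - G) < card R" using dFG cR by simp
      show "u = v" if uv: "u \<in> R" "v \<in> R" "int p dvd u - v" for u v
      proof -
        obtain x y where "x \<in> conjugates" "y \<in> conjugates" "u = int (k x)" "v = int (k y)"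
          using uv(1,2) by (auto simp: R_def)
        hence "\<bar>u - v\<bar> < int p" using k(1)[of x] k(1)[of y] by linarith
        hence "u - v = 0" using uv(3) dvd_imp_le_int[of "u - v" "int p"] by linarith
        thus ?thesis by simp
      qed
      fix u assume "u \<in> R"
      then obtain x where x: "x \<in> conjugates" "u = int (k x)" by (auto simp: R_def)
      have Gu: "poly G u = 0" using x by (auto simp: G_def poly_prod)
      have "of_int (poly F u) = eval_int F (of_int u :: 'a)" by simp
      hence "of_int (poly F u) = (\<Prod>y\<in>conjugates. of_int u - y)"
        unfolding F_factorization poly_prod by simp
      also have "\<dots> = (of_int u - x) * (\<Prod>y\<in>conjugates - {x}. of_int u - y)"
        by (subst prod.remove[OF _ x(1)]) auto
      also have "\<dots> \<in> P"
        using P_uminus[OF k(2)[OF x(1)]] x(2)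
        by (intro P_mult alg_ints_prod alg_ints_diff[OF alg_ints_of_int conjugate_alg_int]) auto
      finally have "int p dvd poly F u" by (simp only: P_of_int_iff)
      thus "int p dvd poly (F - G) u" using Gu by simp
    qed
    then obtain D where D: "F - G = [:int p:] * D" by blast
    have \<theta>: "\<theta> \<in> alg_ints" by (rule conjugate_alg_int) simp
    have "G = F - (F - G)" by simp
    hence "eval_int G \<theta> = eval_int (F - [:int p:] * D) \<theta>" by (simp only: D)
    also have "\<dots> = of_nat p * (- eval_int D \<theta>)" by (simp add: root_F)
    finally have "eval_int G \<theta> \<in> ai_multiples p"
      by (rule ai_multiplesI[rotated]) (intro alg_ints_uminus alg_ints_eval_int \<theta>)
    also have "eval_int G \<theta> = (\<Prod>x\<in>conjugates. \<theta> - of_nat (k x))"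
      by (simp add: G_def of_int_poly_hom.hom_prod poly_prod)
    also have "\<dots> = (\<Prod>r\<in>k ` conjugates. \<theta> - of_nat r)"
      by (simp add: prod.reindex[OF inj])
    finally have "(\<Prod>r\<in>k ` conjugates. \<theta> - of_nat r) * (\<Prod>r\<in>{..<p} - k ` conjugates. \<theta> - of_nat r) \<in> ai_multiples p"
      by (rule ai_multiples_mult) (intro alg_ints_prod alg_ints_diff \<theta> alg_ints_of_nat)
    also have "(\<Prod>r\<in>k ` conjugates. \<theta> - of_nat r) * (\<Prod>r\<in>{..<p} - k ` conjugates. \<theta> - of_nat r) =
        (\<Prod>r<p. \<theta> - of_nat r)"
      using k(1) by (subst mult.commute, intro prod.subset_diff[symmetric]) auto
    finally have "(\<theta> ^ p - \<theta> - (\<Prod>r<p. \<theta> - of_nat r)) + (\<Prod>r<p. \<theta> - of_nat r) \<in> ai_multiples p"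
      by (intro ai_multiples_add frobenius_factorization pP(1) \<theta>)
    thus ?thesis using \<theta> by (simp add: frobenius_fixed_def)
  qed
  thus ?thesis by blast
qed

text \<open>For fixed \<open>P\<close> and varying conjugate \<open>x\<close>, these represent the
  prime ideals of \<open>\<int>[\<theta>]\<close> obtained by pulling \<open>P\<close> back along
  the automorphisms.\<close>

definition residue_ideal :: "'a set \<Rightarrow> 'a \<Rightarrow> int poly set" where
  "residue_ideal P x = {g. eval_int g x \<in> P}"

text \<open>The elements \<open>g\<close> for which \<open>g(x)\<close> is divisible by \<open>p\<^sup>2\<close> in the localization at \<open>P\<close>.\<close>

definition double_ideal :: "nat \<Rightarrow> 'a set \<Rightarrow> 'a \<Rightarrow> int poly set" where
  "double_ideal p P x = {g. \<exists>s\<in>alg_ints. s \<notin> P \<and> s * eval_int g x \<in> ai_multiples (p ^ 2)}"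

definition incongruent :: "int poly set \<Rightarrow> int poly set \<Rightarrow> bool" where
  "incongruent I Y \<longleftrightarrow> (\<forall>y\<in>Y. \<forall>y'\<in>Y. y - y' \<in> I \<longrightarrow> y = y')"

lemma poly_ideal_residue_ideal:
  assumes "prime p" "prime_over p P" "x \<in> conjugates"
  shows "poly_ideal (residue_ideal P x)"
proof -
  interpret prime_over_locale p P using assms by unfold_locales
  show ?thesis using assms(3)
    by (auto simp: poly_ideal_def residue_ideal_def conjugates_def P_0 P_add
        intro!: P_mult alg_ints_eval_int[OF conjugate_alg_int[OF assms(3)]])
qed

lemma poly_ideal_double_ideal:
  assumes "prime p" "prime_over p P" "x \<in> conjugates"
  shows "poly_ideal (double_ideal p P x)"
proof -
  interpret prime_over_locale p P using assms by unfold_locales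
  have ai: "eval_int g x \<in> alg_ints" for g by (intro alg_ints_eval_int conjugate_alg_int assms)
  show ?thesis
    unfolding poly_ideal_def
  proof (intro conjI ballI allI)
    show "F \<in> double_ideal p P x"
      using assms(3) P_1 by (auto simp: double_ideal_def conjugates_def intro!: bexI[of _ 1])
  next
    fix f g assume "f \<in> double_ideal p P x" "g \<in> double_ideal p P x"
    then obtain s t where st: "s \<in> alg_ints" "s \<notin> P" "s * eval_int f x \<in> ai_multiples (p ^ 2)"
      "t \<in> alg_ints" "t \<notin> P" "t * eval_int g x \<in> ai_multiples (p ^ 2)" by (auto simp: double_ideal_def)
    have "s * t * eval_int (f + g) x = (s * eval_int f x) * t + (t * eval_int g x) * s"
      by (simp add: algebra_simps)
    also have "\<dots> \<in> ai_multiples (p ^ 2)" by (intro ai_multiples_add ai_multiples_mult[OF st(3)] ai_multiples_mult[OF st(6)] st)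
    finally have "s * t * eval_int (f + g) x \<in> ai_multiples (p ^ 2)" .
    moreover have "s * t \<in> alg_ints" "s * t \<notin> P" using st P_prime by (auto intro: alg_ints_mult)
    ultimately show "f + g \<in> double_ideal p P x" unfolding double_ideal_def by blast
  next
    fix f g assume "f \<in> double_ideal p P x"
    then obtain s where s: "s \<in> alg_ints" "s \<notin> P" "s * eval_int f x \<in> ai_multiples (p ^ 2)"
      by (auto simp: double_ideal_def)
    have "s * eval_int f x * eval_int g x \<in> ai_multiples (p ^ 2)" by (intro ai_multiples_mult s ai)
    thus "f * g \<in> double_ideal p P x" unfolding double_ideal_def using s by (auto simp: mult.assoc)
  qed
qed

lemma poly_ideal_Int: "poly_ideal I \<Longrightarrow> poly_ideal J \<Longrightarrow> poly_ideal (I \<inter> J)"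
  by (auto simp: poly_ideal_def)

lemma dvd_small_int: "int n dvd int a - int b \<Longrightarrow> a < n \<Longrightarrow> b < n \<Longrightarrow> a = b"
  using dvd_imp_le_int[of "int a - int b" "int n"] by fastforce

text \<open>The \<open>p^2\<close> polynomials \<open>a + b X\<close> with reduced coefficients
  witness index at least \<open>p^2\<close> as soon as \<open>I\<close> contains no linear
  polynomials except those divisible by \<open>p\<close>.\<close>

lemma linear_polys_incongruent:
  assumes p: "prime p" and I: "\<And>a b :: int. [:a, b:] \<in> I \<Longrightarrow> int p dvd a \<and> int p dvd b"
  shows "\<exists>Y. card Y = p ^ 2 \<and> incongruent I Y"
proof (intro exI conjI)
  let ?f = "\<lambda>(a, b). [:int a, int b:]"
  have "inj_on ?f ({..<p} \<times> {..<p})" by (auto simp: inj_on_def)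
  thus "card (?f ` ({..<p} \<times> {..<p})) = p ^ 2"
    by (simp add: card_image card_cartesian_product power2_eq_square)
  show "incongruent I (?f ` ({..<p} \<times> {..<p}))"
    unfolding incongruent_def
  proof (intro ballI impI)
    fix y y' assume "y \<in> ?f ` ({..<p} \<times> {..<p})" "y' \<in> ?f ` ({..<p} \<times> {..<p})" and yy: "y - y' \<in> I"
    then obtain a b a' b' where ab: "a < p" "b < p" "a' < p" "b' < p" "y = [:int a, int b:]" "y' = [:int a', int b':]"
      by auto
    from yy have "[:int a - int a', int b - int b':] \<in> I" by (simp add: ab)
    from I[OF this] show "y = y'" using ab dvd_small_int by blast
  qed
qed

text \<open>Ideals of index at least \<open>p\<^sup>2\<close> that contain every element whose norm is divisible by
  \<open>p\<close> for a reason other than a simple prime factor of degree one. The ideals contain the rare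
  elements discarded in the lower bound.\<close>

definition bad_family :: "nat \<Rightarrow> int poly set set \<Rightarrow> bool" where
  "bad_family p \<I> \<longleftrightarrow> finite \<I> \<and> card \<I> \<le> 3 * deg ^ 2 \<and>
    (\<forall>I\<in>\<I>. poly_ideal I \<and> of_nat (p ^ 2) \<in> I \<and> (\<exists>Y. card Y = p ^ 2 \<and> incongruent I Y)) \<and>
    (\<forall>g. int p dvd nrm g \<and> \<theta> \<notin> frobenius_fixed p \<or> int p ^ 2 dvd nrm g \<longrightarrow> (\<exists>I\<in>\<I>. g \<in> I))"

lemma bad_family_exists:
  assumes p: "prime p" and P: "prime_over p P" and sep: "separates P"
    and res: "\<And>y r. y \<in> conjugates \<Longrightarrow> y - of_int r \<in> P \<Longrightarrow> \<theta> \<in> frobenius_fixed p"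
  shows "\<exists>\<I>. bad_family p \<I>"
proof -
  interpret prime_over_locale p P using p P by unfold_locales
  define E where "E = {e \<in> conjugates \<times> conjugates. fst e \<noteq> snd e}"
  \<comment> \<open>The three reasons for a bad norm: the residue field exceeds the prime field
    (\<open>\<I>1\<close>), two different conjugate values lie in \<open>P\<close>
    (\<open>\<I>2\<close>), or a single value is divisible by \<open>p^2\<close> at \<open>P\<close>
    (\<open>\<I>3\<close>).\<close>
  define \<I>1 where "\<I>1 = (if \<theta> \<in> frobenius_fixed p then {} else residue_ideal P ` conjugates)"
  define \<I>2 where "\<I>2 = (\<lambda>e. residue_ideal P (fst e) \<inter> residue_ideal P (snd e)) ` E"
  define \<I>3 where "\<I>3 = double_ideal p P ` conjugates"
  have ai: "eval_int g x \<in> alg_ints" if "x \<in> conjugates" for g x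
    using that by (intro alg_ints_eval_int conjugate_alg_int)
  have finE: "finite E" unfolding E_def by (rule finite_subset[of _ "conjugates \<times> conjugates"]) auto
  have cE: "card E \<le> deg ^ 2"
  proof -
    have "card E \<le> card (conjugates \<times> conjugates)" by (rule card_mono) (auto simp: E_def)
    thus ?thesis by (simp add: card_cartesian_product card_conjugates power2_eq_square)
  qed
  have dd: "deg \<le> deg ^ 2" by (simp add: power2_nat_le_imp_le self_le_power deg_pos Suc_leI)
  have c1: "card \<I>1 \<le> deg" using card_image_le[of conjugates "residue_ideal P"]
    by (simp add: \<I>1_def card_conjugates)
  have c2: "card \<I>2 \<le> deg ^ 2" unfolding \<I>2_def using card_image_le[OF finE] cE by (rule order.trans)
  have c3: "card \<I>3 \<le> deg" unfolding \<I>3_def using card_image_le[of conjugates "double_ideal p P"]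
    by (simp add: card_conjugates)
  have "card (\<I>1 \<union> \<I>2 \<union> \<I>3) \<le> card \<I>1 + card \<I>2 + card \<I>3"
    using card_Un_le[of "\<I>1 \<union> \<I>2" \<I>3] card_Un_le[of \<I>1 \<I>2] by linarith
  with c1 c2 c3 dd have card: "card (\<I>1 \<union> \<I>2 \<union> \<I>3) \<le> 3 * deg ^ 2" by linarith
  have fin: "finite (\<I>1 \<union> \<I>2 \<union> \<I>3)" using finE by (simp add: \<I>1_def \<I>2_def \<I>3_def)
  have pp: "eval_int (of_nat (p ^ 2)) x = of_nat (p ^ 2)" for x :: 'a
    by (simp only: eval_int_simps)
  have pP: "of_nat (p ^ 2) \<in> P"
  proof -
    have "(of_int (int p ^ 2) :: 'a) \<in> P" unfolding P_of_int_iff by simp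
    thus ?thesis by simp
  qed
  have f1: "poly_ideal I \<and> of_nat (p ^ 2) \<in> I \<and> (\<exists>Y. card Y = p ^ 2 \<and> incongruent I Y)" if I: "I \<in> \<I>1 \<union> \<I>2 \<union> \<I>3" for I
  proof -
    consider y where "I = residue_ideal P y" "y \<in> conjugates" "\<theta> \<notin> frobenius_fixed p"
      | x y where "I = residue_ideal P x \<inter> residue_ideal P y" "x \<in> conjugates" "y \<in> conjugates" "x \<noteq> y"
      | y where "I = double_ideal p P y" "y \<in> conjugates"
      using I by (auto simp: \<I>1_def \<I>2_def \<I>3_def E_def split: if_splits)
    thus ?thesis
    proof cases
      case 1
      have "\<exists>Y. card Y = p ^ 2 \<and> incongruent I Y"
      proof (rule linear_polys_incongruent[OF p])
        fix a b assume "[:a, b:] \<in> I"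
        hence ab: "of_int a + y * of_int b \<in> P" by (simp add: 1 residue_ideal_def)
        \<comment> \<open>If \<open>b\<close> were invertible modulo \<open>p\<close>, then
          \<open>a + b y \<in> P\<close> could be solved for \<open>y\<close> and would give it an
          integer residue, contrary to \<open>res\<close>.\<close>
        have b: "int p dvd b"
        proof (rule ccontr)
          assume "\<not> int p dvd b"
          hence "coprime (int p) b" using p by (simp add: prime_imp_coprime)
          then obtain u v where uv: "u * int p + v * b = 1" by (metis bezout_int coprime_imp_gcd_eq_1)
          have "y - of_int (- (v * a)) = (of_int a + y * of_int b) * of_int v + of_int (u * int p) * y"
          proof -
            have "y = y * of_int (u * int p + v * b)" by (simp add: uv)
            thus ?thesis by (simp add: algebra_simps)
          qed
          also have "\<dots> \<in> P"
            by (intro P_add P_mult[OF ab alg_ints_of_int] P_mult[OF _ conjugate_alg_int[OF 1(2)]]) (simp add: P_of_int_iff del: of_int_mult)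
          finally show False using res 1 by blast
        qed
        hence "y * of_int b \<in> P" by (intro P_mult' conjugate_alg_int 1) (simp add: P_of_int_iff)
        from P_diff[OF ab this] have "of_int a \<in> P" by simp
        with b show "int p dvd a \<and> int p dvd b" by (simp add: P_of_int_iff)
      qed
      thus ?thesis using poly_ideal_residue_ideal[OF p P] 1 pP unfolding 1 residue_ideal_def mem_Collect_eq pp by blast
    next
      case 2
      have "\<exists>Y. card Y = p ^ 2 \<and> incongruent I Y"
      proof (rule linear_polys_incongruent[OF p])
        fix a b assume "[:a, b:] \<in> I"
        hence ab: "of_int a + x * of_int b \<in> P" "of_int a + y * of_int b \<in> P" by (simp_all add: 2 residue_ideal_def)
        have "(x - y) * of_int b \<in> P" using P_diff[OF ab] by (simp add: algebra_simps)
        moreover have "x - y \<notin> P" using sep 2 by (auto simp: separates_def)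
        ultimately have b: "of_int b \<in> P"
          using P_prime[of "x - y" "of_int b"] 2 by (auto intro: alg_ints_diff conjugate_alg_int)
        have "x * of_int b \<in> P" by (intro P_mult' conjugate_alg_int 2 b)
        from P_diff[OF ab(1) this] have "of_int a \<in> P" by simp
        with b show "int p dvd a \<and> int p dvd b" by (simp add: P_of_int_iff)
      qed
      moreover have "poly_ideal I" unfolding 2 by (intro poly_ideal_Int poly_ideal_residue_ideal[OF p P] 2)
      ultimately show ?thesis using pP unfolding 2 residue_ideal_def Int_iff mem_Collect_eq pp by blast
    next
      case 3
      have "(of_nat (p ^ 2) :: 'a) \<in> ai_multiples (p ^ 2)" by (rule ai_multiplesI[of 1]) auto
      hence "of_nat (p ^ 2) \<in> I" unfolding 3 double_ideal_def mem_Collect_eq pp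
        by (intro bexI[of _ 1]) (simp_all add: P_1)
      moreover have "poly_ideal I" unfolding 3 by (rule poly_ideal_double_ideal[OF p P 3(2)])
      moreover have "card ((\<lambda>a. [:int a:]) ` {..<p ^ 2}) = p ^ 2" by (simp add: card_image inj_on_def)
      moreover have "incongruent I ((\<lambda>a. [:int a:]) ` {..<p ^ 2})"
        unfolding incongruent_def
      proof (intro ballI impI)
        fix u v assume "u \<in> (\<lambda>a. [:int a:]) ` {..<p ^ 2}" "v \<in> (\<lambda>a. [:int a:]) ` {..<p ^ 2}" "u - v \<in> I"
        then obtain a b s where ab: "a < p ^ 2" "b < p ^ 2" "u = [:int a:]" "v = [:int b:]"
          and s: "s \<in> alg_ints" "s \<notin> P" "s * eval_int (u - v) y \<in> ai_multiples (p ^ 2)"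
          by (auto simp: 3 double_ideal_def)
        have "eval_int (u - v) y = of_int (int a - int b)" by (simp add: ab)
        hence "of_int (int a - int b) * s \<in> ai_multiples (p ^ 2)" using s(3) by (simp only: mult.commute)
        hence "int p ^ 2 dvd int a - int b" by (rule prime_power_dvd[OF s(1,2)])
        hence "int (p ^ 2) dvd int a - int b" by simp
        thus "u = v" using dvd_small_int ab by blast
      qed
      ultimately show ?thesis by blast
    qed
  qed
  have f2: "\<exists>I\<in>\<I>1 \<union> \<I>2 \<union> \<I>3. g \<in> I"
    if g: "int p dvd nrm g \<and> \<theta> \<notin> frobenius_fixed p \<or> int p ^ 2 dvd nrm g" for g
  proof -
    have "int p dvd nrm g" using g by (auto elim: dvd_trans[rotated])
    hence "of_int (nrm g) \<in> P" by (simp add: P_of_int_iff)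
    then obtain x where x: "x \<in> conjugates" "eval_int g x \<in> P"
      unfolding nrm using P_prod[of conjugates "eval_int g"] ai finite_conjugates by meson
    show ?thesis
    proof (cases "\<theta> \<in> frobenius_fixed p")
      case False
      hence "residue_ideal P x \<in> \<I>1" "g \<in> residue_ideal P x" using x by (auto simp: \<I>1_def residue_ideal_def)
      thus ?thesis by blast
    next
      case True
      hence p2: "int p ^ 2 dvd nrm g" using g by simp
      show ?thesis
      proof (cases "\<exists>y\<in>conjugates. y \<noteq> x \<and> eval_int g y \<in> P")
        case True
        then obtain y where y: "y \<in> conjugates" "y \<noteq> x" "eval_int g y \<in> P" by blast
        have "(x, y) \<in> E" using x y by (auto simp: E_def)
        hence "residue_ideal P x \<inter> residue_ideal P y \<in> \<I>2" unfolding \<I>2_def by force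
        moreover have "g \<in> residue_ideal P x \<inter> residue_ideal P y" using x y by (simp add: residue_ideal_def)
        ultimately show ?thesis by blast
      next
        case False
        \<comment> \<open>No other conjugate value lies in \<open>P\<close>, so this cofactor of the
          norm is the multiplier required by \<open>double_ideal\<close>.\<close>
        define s where "s = (\<Prod>y\<in>conjugates - {x}. eval_int g y)"
        have s: "s \<in> alg_ints" unfolding s_def using ai by (intro alg_ints_prod) auto
        have "s \<notin> P" unfolding s_def using P_prod[of "conjugates - {x}" "eval_int g"] False ai by auto
        moreover have "s * eval_int g x = of_int (nrm g)"
          unfolding nrm s_def by (subst prod.remove[OF _ x(1)]) auto
        moreover have "(of_int (nrm g) :: 'a) \<in> ai_multiples (p ^ 2)"
          using p2 by (simp add: ai_multiples_of_int_iff)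
        ultimately have "g \<in> double_ideal p P x" unfolding double_ideal_def using s by auto
        moreover have "double_ideal p P x \<in> \<I>3" using x by (simp add: \<I>3_def)
        ultimately show ?thesis by blast
      qed
    qed
  qed
  show ?thesis
    by (rule exI[of _ "\<I>1 \<union> \<I>2 \<union> \<I>3"], unfold bad_family_def, rule conjI[OF fin conjI[OF card conjI]])
      (intro ballI f1, assumption, intro allI impI f2, assumption)
qed

lemma nrm_dvd_residue_ideal:
  assumes "prime p" "prime_over p P" "int p dvd nrm g"
  obtains x where "x \<in> conjugates" "g \<in> residue_ideal P x"
proof -
  interpret prime_over_locale p P using assms by unfold_locales
  have "of_int (nrm g) \<in> P" using assms(3) by (simp add: P_of_int_iff)
  hence "(\<Prod>x\<in>conjugates. eval_int g x) \<in> P" unfolding nrm .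
  hence "\<exists>x\<in>conjugates. eval_int g x \<in> P"
    by (rule P_prod[of conjugates "eval_int g", rotated 2]) (simp_all add: alg_ints_eval_int conjugate_alg_int)
  with that show ?thesis by (auto simp: residue_ideal_def)
qed

text \<open>By the pigeonhole principle the ideal contains a nonzero element with coefficients of
  size about \<open>p^(1/deg)\<close>. With it, and with the constants below \<open>p\<close> as
  incongruent elements, \<open>ideal_count\<close> gives a sharp estimate.\<close>

lemma residue_ideal_count:
  assumes p: "prime p" and P: "prime_over p P" and \<theta>: "\<theta> \<in> frobenius_fixed p" and x: "x \<in> conjugates"
    and X: "X \<subseteq> polys_in deg {-int N..int N}" "\<And>u v. u \<in> X \<Longrightarrow> v \<in> X \<Longrightarrow> u - v \<in> residue_ideal P x"
  shows "\<exists>q. q ^ deg \<le> p \<and> card X * p \<le> (2 * (N + representative_constant * q) + 1) ^ deg"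
proof -
  interpret prime_over_locale p P using p P by unfold_locales
  have "\<forall>u. \<exists>r<p. eval_int u x - of_nat r \<in> P"
  proof
    fix u
    have "eval_int u x \<in> frobenius_fixed p"
      by (rule is_subring_eval_int[OF is_subring_frobenius_fixed[OF p] conjugate_frobenius_fixed[OF \<theta> x p]])
    thus "\<exists>r<p. eval_int u x - of_nat r \<in> P" by (rule frobenius_fixed_residue) auto
  qed
  then obtain c where c: "\<And>u. c u < p" "\<And>u. eval_int u x - of_nat (c u) \<in> P" by metis
  have "\<exists>q. p < (q + 1) ^ deg"
    using self_le_power[of "p + 1" deg] deg_pos by (intro exI[of _ p]) simp
  \<comment> \<open>The smallest box with more than \<open>p\<close> elements; minimality yields
    \<open>q^deg \<le> p\<close>.\<close>
  define q where "q = (LEAST q. p < (q + 1) ^ deg)"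
  have q: "p < (q + 1) ^ deg" unfolding q_def by (rule LeastI_ex) fact
  have p1: "p > 1" using p by (rule prime_gt_1_nat)
  hence "q \<noteq> 0" using q by (intro notI) simp
  hence q': "q ^ deg \<le> p"
    using not_less_Least[of "q - 1" "\<lambda>q. p < (q + 1) ^ deg"] by (simp add: q_def)
  define U where "U = polys_in deg {0..int q}"
  have "card (c ` U) \<le> card {..<p}" using c(1) by (intro card_mono) auto
  also have "\<dots> < card U" using q by (simp add: U_def card_polys_in nat_add_distrib)
  finally have "\<not> inj_on c U" using card_image[of c U] by linarith
  then obtain u v where uv: "u \<in> U" "v \<in> U" "u \<noteq> v" "c u = c v" by (auto simp: inj_on_def)
  define b where "b = u - v"
  have "(eval_int u x - of_nat (c u)) - (eval_int v x - of_nat (c v)) \<in> P" by (intro P_diff c)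
  hence b: "b \<in> residue_ideal P x" using uv by (simp add: b_def residue_ideal_def)
  have b': "b \<noteq> 0" "b \<in> polys_in deg {-int q..int q}"
    using uv by (fastforce simp: b_def U_def polys_in_def)+
  have "card X * card ((\<lambda>a. [:int a:]) ` {..<p}) \<le> (2 * (N + representative_constant * q) + 1) ^ deg"
  proof (rule ideal_count[OF poly_ideal_residue_ideal[OF p P x] b b' X])
    fix y y' assume "y \<in> (\<lambda>a. [:int a:]) ` {..<p}" "y' \<in> (\<lambda>a. [:int a:]) ` {..<p}" "y - y' \<in> residue_ideal P x"
    then obtain a a' where a: "a < p" "a' < p" "y = [:int a:]" "y' = [:int a':]"
      and m: "eval_int (y - y') x \<in> P" by (auto simp: residue_ideal_def)
    have "eval_int (y - y') x = of_int (int a - int a')" by (simp add: a)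
    hence "int p dvd int a - int a'" using m by (simp only: P_of_int_iff)
    thus "y = y'" using dvd_small_int a by blast
  qed
  hence "card X * p \<le> (2 * (N + representative_constant * q) + 1) ^ deg" by (simp add: card_image inj_on_def)
  with q' show ?thesis by blast
qed

end

section \<open>Elementary estimates over primes\<close>

text \<open>Chebyshev's argument: every prime in the interval divides the central binomial
  coefficient, which is at most \<open>4^n\<close>.\<close>

lemma sum_ln_primes_dyadic:
  assumes n: "n > 0"
  shows "(\<Sum>p | prime p \<and> n < p \<and> p \<le> 2 * n. ln (real p) / real p) \<le> 2 * ln 2"
proof -
  define T where "T = {p. prime p \<and> n < p \<and> p \<le> 2 * n}"
  have T: "finite T" "\<And>p. p \<in> T \<Longrightarrow> prime p" unfolding T_def by auto
  have dvd: "int p ^ 1 dvd int (2 * n choose n)" if p: "p \<in> T" for p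
  proof -
    have pp: "prime p" "n < p" "p \<le> 2 * n" using p by (auto simp: T_def)
    have "fact n * fact (2 * n - n) * (2 * n choose n) = (fact (2 * n) :: nat)"
      by (rule binomial_fact_lemma) simp
    hence "p dvd fact n * fact n * (2 * n choose n)" using pp by (simp add: prime_dvd_fact_iff mult_2)
    hence "p dvd (2 * n choose n)" using pp by (simp add: prime_dvd_mult_iff prime_dvd_fact_iff)
    thus ?thesis by simp
  qed
  have "(\<Sum>p\<in>T. real 1 * ln (real p)) \<le> ln \<bar>real_of_int (int (2 * n choose n))\<bar>"
    by (rule sum_ln_primes_le[OF T _ dvd]) auto
  also have "\<dots> \<le> ln (2 ^ (2 * n))"
  proof (rule ln_mono)
    have "real (2 * n choose n) \<le> real (2 ^ (2 * n))" by (simp only: of_nat_le_iff binomial_le_pow2)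
    thus "\<bar>real_of_int (int (2 * n choose n))\<bar> \<le> 2 ^ (2 * n)" by simp
  qed (simp add: zero_less_binomial)
  also have "\<dots> = real n * (2 * ln 2)" by (simp add: ln_realpow)
  finally have 1: "(\<Sum>p\<in>T. ln (real p)) \<le> real n * (2 * ln 2)" by simp
  have "(\<Sum>p\<in>T. ln (real p) / real p) \<le> (\<Sum>p\<in>T. ln (real p) / real n)"
    using n by (intro sum_mono divide_left_mono) (auto simp: T_def)
  also have "\<dots> = (\<Sum>p\<in>T. ln (real p)) / real n" by (simp add: sum_divide_distrib)
  also have "\<dots> \<le> 2 * ln 2" using 1 n by (simp add: field_simps)
  finally show ?thesis by (simp add: T_def)
qed

text \<open>Shows that enlarging the range of primes by a constant factor changes the sum only by a
  constant.\<close>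

lemma sum_ln_primes_dyadic_power:
  assumes n: "n > 0"
  shows "(\<Sum>p | prime p \<and> n < p \<and> p \<le> 2 ^ k * n. ln (real p) / real p) \<le> 2 * real k * ln 2"
proof (induction k)
  case (Suc k)
  let ?f = "\<lambda>p::nat. ln (real p) / real p"
  have fin: "finite {p. prime p \<and> a < p \<and> p \<le> b}" for a b :: nat by auto
  have "{p. prime p \<and> n < p \<and> p \<le> 2 ^ Suc k * n} \<subseteq>
      {p. prime p \<and> n < p \<and> p \<le> 2 ^ k * n} \<union> {p. prime p \<and> 2 ^ k * n < p \<and> p \<le> 2 * (2 ^ k * n)}" by auto
  hence "sum ?f {p. prime p \<and> n < p \<and> p \<le> 2 ^ Suc k * n} \<le>
      sum ?f ({p. prime p \<and> n < p \<and> p \<le> 2 ^ k * n} \<union> {p. prime p \<and> 2 ^ k * n < p \<and> p \<le> 2 * (2 ^ k * n)})"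
    by (intro sum_mono2) (auto dest: prime_gt_0_nat)
  also have "\<dots> = sum ?f {p. prime p \<and> n < p \<and> p \<le> 2 ^ k * n} + sum ?f {p. prime p \<and> 2 ^ k * n < p \<and> p \<le> 2 * (2 ^ k * n)}"
    by (intro sum.union_disjoint) auto
  also have "\<dots> \<le> 2 * real k * ln 2 + 2 * ln 2"
    using n by (intro add_mono Suc.IH sum_ln_primes_dyadic) auto
  finally show ?case by (simp add: algebra_simps)
next
  case 0
  have "{p. prime p \<and> n < p \<and> p \<le> 2 ^ 0 * n} = {}" by auto
  thus ?case by (simp only: sum.empty)
qed

text \<open>Comparison with the telescoping series of \<open>1 / (n * (n + 1))\<close>.\<close>

lemma sum_inverse_squares_le:
  assumes "finite R" "\<And>n. n \<in> R \<Longrightarrow> a < n" "a > 0"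
  shows "(\<Sum>n\<in>R. 1 / real n ^ 2) \<le> 1 / real a"
proof -
  have 1: "(\<Sum>n\<in>{a<..a + k}. 1 / real n ^ 2) \<le> 1 / real a - 1 / real (a + k)" for k
  proof (induction k)
    case (Suc k)
    have "{a<..a + Suc k} = insert (a + Suc k) {a<..a + k}" by auto
    hence "(\<Sum>n\<in>{a<..a + Suc k}. 1 / real n ^ 2) = 1 / real (a + Suc k) ^ 2 + (\<Sum>n\<in>{a<..a + k}. 1 / real n ^ 2)"
      by simp
    also have "\<dots> \<le> 1 / real (a + Suc k) ^ 2 + (1 / real a - 1 / real (a + k))" using Suc.IH by simp
    also have "1 / real (a + Suc k) ^ 2 \<le> 1 / (real (a + k) * real (a + Suc k))"
      unfolding power2_eq_square using assms(3) by (intro divide_left_mono mult_right_mono) auto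
    also have "\<dots> = 1 / real (a + k) - 1 / real (a + Suc k)" using assms(3) by (simp add: field_simps)
    finally show ?case by simp
  qed simp
  obtain b where b: "\<And>n. n \<in> R \<Longrightarrow> n \<le> b" using finite_nat_set_iff_bounded_le[of R] assms(1) by blast
  have "(\<Sum>n\<in>R. 1 / real n ^ 2) \<le> (\<Sum>n\<in>{a<..a + b}. 1 / real n ^ 2)"
    using assms(2) b by (intro sum_mono2) (fastforce intro: trans_le_add2)+
  also have "\<dots> \<le> 1 / real a" using 1[of b] by (rule order.trans) simp
  finally show ?thesis .
qed

lemma ln_squarefree_eq:
  fixes m :: nat
  assumes m: "m > 0" and sq: "\<And>p. prime p \<Longrightarrow> \<not> p ^ 2 dvd m"
  shows "ln (real m) = (\<Sum>p\<in>prime_factors m. ln (real p))"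
proof -
  have "multiplicity p m = 1" if p: "p \<in> prime_factors m" for p
  proof -
    have "prime p" "p dvd m" using p by (auto simp: in_prime_factors_iff)
    hence "multiplicity p m \<ge> 1" using m by (simp add: Suc_le_eq prime_multiplicity_gt_zero_iff)
    moreover have "\<not> 2 \<le> multiplicity p m" using sq[OF \<open>prime p\<close>] multiplicity_dvd' by blast
    ultimately show ?thesis by simp
  qed
  hence "m = (\<Prod>p\<in>prime_factors m. p)" using prime_factorization_nat[OF m] by simp
  hence "real m = real (\<Prod>p\<in>prime_factors m. p)" by (rule arg_cong)
  also have "\<dots> = (\<Prod>p\<in>prime_factors m. real p)" by (rule of_nat_prod)
  finally have "ln (real m) = ln (\<Prod>p\<in>prime_factors m. real p)" by simp
  also have "\<dots> = (\<Sum>p\<in>prime_factors m. ln (real p))"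
    by (intro ln_prod) (auto simp: in_prime_factors_iff prime_gt_0_nat)
  finally show ?thesis .
qed

lemma card_squares_le:
  assumes "\<And>n. n \<in> R \<Longrightarrow> n > 0 \<and> real n ^ 2 \<le> x" "x \<ge> 0"
  shows "finite R" "real (card R) \<le> sqrt x"
proof -
  have "n \<le> nat \<lfloor>sqrt x\<rfloor>" if "n \<in> R" for n
    using assms(1)[OF that] real_le_rsqrt[of "real n" x] by (simp add: le_nat_floor)
  hence sub: "R \<subseteq> {1..nat \<lfloor>sqrt x\<rfloor>}" using assms(1) by force
  thus "finite R" by (rule finite_subset) simp
  have "card R \<le> card {1..nat \<lfloor>sqrt x\<rfloor>}" using sub by (intro card_mono) auto
  thus "real (card R) \<le> sqrt x" using assms(2) by (simp add: le_nat_iff le_floor_iff)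
qed

section \<open>A lower bound for primes with trivial Frobenius\<close>

context galois_element
begin

text \<open>The elements \<open>1 + Q (H N + b)\<close> with \<open>b\<close> in a box have norms prime to all \<open>p \<le> p\<^sub>0\<close>, because
  \<open>Q = p\<^sub>0!\<close>, and all their conjugates have absolute value at least \<open>N\<close>, because of the shift
  \<open>H N\<close>. A bad ideal for \<open>p > p\<^sub>0\<close> meets the box in \<open>O(M / p\<^sup>2)\<close> points with a constant
  independent of \<open>p\<^sub>0\<close>, or in a single point, the latter only for \<open>p\<^sup>2 = O(M)\<close>; hence for
  large \<open>p\<^sub>0\<close> and \<open>N\<close> at most a quarter of the box is discarded.\<close>

lemma frobenius_fixed_lower:
  "\<exists>K n0. \<forall>n::nat. n \<ge> n0 \<longrightarrow>
     (\<Sum>p | prime p \<and> \<theta> \<in> frobenius_fixed p \<and> p \<le> n ^ deg. ln p / p) \<ge> 2 / 3 * ln n - K"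
proof -
  let ?C = representative_constant
  obtain W0 :: real where W0: "W0 \<ge> 1"
    "\<And>N g. g \<in> polys_in deg {-int N..int N} \<Longrightarrow> \<bar>real_of_int (nrm g)\<bar> \<le> (W0 * real N) ^ deg"
    using nrm_upper by blast
  define W where "W = nat \<lceil>W0\<rceil>"
  have W: "\<bar>nrm g\<bar> \<le> int ((W * N) ^ deg)" if "g \<in> polys_in deg {-int N..int N}" for N g
  proof -
    have "\<bar>real_of_int (nrm g)\<bar> \<le> (W0 * real N) ^ deg" by (rule W0(2)[OF that])
    also have "\<dots> \<le> (real W * real N) ^ deg"
      using W0(1) by (intro power_mono mult_right_mono) (auto simp: W_def of_nat_ceiling)
    finally have "real_of_int \<bar>nrm g\<bar> \<le> real_of_int (int ((W * N) ^ deg))" by simp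
    thus "\<bar>nrm g\<bar> \<le> int ((W * N) ^ deg)" by (simp only: of_int_le_iff)
  qed
  obtain H where H: "\<And>Q N b. Q \<ge> 1 \<Longrightarrow> N \<ge> 1 \<Longrightarrow> b \<in> polys_in deg {-int N..int N} \<Longrightarrow>
      \<bar>real_of_int (nrm (1 + of_nat Q * (of_nat (H * N) + b)))\<bar> \<ge> real N ^ deg"
    using nrm_lower by blast
  obtain b1 where b1: "\<And>p P. prime p \<Longrightarrow> b1 < p \<Longrightarrow> prime_over p P \<Longrightarrow> separates P"
    using separates_large_primes by blast
  obtain b2 where b2: "\<And>p P y r. prime p \<Longrightarrow> b2 < p \<Longrightarrow> prime_over p P \<Longrightarrow> y \<in> conjugates \<Longrightarrow>
      y - of_int r \<in> P \<Longrightarrow> \<theta> \<in> frobenius_fixed p"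
    using frobenius_fixed_of_integer_residue by blast
  \<comment> \<open>Arises from \<open>ideal_count\<close> when the small ideal element is a
    difference of two box points, of size \<open>2 * N\<close>. It is independent of
    \<open>Q\<close>, so \<open>p0\<close> may depend on it.\<close>
  define K1 where "K1 = (1 + 2 * ?C) ^ deg"
  \<comment> \<open>Beyond \<open>b1\<close> and \<open>b2\<close> bad families exist. The third
    summand makes \<open>3 * deg^2 * K1 * M\<close> times the sum of \<open>1 / p^2\<close> over
    \<open>p > p0\<close> at most \<open>M / 8\<close>.\<close>
  define p0 where "p0 = b1 + b2 + 24 * deg ^ 2 * K1 + 1"
  define Q where "Q = (fact p0 :: nat)"
  have Q: "Q \<ge> 1" by (simp add: Q_def)
  define L where "L = 1 + Q * (H + 1)"
  \<comment> \<open>Here the ideal element is a shifted point itself, of size \<open>L * N\<close>.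
    The constant depends on \<open>Q\<close>, so it serves only to bound the primes that occur, not
    the density of points.\<close>
  define K2 where "K2 = (1 + ?C * L) ^ deg"
  \<comment> \<open>The crude point count for primes up to the largest possible norm
    \<open>(W * L * N)^deg\<close>; it enters only a bounded part of the sum.\<close>
  define K3 where "K3 = (1 + ?C * W * L) ^ deg"
  \<comment> \<open>With \<open>N = h * n\<close> and \<open>p \<le> n^deg\<close>, the small ideal
    elements have size at most \<open>N / h\<close>. A large fixed \<open>h\<close> brings the
    relative error of the count down to 9/8.\<close>
  have "(\<lambda>h. (1 + real ?C * (1 / real (Suc h))) ^ deg) \<longlonglongrightarrow> (1 + real ?C * 0) ^ deg"
    by (intro tendsto_intros lim_1_over_n[THEN LIMSEQ_Suc])
  hence "eventually (\<lambda>h. (1 + real ?C * (1 / real (Suc h))) ^ deg < 9 / 8) sequentially"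
    by (rule order_tendstoD) simp
  then obtain h0 where h0: "(1 + real ?C * (1 / real (Suc h0))) ^ deg < 9 / 8"
    by (auto simp: eventually_sequentially)
  define h where "h = Suc h0"
  have h: "h \<ge> 1" "(1 + real ?C / real h) ^ deg \<le> 9 / 8" using h0 by (simp_all add: h_def)
  \<comment> \<open>All primes beyond \<open>n^deg\<close> that occur lie within \<open>k\<close>
    doublings of it.\<close>
  obtain k :: nat where k: "(W * L * h) ^ deg \<le> 2 ^ k"
    using less_exp[of "(W * L * h) ^ deg"] by (meson less_imp_le)
  \<comment> \<open>Ensures \<open>24 * deg^2 * sqrt (K2 * M) \<le> M\<close>, so that isolated
    points in bad ideals make up at most an eighth of the box.\<close>
  define n0 where "n0 = (24 * deg ^ 2) ^ 2 * K2 + 1"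

  have "(\<Sum>p | prime p \<and> \<theta> \<in> frobenius_fixed p \<and> p \<le> n ^ deg. ln p / p) \<ge>
      2 / 3 * ln n - 8 / 9 * real K3 * (2 * real k * ln 2)" if n: "n \<ge> n0" for n
  proof -
    define N where "N = h * n"
    have n1: "n \<ge> 1" using n by (simp add: n0_def)
    have N: "N \<ge> 1" "N \<ge> n" using n1 h(1) by (simp_all add: N_def)
    define box where "box = polys_in deg {-int N..int N}"
    define M where "M = (2 * N + 1) ^ deg"
    have box: "finite box" "card box = M"
      by (simp_all add: box_def M_def finite_polys_in card_polys_in nat_add_distrib nat_mult_distrib)
    have M1: "M \<ge> 1" by (simp add: M_def)
    have NM: "2 * N + 1 \<le> M" unfolding M_def using deg_pos by (intro self_le_power) auto
    define G where "G = (\<lambda>b :: int poly. 1 + of_nat Q * (of_nat (H * N) + b))"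
    have G_box: "G b \<in> polys_in deg {-int (L * N)..int (L * N)}" if b: "b \<in> box" for b
    proof (rule polys_inI_le)
      have c: "coeff (G b) i = (if i = 0 then 1 + int Q * int (H * N) else 0) + int Q * coeff b i" for i
      proof -
        have "G b = [:1 + int Q * int (H * N):] + smult (int Q) b"
          by (simp add: G_def of_nat_poly algebra_simps one_pCons)
        thus ?thesis by (simp add: coeff_pCons split: nat.split)
      qed
      fix i
      have "\<bar>coeff b i\<bar> \<le> int N" using b unfolding box_def by (rule polys_in_coeff_le)
      hence "int Q * \<bar>coeff b i\<bar> \<le> int Q * int N" by (intro mult_left_mono) auto
      moreover have "\<bar>coeff (G b) i\<bar> \<le> (1 + int Q * int (H * N)) + int Q * \<bar>coeff b i\<bar>"
        unfolding c by (auto simp: abs_mult intro!: order.trans[OF abs_triangle_ineq])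
      moreover have "1 \<le> int N" using N by simp
      ultimately show "\<bar>coeff (G b) i\<bar> \<le> int (L * N)" by (simp add: L_def algebra_simps)
      show "coeff (G b) i = 0" if "i \<ge> deg"
        using that b deg_pos unfolding c by (auto simp: box_def polys_in_def)
    qed
    have G_low: "real N ^ deg \<le> \<bar>real_of_int (nrm (G b))\<bar>" if "b \<in> box" for b
      unfolding G_def using H[OF Q N(1)] that by (simp add: box_def)
    have G_nrm: "nrm (G b) \<noteq> 0" if "b \<in> box" for b
    proof
      assume "nrm (G b) = 0"
      with G_low[OF that] have "real N ^ deg \<le> 0" by simp
      moreover have "real N ^ deg > 0" using N by simp
      ultimately show False by linarith
    qed
    have G_nz: "G b \<noteq> 0" if "b \<in> box" for b
    proof
      assume "G b = 0"
      hence "of_int (nrm (G b)) = (\<Prod>x\<in>conjugates. 0 :: 'a)" by (simp add: nrm)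
      hence "of_int (nrm (G b)) = (0 :: 'a)" using card_conjugates deg_pos by (simp add: zero_power)
      hence "nrm (G b) = 0" by (simp only: of_int_eq_0_iff)
      with G_nrm[OF that] show False by simp
    qed
    \<comment> \<open>Since \<open>p\<close> divides \<open>Q\<close>, all conjugate values of
      \<open>G b\<close> are congruent to 1.\<close>
    have small: "\<not> int p dvd nrm (G b)" if pp: "prime p" "p \<le> p0" for p b
    proof
      assume dvd: "int p dvd nrm (G b)"
      obtain P :: "'a set" where P: "prime_over p P" using prime_over_exists[OF pp(1)] .
      interpret prime_over_locale p P using pp P by unfold_locales
      obtain x where x: "x \<in> conjugates" "G b \<in> residue_ideal P x"
        using nrm_dvd_residue_ideal[OF pp(1) P dvd] .
      have "p dvd Q" using pp unfolding Q_def by (simp add: prime_dvd_fact_iff)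
      hence "(of_int (int Q) :: 'a) \<in> P" by (simp only: P_of_int_iff int_dvd_int_iff)
      hence "of_int (int Q) * eval_int (of_nat (H * N) + b) x \<in> P"
        by (rule P_mult) (intro alg_ints_eval_int conjugate_alg_int x)
      moreover have "1 + of_int (int Q) * eval_int (of_nat (H * N) + b) x \<in> P"
        using x(2) by (simp add: residue_ideal_def G_def)
      ultimately show False using P_diff[of "1 + of_int (int Q) * eval_int (of_nat (H * N) + b) x"] P_1 by fastforce
    qed
    \<comment> \<open>\<open>G u - G v = Q * (u - v)\<close>, and \<open>Q\<close> is invertible
      modulo the integer \<open>m\<close> in \<open>I\<close>. So the box points, not only their
      shifted images, lie in one class of \<open>I\<close>.\<close>
    have G_diff: "u - v \<in> I"
      if I: "poly_ideal I" "of_nat m \<in> I" "coprime Q m" "G u \<in> I" "G v \<in> I" for I m u v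
    proof -
      have "G u - G v = of_nat Q * (u - v)" by (simp add: G_def algebra_simps)
      hence 1: "of_nat Q * (u - v) \<in> I" using poly_ideal_closed(3)[OF I(1,4,5)] by simp
      have "coprime (int Q) (int m)" using I(3) by simp
      then obtain s t where st: "s * int Q + t * int m = 1" by (metis bezout_int coprime_imp_gcd_eq_1)
      have "of_nat Q * (u - v) * of_int s + of_nat m * (of_int t * (u - v)) = of_int (s * int Q + t * int m) * (u - v)"
        by (simp add: algebra_simps)
      also have "\<dots> = u - v" by (simp add: st)
      finally show ?thesis
        using poly_ideal_closed(2)[OF I(1) poly_ideal_closed(4)[OF I(1) 1] poly_ideal_closed(4)[OF I(1,2)]] by metis
    qed
    have cop: "coprime Q p" if "prime p" "p0 < p" for p
      using that unfolding Q_def by (metis coprime_commute linorder_not_le prime_dvd_fact_iff prime_imp_coprime)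

    define bad where "bad = {b \<in> box. \<exists>p. prime p \<and> p0 < p \<and>
      (int p dvd nrm (G b) \<and> \<theta> \<notin> frobenius_fixed p \<or> int p ^ 2 dvd nrm (G b))}"
    define R where "R = {p. prime p \<and> p0 < p \<and> real p ^ 2 \<le> real (K2 * M)}"
    have R: "finite R" "real (card R) \<le> sqrt (real (K2 * M))"
      using card_squares_le[of R "real (K2 * M)"] by (auto simp: R_def prime_gt_0_nat)
    have count: "card {b \<in> box. G b \<in> I} * p ^ 2 \<le> K1 * M + p ^ 2 \<and> ({b \<in> box. G b \<in> I} \<noteq> {} \<longrightarrow> p ^ 2 \<le> K2 * M)"
      if I: "poly_ideal I" "of_nat (p ^ 2) \<in> I" "card Y = p ^ 2" "incongruent I Y" and p: "prime p" "p0 < p" for I Y p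
    proof -
      define X where "X = {b \<in> box. G b \<in> I}"
      have X: "X \<subseteq> polys_in deg {-int N..int N}" by (auto simp: X_def box_def)
      have "coprime Q (p ^ 2)" using cop[OF p] by simp
      hence Xd: "u - v \<in> I" if "u \<in> X" "v \<in> X" for u v
        using that G_diff[OF I(1,2)] by (auto simp: X_def)
      have Y: "y = y'" if "y \<in> Y" "y' \<in> Y" "y - y' \<in> I" for y y' using that I(4) by (auto simp: incongruent_def)
      have finX: "finite X" using box by (simp add: X_def)
      have "p ^ 2 \<le> K2 * M" if ne: "X \<noteq> {}"
      proof -
        obtain b where b: "b \<in> X" using ne by blast
        have "card X * card Y \<le> (2 * (N + ?C * (L * N)) + 1) ^ deg"
          by (rule ideal_count[OF I(1) _ _ _ X Xd Y, of "G b"]) (use b G_nz G_box in \<open>auto simp: X_def\<close>)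
        also have "\<dots> \<le> ((1 + ?C * L) * (2 * N + 1)) ^ deg"
          by (intro power_mono) (auto simp: algebra_simps)
        also have "\<dots> = K2 * M" by (simp only: K2_def M_def power_mult_distrib)
        finally have "card X * p ^ 2 \<le> K2 * M" using I(3) by simp
        moreover have "1 * p ^ 2 \<le> card X * p ^ 2"
          using finX ne by (intro mult_right_mono) (auto simp: Suc_le_eq card_gt_0_iff)
        ultimately show ?thesis by linarith
      qed
      moreover have "card X * p ^ 2 \<le> K1 * M + p ^ 2"
      \<comment> \<open>A single point is paid for by the summand \<open>p^2\<close>. Two points
        supply a nonzero element of \<open>I\<close> whose size does not involve
        \<open>Q\<close>.\<close>
      proof (cases "card X \<le> 1")
        case True
        hence "card X * p ^ 2 \<le> 1 * p ^ 2" by (rule mult_right_mono) simp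
        thus ?thesis by linarith
      next
        case False
        then obtain u v where uv: "u \<in> X" "v \<in> X" "u \<noteq> v"
          using finX by (metis card_le_Suc0_iff_eq One_nat_def)
        have uv': "u - v \<in> polys_in deg {-int (2 * N)..int (2 * N)}"
        proof (rule polys_inI_le)
          fix i
          have "\<bar>coeff u i\<bar> \<le> int N" "\<bar>coeff v i\<bar> \<le> int N"
            using uv X by (auto intro!: polys_in_coeff_le)
          thus "\<bar>coeff (u - v) i\<bar> \<le> int (2 * N)" by simp
          have "u \<in> polys_in deg {-int N..int N}" "v \<in> polys_in deg {-int N..int N}" using uv X by auto
          thus "coeff (u - v) i = 0" if "i \<ge> deg" using that by (simp add: polys_in_def)
        qed
        have "u - v \<noteq> 0" using uv(3) by simp
        hence "card X * card Y \<le> (2 * (N + ?C * (2 * N)) + 1) ^ deg"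
          by (rule ideal_count[OF I(1) Xd[OF uv(1,2)] _ uv' X Xd Y])
        also have "\<dots> \<le> ((1 + 2 * ?C) * (2 * N + 1)) ^ deg"
          by (intro power_mono) (auto simp: algebra_simps)
        also have "\<dots> = K1 * M" by (simp only: K1_def M_def power_mult_distrib)
        finally show ?thesis using I(3) by simp
      qed
      ultimately show ?thesis unfolding X_def by blast
    qed
    have "\<exists>\<I>. bad_family p \<I>" if pp: "prime p" "p0 < p" for p
    proof -
      obtain P :: "'a set" where P: "prime_over p P" using prime_over_exists[OF pp(1)] .
      have b: "b1 < p" "b2 < p" using pp by (auto simp: p0_def)
      show ?thesis
        by (rule bad_family_exists[OF pp(1) P b1[OF pp(1) b(1) P] b2[OF pp(1) b(2) P]])
    qed
    then obtain \<I> where fam: "\<And>p. prime p \<Longrightarrow> p0 < p \<Longrightarrow> bad_family p (\<I> p)" by metis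
    have \<I>: "finite (\<I> p)" "card (\<I> p) \<le> 3 * deg ^ 2" if "prime p" "p0 < p" for p
      using fam[OF that] by (simp_all add: bad_family_def)
    have \<I>_count: "card {b \<in> box. G b \<in> I} * p ^ 2 \<le> K1 * M + p ^ 2"
      "{b \<in> box. G b \<in> I} \<noteq> {} \<Longrightarrow> p ^ 2 \<le> K2 * M" if pp: "prime p" "p0 < p" and I: "I \<in> \<I> p" for p I
    proof -
      from fam[OF pp] I obtain Y where "poly_ideal I" "of_nat (p ^ 2) \<in> I" "card Y = p ^ 2" "incongruent I Y"
        unfolding bad_family_def by meson
      from count[OF this pp] show "card {b \<in> box. G b \<in> I} * p ^ 2 \<le> K1 * M + p ^ 2"
        "{b \<in> box. G b \<in> I} \<noteq> {} \<Longrightarrow> p ^ 2 \<le> K2 * M" by simp_all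
    qed
    have bad_sub: "bad \<subseteq> (\<Union>p\<in>R. \<Union>I\<in>\<I> p. {b \<in> box. G b \<in> I})"
    proof
      fix b assume "b \<in> bad"
      then obtain p where p: "b \<in> box" "prime p" "p0 < p"
        "int p dvd nrm (G b) \<and> \<theta> \<notin> frobenius_fixed p \<or> int p ^ 2 dvd nrm (G b)" by (auto simp: bad_def)
      then obtain I where I: "I \<in> \<I> p" "G b \<in> I" using fam[OF p(2,3)] unfolding bad_family_def by meson
      have "p ^ 2 \<le> K2 * M" by (rule \<I>_count(2)[OF p(2,3) I(1)]) (use I p(1) in blast)
      hence "real (p ^ 2) \<le> real (K2 * M)" by (simp only: of_nat_le_iff)
      hence "p \<in> R" using p by (simp add: R_def)
      thus "b \<in> (\<Union>p\<in>R. \<Union>I\<in>\<I> p. {b \<in> box. G b \<in> I})" using I p(1) by blast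
    qed
    have card_bad: "real (card bad) \<le> real M / 4"
    proof -
      have fin1: "finite (\<Union>I\<in>\<I> p. {b \<in> box. G b \<in> I})" if "p \<in> R" for p
        using that \<I>[of p] box by (auto simp: R_def)
      have "card bad \<le> card (\<Union>p\<in>R. \<Union>I\<in>\<I> p. {b \<in> box. G b \<in> I})"
        using bad_sub R(1) fin1 by (intro card_mono) auto
      also have "\<dots> \<le> (\<Sum>p\<in>R. card (\<Union>I\<in>\<I> p. {b \<in> box. G b \<in> I}))" by (rule card_UN_le[OF R(1)])
      finally have "real (card bad) \<le> (\<Sum>p\<in>R. real (card (\<Union>I\<in>\<I> p. {b \<in> box. G b \<in> I})))"
        by (simp only: of_nat_le_iff flip: of_nat_sum)
      also have "\<dots> \<le> (\<Sum>p\<in>R. real (3 * deg ^ 2) * (real (K1 * M) * (1 / real p ^ 2) + 1))"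
      proof (rule sum_mono)
        fix p assume "p \<in> R"
        hence p: "prime p" "p0 < p" by (auto simp: R_def)
        have p1: "real p > 0" using prime_gt_0_nat[OF p(1)] by simp
        have "card (\<Union>I\<in>\<I> p. {b \<in> box. G b \<in> I}) \<le> (\<Sum>I\<in>\<I> p. card {b \<in> box. G b \<in> I})"
          using \<I>[OF p] by (intro card_UN_le) auto
        hence "real (card (\<Union>I\<in>\<I> p. {b \<in> box. G b \<in> I})) \<le> (\<Sum>I\<in>\<I> p. real (card {b \<in> box. G b \<in> I}))"
          by (simp only: of_nat_le_iff flip: of_nat_sum)
        also have "\<dots> \<le> (\<Sum>I\<in>\<I> p. real (K1 * M) * (1 / real p ^ 2) + 1)"
        proof (rule sum_mono)
          fix I assume "I \<in> \<I> p"
          from \<I>_count(1)[OF p this] have "real (card {b \<in> box. G b \<in> I} * p ^ 2) \<le> real (K1 * M + p ^ 2)"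
            by (simp only: of_nat_le_iff)
          thus "real (card {b \<in> box. G b \<in> I}) \<le> real (K1 * M) * (1 / real p ^ 2) + 1"
            using p1 by (simp add: field_simps)
        qed
        also have "\<dots> = real (card (\<I> p)) * (real (K1 * M) * (1 / real p ^ 2) + 1)" by simp
        also have "\<dots> \<le> real (3 * deg ^ 2) * (real (K1 * M) * (1 / real p ^ 2) + 1)"
        proof (rule mult_right_mono)
          show "real (card (\<I> p)) \<le> real (3 * deg ^ 2)" using \<I>[OF p] by (simp only: of_nat_le_iff)
        qed (auto intro!: add_nonneg_nonneg)
        finally show "real (card (\<Union>I\<in>\<I> p. {b \<in> box. G b \<in> I})) \<le>
          real (3 * deg ^ 2) * (real (K1 * M) * (1 / real p ^ 2) + 1)" .
      qed
      also have "\<dots> = real (3 * deg ^ 2) * real (K1 * M) * (\<Sum>p\<in>R. 1 / real p ^ 2) + real (3 * deg ^ 2) * real (card R)"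
      proof -
        have "(\<Sum>p\<in>R. a * (c * f p + 1)) = a * c * (\<Sum>p\<in>R. f p) + a * real (card R)" for a c and f :: "nat \<Rightarrow> real"
          by (simp add: distrib_left sum.distrib sum_distrib_left mult_ac)
        thus ?thesis .
      qed
      \<comment> \<open>The first half comes from the choice of \<open>p0\<close>, the second from
        that of \<open>n0\<close> together with the bound on the number of primes in
        \<open>R\<close>.\<close>
      also have "\<dots> \<le> real M / 8 + real M / 8"
      proof (rule add_mono)
        have p0: "p0 > 0" "24 * deg ^ 2 * K1 \<le> p0" by (simp_all add: p0_def)
        have "(\<Sum>p\<in>R. 1 / real p ^ 2) \<le> 1 / real p0"
          using R p0 by (intro sum_inverse_squares_le) (auto simp: R_def)
        hence "real (3 * deg ^ 2) * real (K1 * M) * (\<Sum>p\<in>R. 1 / real p ^ 2) \<le>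
            real (3 * deg ^ 2) * real (K1 * M) * (1 / real p0)" by (intro mult_left_mono) auto
        also have "\<dots> = real M * (real (24 * deg ^ 2 * K1) / real p0) / 8" by (simp add: field_simps)
        also have "\<dots> \<le> real M * 1 / 8"
        proof (intro divide_right_mono mult_left_mono)
          have "real (24 * deg ^ 2 * K1) \<le> real p0" using p0(2) by (simp only: of_nat_le_iff)
          thus "real (24 * deg ^ 2 * K1) / real p0 \<le> 1" using p0(1) by (simp add: divide_le_eq)
        qed auto
        finally show "real (3 * deg ^ 2) * real (K1 * M) * (\<Sum>p\<in>R. 1 / real p ^ 2) \<le> real M / 8" by simp
        have "(24 * deg ^ 2) ^ 2 * K2 \<le> M" using n N NM unfolding n0_def by linarith
        hence "(24 * deg ^ 2) ^ 2 * K2 * M \<le> M * M" by (rule mult_right_mono) simp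
        hence "real ((24 * deg ^ 2) ^ 2 * K2 * M) \<le> real (M * M)" by (simp only: of_nat_le_iff)
        hence "sqrt ((24 * real deg ^ 2) ^ 2 * real (K2 * M)) \<le> sqrt (real M ^ 2)"
          by (intro real_sqrt_le_mono) (simp add: power2_eq_square mult_ac)
        moreover have "sqrt ((24 * real deg ^ 2) ^ 2 * real (K2 * M)) = 24 * (real deg ^ 2 * sqrt (real (K2 * M)))"
          by (simp only: real_sqrt_mult[of "_ ^ 2"] real_sqrt_abs) simp
        ultimately have "24 * (real deg ^ 2 * sqrt (real (K2 * M))) \<le> real M" by simp
        moreover have "real deg ^ 2 * real (card R) \<le> real deg ^ 2 * sqrt (real (K2 * M))"
          using R(2) by (intro mult_left_mono) auto
        moreover have "real (3 * deg ^ 2) * real (card R) = 3 * (real deg ^ 2 * real (card R))" by simp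
        ultimately show "real (3 * deg ^ 2) * real (card R) \<le> real M / 8" by linarith
      qed
      finally show ?thesis by simp
    qed

    define good where "good = box - bad"
    have bad_box: "bad \<subseteq> box" by (auto simp: bad_def)
    have card_good: "real (card good) \<ge> 3 / 4 * real M"
    proof -
      have "card good = M - card bad" unfolding good_def
        using card_Diff_subset[OF finite_subset[OF bad_box box(1)] bad_box] box(2) by simp
      moreover have "card bad \<le> M" using card_mono[OF box(1) bad_box] box by simp
      ultimately show ?thesis using card_bad by (simp add: of_nat_diff)
    qed
    define T where "T = {p. prime p \<and> \<theta> \<in> frobenius_fixed p \<and> p0 < p \<and> p \<le> (W * L * N) ^ deg}"
    have finT: "finite T" by (simp add: T_def)
    have Tp: "prime p" "ln p \<ge> 0" "real p > 0" if "p \<in> T" for p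
      using that prime_gt_1_nat[of p] by (auto simp: T_def)
    \<comment> \<open>A good norm is squarefree with all prime factors in \<open>T\<close>, so its
      logarithm is exactly the sum over them; the shift makes the norm at least
      \<open>N^deg\<close>.\<close>
    have good_ln: "real deg * ln N \<le> (\<Sum>p\<in>T. if int p dvd nrm (G b) then ln p else 0)" if b: "b \<in> good" for b
    proof -
      have bb: "b \<in> box" "b \<notin> bad" using b by (auto simp: good_def)
      define m where "m = nat \<bar>nrm (G b)\<bar>"
      have dm: "q dvd m \<longleftrightarrow> int q dvd nrm (G b)" for q by (simp add: m_def)
      have m: "m > 0" using G_nrm[OF bb(1)] by (simp add: m_def)
      have sq: "\<not> p ^ 2 dvd m" if "prime p" for p
      proof
        assume p2: "p ^ 2 dvd m"
        hence "p dvd m" by (metis dvd_trans dvd_triv_left power2_eq_square)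
        hence "p0 < p" using small[OF that] dm by (meson linorder_not_le)
        moreover have "int p ^ 2 dvd nrm (G b)" using p2 dm[of "p ^ 2"] by simp
        ultimately show False using bb that by (auto simp: bad_def)
      qed
      have sub: "prime_factors m \<subseteq> {p \<in> T. int p dvd nrm (G b)}"
      proof
        fix p assume "p \<in> prime_factors m"
        hence p: "prime p" "p dvd m" by (auto simp: in_prime_factors_iff)
        hence d: "int p dvd nrm (G b)" using dm by simp
        hence "p0 < p" using small[OF p(1)] by (meson linorder_not_le)
        have fr: "\<theta> \<in> frobenius_fixed p" using bb d p(1) \<open>p0 < p\<close> by (auto simp: bad_def)
        have "p \<le> m" using p(2) m by (rule dvd_imp_le)
        moreover have "m \<le> (W * (L * N)) ^ deg"
          unfolding m_def nat_le_iff by (rule W[OF G_box[OF bb(1)]])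
        ultimately have "p \<le> (W * L * N) ^ deg" by (simp add: mult.assoc)
        thus "p \<in> {p \<in> T. int p dvd nrm (G b)}" using p(1) d fr \<open>p0 < p\<close> by (simp add: T_def)
      qed
      have "real deg * ln N = ln (real N ^ deg)" using N by (simp add: ln_realpow)
      also have "\<dots> \<le> ln (real m)" using G_low[OF bb(1)] N by (intro ln_mono) (auto simp: m_def)
      also have "\<dots> = (\<Sum>p\<in>prime_factors m. ln (real p))" by (rule ln_squarefree_eq[OF m sq])
      also have "\<dots> \<le> (\<Sum>p | p \<in> T \<and> int p dvd nrm (G b). ln (real p))"
        using sub finT Tp by (intro sum_mono2) auto
      also have "\<dots> = (\<Sum>p\<in>T. if int p dvd nrm (G b) then ln p else 0)"
        using finT by (simp add: sum.If_cases Int_def)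
      finally show ?thesis .
    qed
    have cnt: "real (card {b \<in> box. int p dvd nrm (G b)}) \<le>
        (if p \<le> n ^ deg then 9 / 8 * (real deg * real M / p) else real K3 * (real deg * real M / p))" if pT: "p \<in> T" for p
    proof -
      have pp: "prime p" "p0 < p" and \<theta>: "\<theta> \<in> frobenius_fixed p" and pW: "p \<le> (W * L * N) ^ deg"
        using pT by (auto simp: T_def)
      obtain P :: "'a set" where P: "prime_over p P" using prime_over_exists[OF pp(1)] .
      interpret prime_over_locale p P using pp P by unfold_locales
      define c where "c = (if p \<le> n ^ deg then 9 / 8 else real K3)"
      have one: "real (card {b \<in> box. G b \<in> residue_ideal P x}) \<le> c * (real M / p)" if x: "x \<in> conjugates" for x
      proof -
        define X where "X = {b \<in> box. G b \<in> residue_ideal P x}"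
        have I: "poly_ideal (residue_ideal P x)" by (rule poly_ideal_residue_ideal[OF pp(1) P x])
        have pI: "of_nat p \<in> residue_ideal P x"
          unfolding residue_ideal_def mem_Collect_eq eval_int_simps using P_of_int_iff[of "int p"] by simp
        obtain q where q: "q ^ deg \<le> p" "card X * p \<le> (2 * (N + ?C * q) + 1) ^ deg"
        proof -
          have "\<exists>q. q ^ deg \<le> p \<and> card X * p \<le> (2 * (N + ?C * q) + 1) ^ deg"
          proof (rule residue_ideal_count[OF pp(1) P \<theta> x])
            show "X \<subseteq> polys_in deg {-int N..int N}" by (auto simp: X_def box_def)
            show "u - v \<in> residue_ideal P x" if "u \<in> X" "v \<in> X" for u v
              using that G_diff[OF I pI cop[OF pp]] by (auto simp: X_def)
          qed
          with that show ?thesis by blast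
        qed
        have "real (card X) * real p \<le> (real (2 * (N + ?C * q) + 1)) ^ deg"
          using q(2) by (metis of_nat_le_iff of_nat_mult of_nat_power)
        also have "\<dots> \<le> c * real M"
        proof (cases "p \<le> n ^ deg")
          case True
          hence "q ^ deg \<le> n ^ deg" using q by linarith
          hence "q \<le> n" using deg_pos by (simp add: power_mono_iff)
          hence "real ?C * real q \<le> real ?C * real n" by (intro mult_left_mono) auto
          also have "real ?C * real n = real ?C / real h * real N" using h by (simp add: N_def)
          finally have "real ?C * real q \<le> real ?C / real h * real N" .
          moreover have "(1 + real ?C / real h) * (2 * real N + 1) = 2 * real N + 1 + 2 * (real ?C / real h * real N) + real ?C / real h"
            by (simp add: algebra_simps)
          moreover have "0 \<le> real ?C / real h" by simp
          moreover have "real (2 * (N + ?C * q) + 1) = 2 * real N + 1 + 2 * (real ?C * real q)" by simp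
          ultimately have "real (2 * (N + ?C * q) + 1) \<le> (1 + real ?C / real h) * (2 * real N + 1)" by linarith
          hence "real (2 * (N + ?C * q) + 1) ^ deg \<le> ((1 + real ?C / real h) * (2 * real N + 1)) ^ deg"
            by (intro power_mono) auto
          also have "\<dots> = (1 + real ?C / real h) ^ deg * real M" by (simp add: M_def power_mult_distrib add.commute)
          also have "\<dots> \<le> 9 / 8 * real M" using h by (intro mult_right_mono) auto
          finally show ?thesis using True by (simp add: c_def)
        next
          case False
          have "q ^ deg \<le> (W * L * N) ^ deg" using q pW by linarith
          hence "q \<le> W * L * N" using deg_pos by (simp add: power_mono_iff)
          hence Cq: "?C * q \<le> ?C * (W * L * N)" by (rule mult_left_mono) simp
          have "2 * (N + ?C * q) + 1 = 2 * N + 1 + 2 * (?C * q)" by simp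
          also have "\<dots> \<le> 2 * N + 1 + 2 * (?C * (W * L * N)) + ?C * W * L"
            by (intro trans_le_add1 add_left_mono mult_left_mono[OF Cq]) simp
          also have "\<dots> = (1 + ?C * W * L) * (2 * N + 1)" by (simp add: algebra_simps)
          finally have "2 * (N + ?C * q) + 1 \<le> (1 + ?C * W * L) * (2 * N + 1)" .
          hence "(2 * (N + ?C * q) + 1) ^ deg \<le> ((1 + ?C * W * L) * (2 * N + 1)) ^ deg" by (rule power_mono) simp
          also have "\<dots> = K3 * M" by (simp only: K3_def M_def power_mult_distrib)
          finally have "real ((2 * (N + ?C * q) + 1) ^ deg) \<le> real (K3 * M)" by (simp only: of_nat_le_iff)
          thus ?thesis using False by (simp add: c_def)
        qed
        finally show ?thesis using Tp(3)[OF pT] by (simp add: X_def field_simps)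
      qed
      have "{b \<in> box. int p dvd nrm (G b)} \<subseteq> (\<Union>x\<in>conjugates. {b \<in> box. G b \<in> residue_ideal P x})"
      proof
        fix b assume b: "b \<in> {b \<in> box. int p dvd nrm (G b)}"
        then obtain x where "x \<in> conjugates" "G b \<in> residue_ideal P x"
          using nrm_dvd_residue_ideal[OF pp(1) P, of "G b"] by blast
        with b show "b \<in> (\<Union>x\<in>conjugates. {b \<in> box. G b \<in> residue_ideal P x})" by blast
      qed
      hence "card {b \<in> box. int p dvd nrm (G b)} \<le> card (\<Union>x\<in>conjugates. {b \<in> box. G b \<in> residue_ideal P x})"
        using box by (intro card_mono) auto
      also have "\<dots> \<le> (\<Sum>x\<in>conjugates. card {b \<in> box. G b \<in> residue_ideal P x})" by (rule card_UN_le) simp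
      finally have "real (card {b \<in> box. int p dvd nrm (G b)}) \<le> (\<Sum>x\<in>conjugates. real (card {b \<in> box. G b \<in> residue_ideal P x}))"
        by (simp only: of_nat_le_iff flip: of_nat_sum)
      also have "\<dots> \<le> (\<Sum>x\<in>conjugates. c * (real M / p))" by (intro sum_mono one)
      also have "\<dots> = c * (real deg * real M / p)" by (simp add: card_conjugates)
      finally show ?thesis by (cases "p \<le> n ^ deg") (simp_all add: c_def)
    qed
    let ?S = "{p. prime p \<and> \<theta> \<in> frobenius_fixed p \<and> p \<le> n ^ deg}"
    let ?D = "{p. prime p \<and> n ^ deg < p \<and> p \<le> 2 ^ k * n ^ deg}"
    \<comment> \<open>Double counting over good points and primes. Dividing by
      \<open>deg * M\<close> leaves 3/4 against 9/8, which is the source of 2/3.\<close>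
    have "3 / 4 * real M * (real deg * ln N) \<le> real (card good) * (real deg * ln N)"
      using card_good N by (intro mult_right_mono) auto
    also have "\<dots> = (\<Sum>b\<in>good. real deg * ln N)" by simp
    also have "\<dots> \<le> (\<Sum>b\<in>good. \<Sum>p\<in>T. if int p dvd nrm (G b) then ln p else 0)" by (intro sum_mono good_ln)
    also have "\<dots> \<le> (\<Sum>b\<in>box. \<Sum>p\<in>T. if int p dvd nrm (G b) then ln p else 0)"
      using box Tp by (intro sum_mono2) (auto simp: good_def intro!: sum_nonneg)
    also have "\<dots> = (\<Sum>p\<in>T. \<Sum>b\<in>box. if int p dvd nrm (G b) then ln p else 0)" by (rule sum.swap)
    also have "\<dots> = (\<Sum>p\<in>T. real (card {b \<in> box. int p dvd nrm (G b)}) * ln p)"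
      using box by (intro sum.cong) (auto simp: sum.If_cases Int_def)
    also have "\<dots> \<le> (\<Sum>p\<in>T. real deg * real M * ((if p \<le> n ^ deg then 9 / 8 * (ln p / p) else 0) +
        (if n ^ deg < p then real K3 * (ln p / p) else 0)))"
    proof (rule sum_mono)
      fix p assume p: "p \<in> T"
      from mult_right_mono[OF cnt[OF p] Tp(2)[OF p]]
      show "real (card {b \<in> box. int p dvd nrm (G b)}) * ln p \<le> real deg * real M *
        ((if p \<le> n ^ deg then 9 / 8 * (ln p / p) else 0) + (if n ^ deg < p then real K3 * (ln p / p) else 0))"
        by (cases "p \<le> n ^ deg") (simp_all add: mult_ac)
    qed
    also have "\<dots> = real deg * real M * (9 / 8 * (\<Sum>p | p \<in> T \<and> p \<le> n ^ deg. ln p / p) +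
        real K3 * (\<Sum>p | p \<in> T \<and> n ^ deg < p. ln p / p))"
    proof -
      have "(\<Sum>p\<in>T. c * ((if p \<le> m then a * f p else 0) + (if m < p then b * f p else 0))) =
          c * (a * (\<Sum>p | p \<in> T \<and> p \<le> m. f p) + b * (\<Sum>p | p \<in> T \<and> m < p. f p))"
        for a b c :: real and m and f :: "nat \<Rightarrow> real"
        using finT by (simp add: sum.distrib sum.If_cases Int_def flip: sum_distrib_left)
      thus ?thesis .
    qed
    also have "\<dots> \<le> real deg * real M * (9 / 8 * (\<Sum>p\<in>?S. ln p / p) + real K3 * (2 * real k * ln 2))"
    proof (intro mult_left_mono add_mono)
      show "(\<Sum>p | p \<in> T \<and> p \<le> n ^ deg. ln p / p) \<le> (\<Sum>p\<in>?S. ln p / p)"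
        by (intro sum_mono2) (auto simp: T_def dest: prime_gt_0_nat)
      have "(W * L * N) ^ deg = (W * L * h) ^ deg * n ^ deg" by (simp add: N_def power_mult_distrib mult_ac)
      also have "\<dots> \<le> 2 ^ k * n ^ deg" using k by (rule mult_right_mono) simp
      finally have "(W * L * N) ^ deg \<le> 2 ^ k * n ^ deg" .
      hence "(\<Sum>p | p \<in> T \<and> n ^ deg < p. ln p / p) \<le> (\<Sum>p\<in>?D. ln p / p)"
        by (intro sum_mono2) (auto simp: T_def dest: prime_gt_0_nat)
      also have "\<dots> \<le> 2 * real k * ln 2" using n1 by (intro sum_ln_primes_dyadic_power) auto
      finally show "(\<Sum>p | p \<in> T \<and> n ^ deg < p. ln p / p) \<le> 2 * real k * ln 2" .
    qed auto
    finally have "real deg * real M * (3 / 4 * ln N) \<le> real deg * real M *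
        (9 / 8 * (\<Sum>p\<in>?S. ln p / p) + real K3 * (2 * real k * ln 2))" by (simp add: mult_ac)
    hence "3 / 4 * ln N \<le> 9 / 8 * (\<Sum>p\<in>?S. ln p / p) + real K3 * (2 * real k * ln 2)"
      using deg_pos M1 by (simp add: mult_le_cancel_left_pos)
    moreover have "ln n \<le> ln N" using N n1 by (intro ln_mono) auto
    ultimately show ?thesis by (simp add: algebra_simps)
  qed
  thus ?thesis by blast
qed

end

section \<open>The normal closure and Bauer's argument\<close>

lemma rat_vector_space: "vector_space (\<lambda>(q::rat) (x::'a::field_char_0). of_rat q * x)"
  by unfold_locales (auto simp: algebra_simps of_rat_add of_rat_mult)

lemma coeff_prod_linear_alg_ints:
  assumes "\<And>x. x \<in> B \<Longrightarrow> x \<in> alg_ints"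
  shows "coeff (\<Prod>x\<in>B. [:- x, 1:]) i \<in> alg_ints"
  using assms
proof (induction B arbitrary: i rule: infinite_finite_induct)
  case (insert x B)
  hence "coeff (pCons 0 (\<Prod>x\<in>B. [:- x, 1:])) i \<in> alg_ints" "- x * coeff (\<Prod>x\<in>B. [:- x, 1:]) i \<in> alg_ints"
    by (auto simp: coeff_pCons split: nat.splits intro!: alg_ints_uminus alg_ints_mult)
  hence "coeff (pCons 0 (\<Prod>x\<in>B. [:- x, 1:])) i + - x * coeff (\<Prod>x\<in>B. [:- x, 1:]) i \<in> alg_ints"
    by (rule alg_ints_add)
  moreover have "(\<Prod>x\<in>insert x B. [:- x, 1:]) = pCons 0 (\<Prod>x\<in>B. [:- x, 1:]) + smult (- x) (\<Prod>x\<in>B. [:- x, 1:])"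
    using insert.hyps by simp
  ultimately show ?case by (metis coeff_add coeff_smult)
qed (auto simp: coeff_1)

text \<open>The coefficients are polynomials in the conjugates, hence algebraic integers, and they
  are rational.\<close>

lemma min_poly_integral:
  fixes c :: "'a::{alg_closed_field, field_char_0}"
  assumes f: "irreducible f" "lead_coeff f = 1" "eval_rat f c = 0" and c: "c \<in> alg_ints"
  obtains F where "f = map_poly of_int F"
proof -
  define A where "A = {x :: 'a. poly (map_poly of_rat f) x = 0}"
  have eq: "(map_poly of_rat f :: 'a poly) = (\<Prod>x\<in>A. [:- x, 1:])"
    using rsquarefree_factorization(1)[OF irreducible_rsquarefree[OF f(1)]] f(2)
    by (simp add: A_def coeff_map_poly)
  have A_int: "x \<in> alg_ints" if "x \<in> A" for x
    using conjugate_eval_alg_int[OF f(1,3), of x "[:0, 1:]"] that c by (simp add: A_def eval_rat_def)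
  have "coeff (\<Prod>x\<in>A. [:- x, 1:]) i \<in> alg_ints" for i by (rule coeff_prod_linear_alg_ints[OF A_int])
  hence "(of_rat (coeff f i) :: 'a) \<in> alg_ints" for i using eq by (metis coeff_map_poly of_rat_0)
  hence "coeff f i \<in> \<int>" for i using alg_ints_of_rat by blast
  hence "f = map_poly of_int (map_poly floor f)" by (intro poly_eqI) (simp add: coeff_map_poly)
  thus ?thesis by (rule that)
qed

text \<open>The premise on \<open>y\<close> says that \<open>y\<close> is a conjugate of
  \<open>c\<close> without naming the minimal polynomial, which is only constructed in the
  proof.\<close>

lemma galois_element_exists:
  fixes c :: "'a::{alg_closed_field, field_char_0}"
  assumes c: "c \<in> alg_ints"
    and normal: "\<And>y. (\<And>h. eval_rat h c = 0 \<Longrightarrow> eval_rat h y = 0) \<Longrightarrow> y \<in> rat_adjoin c"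
  obtains F where "galois_element c F"
proof -
  have "algebraic c" using c by (auto simp: alg_ints_def)
  then obtain f :: "rat poly" where f: "irreducible f" "lead_coeff f = 1" "eval_rat f c = 0"
    by (rule min_poly_exists)
  obtain F where F: "f = map_poly of_int F" using min_poly_integral[OF f c] .
  have "galois_element c F"
  proof
    show "irreducible (map_poly of_int F :: rat poly)" using f F by simp
    show "lead_coeff F = 1" using f(2) F by simp
    show "eval_int F c = 0" using f(3) F by (simp add: eval_rat_int)
    fix y :: 'a assume "eval_int F y = 0"
    hence "eval_rat f y = 0" by (simp add: F eval_rat_int)
    thus "y \<in> rat_adjoin c" using conjugate_eval_zero[OF f(1,3)] by (intro normal)
  qed
  thus ?thesis by (rule that)
qed

lemma rat_adjoin_span:
  fixes \<eta> :: "'a::{alg_closed_field, field_char_0}"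
  assumes "galois_element \<eta> G" and x: "x \<in> rat_adjoin \<eta>"
  shows "x \<in> module.span (\<lambda>(q::rat) x. of_rat q * x) ((\<lambda>i. \<eta> ^ i) ` {..<galois_element.deg G})"
proof -
  interpret galois_element \<eta> G by fact
  interpret vs: vector_space "\<lambda>(q::rat) (x::'a). of_rat q * x" by (rule rat_vector_space)
  obtain r where r: "x = eval_rat r \<eta>" "degree r < deg" using x by (rule rat_adjoin_reduced)
  have dr: "coeff r i = 0" if "i \<ge> deg" for i using r(2) that by (intro coeff_eq_0) simp
  note r(1)
  also have "r = (\<Sum>i<deg. monom (coeff r i) i)" by (rule poly_eqI) (auto simp: coeff_sum dr)
  also have "eval_rat \<dots> \<eta> = (\<Sum>i<deg. of_rat (coeff r i) * \<eta> ^ i)" by (simp add: eval_rat_sum)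
  also have "\<dots> \<in> vs.span ((\<lambda>i. \<eta> ^ i) ` {..<deg})"
    by (intro vs.span_sum vs.span_scale vs.span_base) auto
  finally show ?thesis .
qed

text \<open>A weak tower law: the powers of \<theta> below \<open>deg\<close> and their multiples by
  \<alpha> are independent over the rationals, since a relation would express \<alpha> as a quotient
  of elements of the field generated by \<theta>.\<close>

lemma degree_doubles:
  fixes \<theta> \<eta> \<alpha> :: "'a::{alg_closed_field, field_char_0}"
  assumes "galois_element \<theta> F" "galois_element \<eta> G"
    and \<theta>: "\<theta> \<in> rat_adjoin \<eta>" and \<alpha>: "\<alpha> \<in> rat_adjoin \<eta>" "\<alpha> \<notin> rat_adjoin \<theta>"
  shows "2 * galois_element.deg F \<le> galois_element.deg G"
proof -
  interpret galois_element \<theta> F by fact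
  interpret E: galois_element \<eta> G by fact
  interpret vs: vector_space "\<lambda>(q::rat) (x::'a). of_rat q * x" by (rule rat_vector_space)
  have \<theta>_alg: "algebraic \<theta>" using conjugate_alg_int[of \<theta>] by (auto simp: alg_ints_def)
  define f where "f = (\<lambda>k. if k < deg then \<theta> ^ k else \<alpha> * \<theta> ^ (k - deg))"
  have indep: "u k = 0" if u: "(\<Sum>k<2 * deg. of_rat (u k) * f k) = 0" and k: "k < 2 * deg" for u k
  proof -
    define A where "A = (\<Sum>k<deg. monom (u k) k)"
    define B where "B = (\<Sum>k<deg. monom (u (deg + k)) k)"
    have cA: "coeff A i = (if i < deg then u i else 0)" and cB: "coeff B i = (if i < deg then u (deg + i) else 0)" for i
      by (simp_all add: A_def B_def coeff_sum)
    have dA: "A = 0 \<or> degree A < deg" and dB: "B = 0 \<or> degree B < deg"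
      using deg_pos by (auto simp: cA cB intro!: degree_lessI)
    have "{..<2 * deg} = {..<deg} \<union> (+) deg ` {..<deg}"
      by (auto simp: image_iff) (metis add_diff_inverse_nat lessThan_iff less_diff_conv2 linorder_not_less mult_2 nat_add_left_cancel_less)
    hence "(\<Sum>k<2 * deg. of_rat (u k) * f k) = (\<Sum>k<deg. of_rat (u k) * f k) + (\<Sum>k\<in>(+) deg ` {..<deg}. of_rat (u k) * f k)"
      by (simp only:) (intro sum.union_disjoint; auto)
    also have "(\<Sum>k<deg. of_rat (u k) * f k) = eval_rat A \<theta>" by (simp add: A_def eval_rat_sum f_def)
    also have "(\<Sum>k\<in>(+) deg ` {..<deg}. of_rat (u k) * f k) = \<alpha> * eval_rat B \<theta>"
      by (simp add: sum.reindex B_def eval_rat_sum f_def sum_distrib_left mult_ac)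
    finally have AB: "eval_rat A \<theta> + \<alpha> * eval_rat B \<theta> = 0" using u by simp
    have "eval_rat B \<theta> = 0"
    proof (rule ccontr)
      assume "eval_rat B \<theta> \<noteq> 0"
      hence "\<alpha> = eval_rat (- A) \<theta> * inverse (eval_rat B \<theta>)"
        using AB by (simp add: field_simps eq_neg_iff_add_eq_0)
      also have "\<dots> \<in> rat_adjoin \<theta>"
        by (intro rat_adjoin_mult rat_adjoin_inverse \<theta>_alg rat_adjoinI)
      finally show False using \<alpha>(2) by simp
    qed
    moreover from this have "eval_rat A \<theta> = 0" using AB by simp
    ultimately have "A = 0" "B = 0" using rat_poly_zero_of_root[OF _ theta_conjugate] dA dB by blast+
    hence AB0: "coeff A i = 0" "coeff B i = 0" for i by simp_all
    show "u k = 0"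
    proof (cases "k < deg")
      case True
      thus ?thesis using AB0(1)[of k] by (simp add: cA)
    next
      case False
      hence "k - deg < deg" "deg + (k - deg) = k" using k by linarith+
      thus ?thesis using AB0(2)[of "k - deg"] by (simp add: cB)
    qed
  qed
  \<comment> \<open>Independence is a property of the set of values, so coincidences in the family
    have to be excluded for the cardinality.\<close>
  have inj: "inj_on f {..<2 * deg}"
  proof (rule inj_onI, rule ccontr)
    fix k l assume kl: "k \<in> {..<2 * deg}" "l \<in> {..<2 * deg}" "f k = f l" "k \<noteq> l"
    define u where "u = (\<lambda>j. if j = k then 1 else if j = l then -1 else 0 :: rat)"
    have "(\<Sum>j<2 * deg. of_rat (u j) * f j) = (\<Sum>j\<in>{k, l}. of_rat (u j) * f j)"
      using kl by (intro sum.mono_neutral_right) (auto simp: u_def)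
    also have "\<dots> = 0" using kl by (simp add: u_def of_rat_minus)
    finally have "u k = 0" by (rule indep) (use kl in simp)
    thus False by (simp add: u_def)
  qed
  have "vs.independent (f ` {..<2 * deg})"
    unfolding vs.independent_explicit_module
  proof (intro allI impI)
    fix t and u :: "'a \<Rightarrow> rat" and v assume t: "finite t" "t \<subseteq> f ` {..<2 * deg}" "(\<Sum>v\<in>t. of_rat (u v) * v) = 0" "v \<in> t"
    define u' where "u' = (\<lambda>k. if f k \<in> t then u (f k) else 0)"
    have "(\<Sum>k<2 * deg. of_rat (u' k) * f k) = (\<Sum>v\<in>f ` {..<2 * deg}. of_rat (if v \<in> t then u v else 0) * v)"
      by (simp add: sum.reindex[OF inj] u'_def)
    also have "\<dots> = (\<Sum>v\<in>t. of_rat (u v) * v)"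
      using t(2) by (intro sum.mono_neutral_cong_right) auto
    finally have u'0: "(\<Sum>k<2 * deg. of_rat (u' k) * f k) = 0" using t(3) by simp
    obtain k where k: "k < 2 * deg" "v = f k" using t(2,4) by auto
    have "u' k = 0" by (rule indep[OF u'0 k(1)])
    thus "u v = 0" using k t(4) by (simp add: u'_def)
  qed
  moreover have "f ` {..<2 * deg} \<subseteq> vs.span ((\<lambda>i. \<eta> ^ i) ` {..<E.deg})"
  proof safe
    fix k
    have "\<theta> ^ i \<in> rat_adjoin \<eta>" for i
      using rat_adjoin_eval[OF \<theta>, of "monom 1 i"] by simp
    hence "f k \<in> rat_adjoin \<eta>" using \<alpha>(1) by (simp add: f_def rat_adjoin_mult)
    thus "f k \<in> vs.span ((\<lambda>i. \<eta> ^ i) ` {..<E.deg})"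
      by (rule rat_adjoin_span[OF assms(2)])
  qed
  ultimately have "card (f ` {..<2 * deg}) \<le> card ((\<lambda>i. \<eta> ^ i) ` {..<E.deg})"
    using vs.independent_span_bound[of "(\<lambda>i. \<eta> ^ i) ` {..<E.deg}"] by blast
  also have "\<dots> \<le> E.deg" using card_image_le[of "{..<E.deg}" "\<lambda>i. \<eta> ^ i"] by simp
  finally show ?thesis by (simp add: card_image[OF inj])
qed

text \<open>The weak Bauer theorem. The conjugates of \<alpha> together with \<theta> generate a
  normal field with primitive element \<eta>, and every large prime that splits completely for
  \<theta> does so for \<eta>. If \<alpha> were outside, the doubled degree would make the upper
  bound for \<eta> fall below the lower bound for \<theta>.\<close>

lemma frobenius_fixed_imp_mem:
  fixes \<theta> \<alpha> :: "'a::{alg_closed_field, field_char_0}"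
  assumes "galois_element \<theta> F" and \<alpha>: "\<alpha> \<in> alg_ints"
    and frob: "\<And>p. prime p \<Longrightarrow> b < p \<Longrightarrow> \<theta> \<in> frobenius_fixed p \<Longrightarrow> \<alpha> \<in> frobenius_fixed p"
  shows "\<alpha> \<in> rat_adjoin \<theta>"
proof (rule ccontr)
  assume not_mem: "\<alpha> \<notin> rat_adjoin \<theta>"
  interpret galois_element \<theta> F by fact
  have \<theta>: "\<theta> \<in> alg_ints" by (rule conjugate_alg_int) simp
  have "algebraic \<alpha>" using \<alpha> by (auto simp: alg_ints_def)
  then obtain f :: "rat poly" where f: "irreducible f" "lead_coeff f = 1" "eval_rat f \<alpha> = 0"
    by (rule min_poly_exists)
  define A where "A = {x :: 'a. eval_rat f x = 0}"
  have f0: "f \<noteq> 0" using f by auto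
  have finA: "finite A" unfolding A_def eval_rat_def by (rule poly_roots_finite) (simp add: f0)
  have A_int: "A \<subseteq> alg_ints"
    using conjugate_eval_alg_int[OF f(1,3), of _ "[:0, 1:]"] \<alpha> by (auto simp: A_def)
  have \<alpha>A: "\<alpha> \<in> A" using f by (simp add: A_def)
  obtain \<eta> where \<eta>: "\<eta> \<in> alg_ints" "insert \<theta> A \<subseteq> rat_adjoin \<eta>"
    "\<And>R. is_subring R \<Longrightarrow> insert \<theta> A \<subseteq> R \<Longrightarrow> \<eta> \<in> R"
    using primitive_element[of "insert \<theta> A"] finA A_int \<theta> by auto
  have \<theta>\<eta>: "\<theta> \<in> rat_adjoin \<eta>" and A\<eta>: "A \<subseteq> rat_adjoin \<eta>" using \<eta>(2) by auto
  have normal: "y \<in> rat_adjoin \<eta>" if y: "\<And>h. eval_rat h \<eta> = 0 \<Longrightarrow> eval_rat h y = 0" for y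
  proof -
    \<comment> \<open>The elements that the substitution of \<open>y\<close> for \<eta> carries into
      the field generated by \<eta>. They form a subring containing the generators, since conjugates
      go to conjugates; hence \<eta> belongs to it.\<close>
    define R where "R = {x. \<exists>h. x = eval_rat h \<eta> \<and> eval_rat h y \<in> rat_adjoin \<eta>}"
    have "is_subring R"
      unfolding is_subring_def
    proof (intro conjI ballI)
      show "1 \<in> R" unfolding R_def using rat_adjoin_of_rat[of 1 \<eta>] by (auto intro!: exI[of _ 1])
      fix u v assume "u \<in> R" "v \<in> R"
      then obtain g h where gh: "u = eval_rat g \<eta>" "eval_rat g y \<in> rat_adjoin \<eta>"
        "v = eval_rat h \<eta>" "eval_rat h y \<in> rat_adjoin \<eta>" by (auto simp: R_def)
      show "u - v \<in> R" unfolding R_def using gh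
        by (intro CollectI exI[of _ "g - h"]) (simp add: rat_adjoin_diff)
      show "u * v \<in> R" unfolding R_def using gh
        by (intro CollectI exI[of _ "g * h"]) (simp add: rat_adjoin_mult)
    qed
    moreover have "insert \<theta> A \<subseteq> R"
    proof
      fix x assume x: "x \<in> insert \<theta> A"
      then obtain g where g: "x = eval_rat g \<eta>" using \<eta>(2) rat_adjoinE by blast
      have "eval_rat g y \<in> rat_adjoin \<eta>"
      proof (cases "x = \<theta>")
        case True
        have "eval_rat (pcompose (map_poly of_int F) g) \<eta> = 0"
          using root_F by (simp add: eval_rat_int True flip: g)
        from y[OF this] have "eval_int F (eval_rat g y) = 0" by (simp add: eval_rat_int)
        hence "eval_rat g y \<in> rat_adjoin \<theta>" by (rule normal_F)
        thus ?thesis using rat_adjoin_eval[OF \<theta>\<eta>] by (auto elim: rat_adjoinE)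
      next
        case False
        hence "eval_rat (pcompose f g) \<eta> = 0" using x by (simp add: A_def flip: g)
        from y[OF this] have "eval_rat g y \<in> A" by (simp add: A_def)
        thus ?thesis using A\<eta> by blast
      qed
      thus "x \<in> R" unfolding R_def using g by blast
    qed
    ultimately have "\<eta> \<in> R" by (rule \<eta>(3))
    then obtain h where h: "\<eta> = eval_rat h \<eta>" "eval_rat h y \<in> rat_adjoin \<eta>" unfolding R_def by blast
    have "eval_rat (h - [:0, 1:]) \<eta> = 0" using h(1) by simp
    from y[OF this] have "eval_rat h y = y" by simp
    with h(2) show ?thesis by simp
  qed
  obtain G where G: "galois_element \<eta> G" using galois_element_exists[OF \<eta>(1) normal] .
  interpret E: galois_element \<eta> G by fact
  have deg2: "2 * deg \<le> E.deg"
    using degree_doubles[OF assms(1) G \<theta>\<eta> _ not_mem] A\<eta> \<alpha>A by blast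
  define S where "S = {p. prime p \<and> \<theta> \<in> frobenius_fixed p \<and> b < p}"
  have S: "prime p" "\<eta> \<in> frobenius_fixed p" if "p \<in> S" for p
  proof -
    have p: "prime p" "\<theta> \<in> frobenius_fixed p" "b < p" using that by (auto simp: S_def)
    show "prime p" by fact
    have "\<alpha> \<in> frobenius_fixed p" by (rule frob[OF p(1,3,2)])
    hence "A \<subseteq> frobenius_fixed p"
      using conjugate_in_frobenius_fixed[OF f(1,3) _ p(1)] by (auto simp: A_def)
    thus "\<eta> \<in> frobenius_fixed p"
      using p by (intro \<eta>(3) is_subring_frobenius_fixed) auto
  qed
  obtain K1 where K1: "\<And>X::nat. X \<ge> 1 \<Longrightarrow> 7 / 8 * real E.deg * (\<Sum>p | p \<in> S \<and> p \<le> X. ln p / p) \<le> ln X + K1"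
    using E.frobenius_fixed_upper[of S] S by blast
  obtain K2 n0 where K2: "\<And>n::nat. n \<ge> n0 \<Longrightarrow>
     (\<Sum>p | prime p \<and> \<theta> \<in> frobenius_fixed p \<and> p \<le> n ^ deg. ln p / p) \<ge> 2 / 3 * ln n - K2"
    using frobenius_fixed_lower by blast
  define K3 where "K3 = (\<Sum>p | prime p \<and> p \<le> b. ln p / p)"
  \<comment> \<open>At \<open>X = n^deg\<close> the lower bound enters with the factor (7/4) * (2/3)
    = 7/6 against 1 on the other side; 6 is the reciprocal of the surplus. \<open>K3\<close> covers
    the primes up to \<open>b\<close>.\<close>
  have bound: "real deg * ln n \<le> 6 * (K1 + 7 / 4 * real deg * (K2 + K3))" if n: "n \<ge> n0" "n \<ge> 1" for n :: nat
  proof -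
    let ?X = "n ^ deg"
    define s where "s = (\<Sum>p | p \<in> S \<and> p \<le> ?X. ln p / p)"
    have "{p. prime p \<and> \<theta> \<in> frobenius_fixed p \<and> p \<le> ?X} \<subseteq> {p. p \<in> S \<and> p \<le> ?X} \<union> {p. prime p \<and> p \<le> b}"
      by (auto simp: S_def)
    hence "(\<Sum>p | prime p \<and> \<theta> \<in> frobenius_fixed p \<and> p \<le> ?X. ln p / p) \<le>
        (\<Sum>p\<in>{p. p \<in> S \<and> p \<le> ?X} \<union> {p. prime p \<and> p \<le> b}. ln p / p)"
      by (intro sum_mono2) (auto simp: S_def dest: prime_gt_0_nat)
    also have "\<dots> \<le> s + K3"
      unfolding s_def K3_def by (subst sum.union_inter[symmetric])
        (auto simp: S_def intro!: sum_nonneg dest: prime_gt_0_nat)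
    finally have "2 / 3 * ln n - K2 - K3 \<le> s" using K2[OF n(1)] by simp
    hence "7 / 4 * real deg * (2 / 3 * ln n - K2 - K3) \<le> 7 / 4 * real deg * s"
      by (intro mult_left_mono) auto
    also have "\<dots> = 7 / 8 * (2 * real deg) * s" by simp
    also have "\<dots> \<le> 7 / 8 * real E.deg * s"
    proof (intro mult_right_mono mult_left_mono)
      show "2 * real deg \<le> real E.deg" using deg2 by linarith
      show "0 \<le> s" unfolding s_def by (intro sum_nonneg) (auto simp: S_def dest: prime_gt_0_nat)
    qed auto
    also have "\<dots> \<le> ln ?X + K1" unfolding s_def using n by (intro K1) simp
    also have "ln (real ?X) = real deg * ln n" using n by (simp add: ln_realpow)
    finally show ?thesis by (simp add: algebra_simps)
  qed
  define K where "K = 6 * (K1 + 7 / 4 * real deg * (K2 + K3))"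
  define n where "n = max (max n0 1) (nat \<lceil>exp (\<bar>K\<bar> + 1)\<rceil>)"
  have "exp (\<bar>K\<bar> + 1) \<le> real n" unfolding n_def by linarith
  hence "\<bar>K\<bar> + 1 \<le> ln n" by (simp add: ln_ge_iff n_def)
  moreover have "1 * ln n \<le> real deg * ln n"
    using deg_pos by (intro mult_right_mono) (auto simp: n_def)
  moreover have "real deg * ln n \<le> K" unfolding K_def by (rule bound) (auto simp: n_def)
  ultimately show False by linarith
qed

section \<open>Frobenius polynomials are integer-valued\<close>

context galois_element
begin

text \<open>Lagrange interpolation at the conjugates recovers \<open>h\<close> from its integral
  values \<open>h(y)\<close>, with denominators \<open>\<delta> y\<close> only. An integer divisible
  by the product of these clears the denominators of all integral elements at once.\<close>

lemma integral_coordinates: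
  "\<exists>m::int. m \<noteq> 0 \<and> (\<forall>x\<in>rat_adjoin \<theta> \<inter> alg_ints. \<exists>g. of_int m * x = eval_int g \<theta>)"
proof -
  define \<delta> where "\<delta> = (\<lambda>y. \<Prod>z\<in>conjugates - {y}. y - z)"
  define L where "L = (\<lambda>y. \<Prod>z\<in>conjugates - {y}. [:- z, 1:])"
  have \<delta>_int: "\<delta> y \<in> alg_ints" if "y \<in> conjugates" for y
    unfolding \<delta>_def using that by (intro alg_ints_prod) (auto intro: alg_ints_diff conjugate_alg_int)
  have \<delta>_nz: "\<delta> y \<noteq> 0" for y by (auto simp: \<delta>_def)
  have L_int: "coeff (L y) i \<in> alg_ints" for y i
    unfolding L_def by (rule coeff_prod_linear_alg_ints) (auto intro: conjugate_alg_int)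
  have L_poly: "poly (L y) z = (if z = y then \<delta> y else 0)" if "y \<in> conjugates" "z \<in> conjugates" for y z
    using that by (auto simp: L_def \<delta>_def poly_prod)
  have L_deg: "degree (L y) < deg" if "y \<in> conjugates" for y
    using that deg_pos by (simp add: L_def degree_prod_eq_sum_degree card_conjugates card_Diff_singleton)
  have "prod \<delta> conjugates \<in> alg_ints" "prod \<delta> conjugates \<noteq> 0"
    using \<delta>_int \<delta>_nz by (auto intro: alg_ints_prod)
  then obtain m z where m: "m \<noteq> 0" "z \<in> alg_ints" "of_int m = prod \<delta> conjugates * z" by (rule alg_int_dvd_int)
  have "\<exists>g. of_int m * x = eval_int g \<theta>" if x: "x \<in> rat_adjoin \<theta>" "x \<in> alg_ints" for x
  proof -
    obtain h where xh: "x = eval_rat h \<theta>" and dh: "degree h < deg" using x(1) by (rule rat_adjoin_reduced)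
    have h_int: "eval_rat h y \<in> alg_ints" if "y \<in> conjugates" for y
      by (rule conjugates_transfer_alg_int[OF _ theta_conjugate that]) (use xh x in simp)
    define D where "D = map_poly of_rat h - (\<Sum>y\<in>conjugates. smult (eval_rat h y / \<delta> y) (L y))"
    have "D = 0"
    proof (rule ccontr)
      assume "D \<noteq> 0"
      have "degree (\<Sum>y\<in>conjugates. smult (eval_rat h y / \<delta> y) (L y)) < deg"
      proof (intro degree_lessI disjI2 deg_pos allI impI)
        fix k assume "deg \<le> k"
        hence "coeff (L y) k = 0" if "y \<in> conjugates" for y
          using L_deg[OF that] by (intro coeff_eq_0) linarith
        thus "coeff (\<Sum>y\<in>conjugates. smult (eval_rat h y / \<delta> y) (L y)) k = 0" by (simp add: coeff_sum)
      qed
      hence "degree D < deg" unfolding D_def using dh by (intro degree_diff_less) auto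
      moreover have "conjugates \<subseteq> {y. poly D y = 0}"
      proof safe
        fix y assume y: "y \<in> conjugates"
        have "poly D y = eval_rat h y - (\<Sum>w\<in>conjugates. eval_rat h w / \<delta> w * (if y = w then \<delta> w else 0))"
          using y by (simp add: D_def poly_sum L_poly eval_rat_def)
        also have "\<dots> = 0" using y \<delta>_nz by (simp add: if_distrib sum.delta cong: if_cong)
        finally show "poly D y = 0" .
      qed
      hence "card conjugates \<le> card {y. poly D y = 0}" by (intro card_mono poly_roots_finite \<open>D \<noteq> 0\<close>)
      hence "deg \<le> degree D" using card_poly_roots_bound[OF \<open>D \<noteq> 0\<close>] card_conjugates by linarith
      ultimately show False by simp
    qed
    hence hL: "map_poly of_rat h = (\<Sum>y\<in>conjugates. smult (eval_rat h y / \<delta> y) (L y))" by (simp add: D_def)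
    have "(of_rat (of_int m * coeff h i) :: 'a) \<in> alg_ints" for i
    proof -
      have "(of_rat (of_int m * coeff h i) :: 'a) = of_int m * coeff (map_poly of_rat h) i"
        by (simp add: of_rat_mult coeff_map_poly)
      also have "\<dots> = (\<Sum>y\<in>conjugates. (of_int m / \<delta> y) * eval_rat h y * coeff (L y) i)"
        by (simp add: hL coeff_sum sum_distrib_left mult.assoc)
      also have "\<dots> \<in> alg_ints"
      proof (intro alg_ints_sum alg_ints_mult h_int L_int)
        fix y assume y: "y \<in> conjugates"
        have "of_int m / \<delta> y = prod \<delta> (conjugates - {y}) * z"
          unfolding m(3) using \<delta>_nz[of y] by (subst prod.remove[OF _ y]) auto
        also have "\<dots> \<in> alg_ints" using \<delta>_int by (intro alg_ints_mult alg_ints_prod m) auto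
        finally show "of_int m / \<delta> y \<in> alg_ints" .
      qed
      finally show ?thesis .
    qed
    hence "of_int m * coeff h i \<in> \<int>" for i using alg_ints_of_rat by blast
    hence eq: "smult (of_int m) h = map_poly of_int (map_poly floor (smult (of_int m) h))"
      by (intro poly_eqI) (simp add: coeff_map_poly)
    have "of_int m * x = eval_rat (smult (of_int m) h) \<theta>" by (simp add: xh)
    also have "\<dots> = eval_int (map_poly floor (smult (of_int m) h)) \<theta>" by (subst eq) (rule eval_rat_int)
    finally show ?thesis by blast
  qed
  with m(1) show ?thesis by blast
qed

text \<open>The subring property carries the congruence from \<theta> to \<open>m * x\<close> for
  every integral \<open>x\<close>; since \<open>p\<close> does not divide \<open>m\<close>, the
  factor \<open>m\<close> can be cancelled.\<close>

lemma frobenius_poly_Int_Q: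
  "\<exists>b. \<forall>p. prime p \<longrightarrow> b < p \<longrightarrow> \<theta> \<in> frobenius_fixed p \<longrightarrow>
     smult (1 / of_nat p) (monom 1 p - [:0, 1:]) \<in> Int_Q (ring_of_ints (rat_adjoin \<theta>))"
proof -
  obtain m :: int where m: "m \<noteq> 0" "\<And>x. x \<in> rat_adjoin \<theta> \<Longrightarrow> x \<in> alg_ints \<Longrightarrow> \<exists>g. of_int m * x = eval_int g \<theta>"
    using integral_coordinates by blast
  have "smult (1 / of_nat p) (monom 1 p - [:0, 1:]) \<in> Int_Q (ring_of_ints (rat_adjoin \<theta>))"
    if p: "prime p" "nat \<bar>m\<bar> < p" "\<theta> \<in> frobenius_fixed p" for p
    unfolding Int_Q_def
  proof (intro CollectI image_subsetI)
    fix x assume "x \<in> ring_of_ints (rat_adjoin \<theta>)"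
    hence x: "x \<in> rat_adjoin \<theta>" "x \<in> alg_ints" by (auto simp: ring_of_ints_def)
    let ?h = "smult (1 / of_nat p) (monom 1 p - [:0, 1:]) :: rat poly"
    have h: "eval_rat ?h x = (x ^ p - x) / of_nat p" by (simp add: of_rat_divide)
    have sub: "is_subring (frobenius_fixed p :: 'a set)" by (rule is_subring_frobenius_fixed[OF p(1)])
    obtain g where g: "of_int m * x = eval_int g \<theta>" using m(2)[OF x] by blast
    have "of_int m * x \<in> frobenius_fixed p" unfolding g by (rule is_subring_eval_int[OF sub p(3)])
    moreover have "(of_int m :: 'a) \<in> frobenius_fixed p" by (rule is_subring_closed(6)[OF sub])
    ultimately have mx: "(of_int m * x) ^ p - of_int m * x \<in> ai_multiples p" "(of_int m :: 'a) ^ p - of_int m \<in> ai_multiples p"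
      by (simp_all add: frobenius_fixed_def)
    have "of_int m * (x ^ p - x) = ((of_int m * x) ^ p - of_int m * x) - (of_int m ^ p - of_int m) * x ^ p"
      by (simp add: power_mult_distrib algebra_simps)
    also have "\<dots> \<in> ai_multiples p" by (intro ai_multiples_diff ai_multiples_mult mx alg_ints_power x)
    finally have mult: "of_int m * (x ^ p - x) \<in> ai_multiples p" .
    have "coprime m (int p)"
    proof -
      have "\<not> int p dvd m" using m(1) p(2) dvd_imp_le_int[of m "int p"] by auto
      hence "coprime (int p) m" using p(1) by (intro prime_imp_coprime) auto
      thus ?thesis by (simp add: coprime_commute)
    qed
    hence "x ^ p - x \<in> ai_multiples p"
      by (rule ai_multiples_cancel_coprime[OF alg_ints_diff[OF alg_ints_power[OF x(2)] x(2)] _ mult])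
    then obtain z where "z \<in> alg_ints" "x ^ p - x = of_nat p * z" by (auto simp: ai_multiples_def)
    moreover have "p \<noteq> 0" using p(1) by auto
    ultimately have "eval_rat ?h x \<in> alg_ints" unfolding h by simp
    moreover have "eval_rat ?h x \<in> rat_adjoin \<theta>" by (rule rat_adjoin_eval[OF x(1)])
    ultimately show "eval_rat ?h x \<in> ring_of_ints (rat_adjoin \<theta>)" by (simp add: ring_of_ints_def)
  qed
  thus ?thesis by blast
qed

end

section \<open>Number fields\<close>

lemma is_subfield_imp_is_subring: "is_subfield K \<Longrightarrow> is_subring K"
  by (auto simp: is_subfield_def is_subring_def)

text \<open>A spanning set, scaled to consist of algebraic integers, has a primitive element in
  \<open>K\<close> because \<open>K\<close> is a subring.\<close>

lemma number_field_primitive: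
  fixes K :: "'a::{alg_closed_field, field_char_0} set"
  assumes alg: "\<forall>x::'a. algebraic x" and K: "number_field K"
  obtains \<theta> where "\<theta> \<in> alg_ints" "K = rat_adjoin \<theta>"
proof -
  interpret vs: vector_space "\<lambda>(q::rat) (x::'a). of_rat q * x" by (rule rat_vector_space)
  from K obtain B where sf: "is_subfield K" and B: "finite B" "K = vs.span B"
    by (auto simp: number_field_def)
  have "\<forall>x::'a. \<exists>n::nat. n > 0 \<and> of_nat n * x \<in> alg_ints"
    using alg integral_multiple by metis
  then obtain N :: "'a \<Rightarrow> nat" where N: "\<And>x. N x > 0" "\<And>x. of_nat (N x) * x \<in> alg_ints" by metis
  define B' where "B' = (\<lambda>x. of_nat (N x) * x) ` B"
  have B': "finite B'" "B' \<subseteq> alg_ints" using B(1) N(2) by (auto simp: B'_def)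
  obtain \<theta> where \<theta>: "\<theta> \<in> alg_ints" "B' \<subseteq> rat_adjoin \<theta>" "\<And>R. is_subring R \<Longrightarrow> B' \<subseteq> R \<Longrightarrow> \<theta> \<in> R"
    using primitive_element[OF B'] by auto
  have BK: "B \<subseteq> K" unfolding B(2) by (rule vs.span_superset)
  have "of_nat n * x \<in> K" if "x \<in> K" for n x
    using is_subfield_eval_rat[OF sf that, of "[:0, of_nat n:]"] by (simp add: mult.commute)
  hence "B' \<subseteq> K" using BK by (auto simp: B'_def)
  hence "\<theta> \<in> K" by (rule \<theta>(3)[OF is_subfield_imp_is_subring[OF sf]])
  hence "rat_adjoin \<theta> \<subseteq> K" using is_subfield_eval_rat[OF sf] by (auto simp: rat_adjoin_def)
  moreover have "K \<subseteq> rat_adjoin \<theta>"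
    unfolding B(2)
  proof (rule vs.span_minimal)
    show "B \<subseteq> rat_adjoin \<theta>"
    proof
      fix x assume "x \<in> B"
      hence "of_nat (N x) * x \<in> rat_adjoin \<theta>" using \<theta>(2) by (auto simp: B'_def)
      hence "of_rat (1 / of_nat (N x)) * (of_nat (N x) * x) \<in> rat_adjoin \<theta>"
        by (rule rat_adjoin_mult[OF rat_adjoin_of_rat])
      also have "of_rat (1 / of_nat (N x)) * (of_nat (N x) * x) = x" using N(1)[of x] by (simp add: of_rat_divide)
      finally show "x \<in> rat_adjoin \<theta>" .
    qed
    show "vs.subspace (rat_adjoin \<theta>)"
      unfolding vs.subspace_def using rat_adjoin_of_rat[of 0 \<theta>]
      by (auto intro: rat_adjoin_add rat_adjoin_mult rat_adjoin_of_rat)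
  qed
  ultimately show ?thesis using \<theta>(1) that by blast
qed

lemma galois_imp_galois_element:
  fixes \<theta> :: "'a::{alg_closed_field, field_char_0}"
  assumes \<theta>: "\<theta> \<in> alg_ints" and normal: "normal_over_Q (rat_adjoin \<theta>)"
  obtains F where "galois_element \<theta> F"
proof (rule galois_element_exists[OF \<theta>])
  have "algebraic \<theta>" using \<theta> by (auto simp: alg_ints_def)
  then obtain f :: "rat poly" where f: "irreducible f" "eval_rat f \<theta> = 0" using min_poly_exists by metis
  then obtain c xs where cx: "set xs \<subseteq> rat_adjoin \<theta>" "map_poly of_rat f = smult c (\<Prod>x\<leftarrow>xs. [:- x, 1:])"
    using normal rat_adjoin_self unfolding normal_over_Q_def by blast
  have "f \<noteq> 0" using f by auto
  hence "c \<noteq> 0" using cx(2) by auto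
  fix y :: 'a assume "\<And>h. eval_rat h \<theta> = 0 \<Longrightarrow> eval_rat h y = 0"
  hence "poly (smult c (\<Prod>x\<leftarrow>xs. [:- x, 1:])) y = 0" using f(2) by (simp add: eval_rat_def flip: cx(2))
  hence "(\<Prod>x\<leftarrow>xs. y - x) = 0" using \<open>c \<noteq> 0\<close> by (simp add: poly_prod_list o_def)
  hence "y \<in> set xs" by (auto simp: prod_list_zero_iff)
  thus "y \<in> rat_adjoin \<theta>" using cx(1) by blast
qed (use that in blast)

definition integrality_locus :: "'a::field_char_0 set \<Rightarrow> 'a set" where
  "integrality_locus K = {\<alpha> \<in> alg_ints. values_at (Int_Q (ring_of_ints K)) \<alpha> \<subseteq> alg_ints}"

lemma ring_of_ints_subset_locus: "ring_of_ints K \<subseteq> integrality_locus K"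
  by (auto simp: integrality_locus_def values_at_def Int_Q_def ring_of_ints_def)

lemma locus_eq_of_galois:
  fixes K :: "'a::{alg_closed_field, field_char_0} set"
  assumes alg: "\<forall>x::'a. algebraic x" and K: "number_field K" and gal: "galois_over_Q K"
  shows "integrality_locus K = ring_of_ints K"
proof (rule antisym[OF _ ring_of_ints_subset_locus], rule subsetI)
  fix \<alpha> assume \<alpha>: "\<alpha> \<in> integrality_locus K"
  hence \<alpha>_int: "\<alpha> \<in> alg_ints" by (simp add: integrality_locus_def)
  obtain \<theta> where \<theta>: "\<theta> \<in> alg_ints" "K = rat_adjoin \<theta>" using number_field_primitive[OF alg K] .
  obtain F where F: "galois_element \<theta> F"
    using galois_imp_galois_element[OF \<theta>(1)] gal \<theta>(2) by (auto simp: galois_over_Q_def)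
  interpret galois_element \<theta> F by fact
  obtain b where b: "\<And>p. prime p \<Longrightarrow> b < p \<Longrightarrow> \<theta> \<in> frobenius_fixed p \<Longrightarrow>
     smult (1 / of_nat p) (monom 1 p - [:0, 1:]) \<in> Int_Q (ring_of_ints (rat_adjoin \<theta>))"
    using frobenius_poly_Int_Q by blast
  have "\<alpha> \<in> frobenius_fixed p" if p: "prime p" "b < p" "\<theta> \<in> frobenius_fixed p" for p
  proof -
    let ?h = "smult (1 / of_nat p) (monom 1 p - [:0, 1:]) :: rat poly"
    have "eval_rat ?h \<alpha> \<in> values_at (Int_Q (ring_of_ints K)) \<alpha>"
      unfolding values_at_def \<theta>(2) using b[OF p] by blast
    hence "eval_rat ?h \<alpha> \<in> alg_ints" using \<alpha> by (auto simp: integrality_locus_def)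
    moreover have "\<alpha> ^ p - \<alpha> = of_nat p * eval_rat ?h \<alpha>" using p(1) by (auto simp: of_rat_divide)
    ultimately have "\<alpha> ^ p - \<alpha> \<in> ai_multiples p" by (rule ai_multiplesI)
    thus ?thesis using \<alpha>_int by (simp add: frobenius_fixed_def)
  qed
  hence "\<alpha> \<in> K" unfolding \<theta>(2) by (rule frobenius_fixed_imp_mem[OF F \<alpha>_int])
  thus "\<alpha> \<in> ring_of_ints K" using \<alpha>_int by (simp add: ring_of_ints_def)
qed

lemma mem_of_multiple_mem:
  assumes K: "is_subfield K" and "n > 0" "of_nat n * x \<in> K"
  shows "x \<in> (K :: 'a::field_char_0 set)"
proof -
  have "eval_rat [:0, 1 / of_nat n:] (of_nat n * x) \<in> K" using is_subfield_eval_rat[OF K assms(3)] .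
  thus ?thesis using assms(2) by (simp add: of_rat_divide)
qed

text \<open>Let \<open>y\<close> be a conjugate of \<open>x \<in> K\<close>, and \<open>n\<close>
  such that \<open>n * x\<close> is integral. For integer-valued \<open>f\<close>, the integrality
  of \<open>f(n * x)\<close> passes to \<open>f(n * y)\<close>, so \<open>n * y\<close> belongs to
  the locus and thus to \<open>K\<close>.\<close>

lemma galois_of_locus_eq:
  fixes K :: "'a::{alg_closed_field, field_char_0} set"
  assumes alg: "\<forall>x::'a. algebraic x" and K: "number_field K" and eq: "integrality_locus K = ring_of_ints K"
  shows "galois_over_Q K"
proof -
  have sf: "is_subfield K" using K by (simp add: number_field_def)
  have "\<exists>c xs. set xs \<subseteq> K \<and> map_poly of_rat p = smult c (\<Prod>x\<leftarrow>xs. [:- x, 1:])"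
    if p: "irreducible (p :: rat poly)" and x: "x \<in> K" "eval_rat p x = 0" for p x
  proof -
    have root: "y \<in> K" if y: "eval_rat p y = 0" for y
    proof -
      obtain n :: nat where n: "n > 0" "of_nat n * x \<in> alg_ints" using integral_multiple alg by blast
      have nz: "eval_rat [:0, of_nat n:] z = of_nat n * z" for z :: 'a by (simp add: mult.commute)
      have "of_nat n * x \<in> K" using is_subfield_eval_rat[OF sf x(1), of "[:0, of_nat n:]"] unfolding nz .
      hence nx: "of_nat n * x \<in> ring_of_ints K" using n(2) by (simp add: ring_of_ints_def)
      have "of_nat n * y \<in> alg_ints"
        using conjugate_eval_alg_int[OF p x(2) y, of "[:0, of_nat n:]"] n(2) unfolding nz by simp
      moreover have "eval_rat f (of_nat n * y) \<in> alg_ints" if f: "f \<in> Int_Q (ring_of_ints K)" for f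
      proof -
        have "eval_rat f (of_nat n * x) \<in> alg_ints" using f nx by (auto simp: Int_Q_def ring_of_ints_def)
        hence "eval_rat (pcompose f [:0, of_nat n:]) x \<in> alg_ints"
          unfolding eval_rat_simps(13) nz .
        from conjugate_eval_alg_int[OF p x(2) y this]
        show ?thesis unfolding eval_rat_simps(13) nz .
      qed
      ultimately have "of_nat n * y \<in> integrality_locus K"
        by (auto simp: integrality_locus_def values_at_def)
      hence "of_nat n * y \<in> K" unfolding eq by (simp add: ring_of_ints_def)
      thus ?thesis by (rule mem_of_multiple_mem[OF sf n(1)])
    qed
    have p0: "p \<noteq> 0" using p by auto
    then obtain A where A: "(map_poly of_rat p :: 'a poly) = smult (lead_coeff (map_poly of_rat p)) (\<Prod>x\<in>#A. [:- x, 1:])"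
      using alg_closed_imp_factorization[of "map_poly of_rat p :: 'a poly"] by auto
    obtain xs where xs: "mset xs = A" using ex_mset by blast
    have eq_list: "(\<Prod>x\<in>#A. [:- x, 1:]) = (\<Prod>x\<leftarrow>xs. [:- x, 1:])"
      unfolding xs[symmetric] mset_map[symmetric] by (rule prod_mset_prod_list)
    from A have fac: "(map_poly of_rat p :: 'a poly) = smult (lead_coeff (map_poly of_rat p)) (\<Prod>x\<leftarrow>xs. [:- x, 1:])"
      unfolding eq_list .
    have "set xs \<subseteq> K"
    proof
      fix y assume y: "y \<in> set xs"
      have "eval_rat p y = 0" unfolding eval_rat_def
        by (subst fac) (use y in \<open>auto simp: poly_prod_list prod_list_zero_iff image_iff\<close>)
      thus "y \<in> K" by (rule root)
    qed
    with fac show ?thesis by blast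
  qed
  hence "normal_over_Q K" unfolding normal_over_Q_def by blast
  moreover have "separable_over_Q K" unfolding separable_over_Q_def by (auto intro: irreducible_rsquarefree)
  ultimately show ?thesis by (simp add: galois_over_Q_def)
qed

text \<open>Each element of \<open>K\<close> has an integral multiple by a positive integer, so the
  field is recovered from its ring of integers.\<close>

lemma number_field_subset_of_ring_of_ints:
  fixes K :: "'a::field_char_0 set"
  assumes alg: "\<forall>x::'a. algebraic x" and "is_subfield K" "is_subfield K'" "ring_of_ints K \<subseteq> ring_of_ints K'"
  shows "K \<subseteq> K'"
proof
  fix x assume x: "x \<in> K"
  obtain n :: nat where n: "n > 0" "of_nat n * x \<in> alg_ints" using integral_multiple alg by blast
  have "eval_rat [:0, of_nat n:] x \<in> K" by (rule is_subfield_eval_rat[OF assms(2) x])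
  hence "of_nat n * x \<in> ring_of_ints K" using n(2) by (simp add: ring_of_ints_def mult.commute)
  hence "of_nat n * x \<in> K'" using assms(4) by (auto simp: ring_of_ints_def)
  thus "x \<in> K'" by (rule mem_of_multiple_mem[OF assms(3) n(1)])
qed

theorem theorem2p7:
  assumes algebraic_closure: "\<forall>x::'a::{alg_closed_field, field_char_0}. algebraic x"
  shows "(\<forall>K::'a set. number_field K \<longrightarrow>
            (galois_over_Q K \<longleftrightarrow>
               {\<alpha> \<in> alg_ints. values_at (Int_Q (ring_of_ints K)) \<alpha> \<subseteq> alg_ints} = ring_of_ints K)) \<and>
         (\<forall>K K' :: 'a set. number_field K \<and> galois_over_Q K \<and> number_field K' \<and> galois_over_Q K' \<and>
            Int_Q (ring_of_ints K) = Int_Q (ring_of_ints K') \<longrightarrow> K = K')"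
  unfolding integrality_locus_def[symmetric]
proof (intro conjI allI impI iffI)
  fix K :: "'a set" assume "number_field K"
  thus "galois_over_Q K \<Longrightarrow> integrality_locus K = ring_of_ints K"
    "integrality_locus K = ring_of_ints K \<Longrightarrow> galois_over_Q K"
    using locus_eq_of_galois galois_of_locus_eq algebraic_closure by blast+
next
  fix K K' :: "'a set"
  assume KK: "number_field K \<and> galois_over_Q K \<and> number_field K' \<and> galois_over_Q K' \<and>
    Int_Q (ring_of_ints K) = Int_Q (ring_of_ints K')"
  have sf: "is_subfield K" "is_subfield K'" using KK by (auto simp: number_field_def)
  \<comment> \<open>The locus depends on the field only through its integer-valued
    polynomials.\<close>
  have "integrality_locus K = integrality_locus K'" using KK by (simp add: integrality_locus_def)
  moreover have "integrality_locus K = ring_of_ints K" "integrality_locus K' = ring_of_ints K'"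
    using KK by (simp_all add: locus_eq_of_galois[OF algebraic_closure])
  ultimately have "ring_of_ints K = ring_of_ints K'" by simp
  thus "K = K'"
    using number_field_subset_of_ring_of_ints[OF algebraic_closure] sf by (intro equalityI) auto
qed

end
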